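(* Let $N=d+m$. Assume $\mathcal Y=\mathscr A(\mathcal X^* )+\mathcal E$, where $\mathcal X^*\in\mathbb R^{p_1\times\cdots\times p_N}$ has Tucker rank $\mathbf r^*=(r_1^*,\dots,r_N^* )$, and let $\mathbf r=(r_1,\dots,r_N)\ge\mathbf r^*$ (entrywise) be the input rank. Let $\underline\lambda:=\min_{k=1,\dots,N}\sigma_{r_k^*}(\mathcal M_k(\mathcal X^* ))$. Suppose $\mathscr A$ satisfies $2\mathbf r$-TRIP and that $$\|\mathcal X^0-\mathcal X^*\|_F\le \frac{R_{2\mathbf r}}{N(1+R_{2\mathbf r+\mathbf r^*}-R_{2\mathbf r})}\,\underline\lambda,\qquad R_{2\mathbf r}\le\frac{1}{8(\sqrt{N}+1)+1},$$ $$\underline\lambda\ \ge\ \frac{2(1+R_{2\mathbf r+\mathbf r^*}-R_{2\mathbf r})(\sqrt{N}+1)N}{R_{2\mathbf r}(1-R_{2\mathbf r})}\,\big\|(\mathscr A^*(\mathcal E))_{\max(2\mathbf r)}\big\|_F$$ (with $R_{2\mathbf r}>0$). Then the iterates $\mathcal X^t$ of Riemannian gradient descent (RGD) started at $\mathcal X^0$ satisfy, for all $t\ge 0$, $$\|\mathcal X^t-\mathcal X^*\|_F\le 2^{-t}\|\mathcal X^0-\mathcal X^*\|_F+\frac{2(\sqrt{N}+1)}{1-R_{2\mathbf r}}\big\|(\mathscr A^*(\mathcal E))_{\max(2\mathbf r)}\big\|_F .$$ In particular, if $\mathcal E=0$, then $\|\mathcal X^t-\mathcal X^*\|_F\le 2^{-t}\|\mathcal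 X^0-\mathcal X^*\|_F$ for all $t\ge0$.
   Context: Tensor notation. For an order-$N$ tensor $\mathcal X\in\mathbb R^{p_1\times\cdots\times p_N}$, $\mathcal M_k(\mathcal X)\in\mathbb R^{p_k\times\prod_{j\ne k}p_j}$ is the mode-$k$ matricization (columns indexed by the other modes, earlier modes varying fastest), $\mathcal T_k$ is its inverse, $\mathcal X\times_k B$ is the mode-$k$ product with matrix $B$ (so $\mathcal M_k(\mathcal X\times_kB)=B\mathcal M_k(\mathcal X)$), and the Tucker rank is $(\mathrm{rank}\,\mathcal M_k(\mathcal X))_{k}$. $\sigma_j(\cdot)$ is the $j$th largest singular value. $\mathbb O_{p,r}=\{U\in\mathbb R^{p\times r}:U^\top U=I_r\}$, $P_U=UU^\top$, $P_{U_\perp}=I-UU^\top$. $\mathrm{SVD}_r(D)$ is the matrix of the leading $r$ left singular vectors of $D$ (ordered by decreasing singular value). $\mathcal Z_{\max(\mathbf s)}$ is a best Frobenius-norm approximation of $\mathcal Z$ by tensors of Tucker rank at most $\mathbf s$; $\|\mathcal Z_{\max(\mathbf s)}\|_F=\sup\{\langle\mathcal Z,\mathcal W\rangle:\mathrm{Tucrank}(\mathcal W)\le\mathbf s,\|\mathcal W\|_F\le1\}$. Model. $d\ge1$, $m\ge0$, $N=d+m$. Given $\mathcal A_1,\dots,\mathcal A_n\in\mathbb R^{p_1\times\cdots\times p_d}$, the linear map $\mathscr A:\mathbb R^{p_1\times\cdots\times p_{N}}\to\mathbb R^{n\times p_{d+1}\times\cdots\times p_{N}}$ is $\mathscr A(\mathcal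 X)_{[i,j_1,\dots,j_m]}=\sum_{k_1,\dots,k_d}(\mathcal A_i)_{[k_1,\dots,k_d]}\mathcal X_{[k_1,\dots,k_d,j_1,\dots,j_m]}$; $\mathscr A^*$ is its adjoint. TRIP. For a tuple $\mathbf s$, $R_{\mathbf s}$ is the smallest number such that $(1-R_{\mathbf s})\|\mathcal Z\|_F^2\le\|\mathscr A(\mathcal Z)\|_F^2\le(1+R_{\mathbf s})\|\mathcal Z\|_F^2$ for all $\mathcal Z$ of Tucker rank at most $\mathbf s$ (entries of $\mathbf s$ may exceed $p_k$). $\mathscr A$ satisfies $\mathbf s$-TRIP if $R_{\mathbf s}<1$. Tangent projection. The input rank $\mathbf r$ satisfies $1\le r_k\le p_k$ and $r_k\le\prod_{j\neq k}r_j$. For $\mathcal X=\mathcal S\times_1U_1\cdots\times_NU_N$ of Tucker rank $\mathbf r$ with $U_k=\mathrm{SVD}_{r_k}(\mathcal M_k(\mathcal X))$, let $V_k$ have orthonormal columns ($r_k$ of them) spanning the row space of $\mathcal M_k(\mathcal S)$, $W_k=(U_N\otimes\cdots\otimes U_{k+1}\otimes U_{k-1}\otimes\cdots\otimes U_1)V_k$, and $$P_{T_{\mathcal X}}(\mathcal Z)=\mathcal Z\times_{k=1}^NP_{U_k}+\sum_{k=1}^N\mathcal T_k\big(P_{U_{k\perp}}\mathcal M_k(\mathcal Z)P_{W_k}\big),$$ the orthogonal projector onto the tangent space $T_{\mathcal X}\mathbb M_{\mathbf r}$ at $\mathcal X$ of the manifold $\mathbb M_{\mathbf r}$ of Tucker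 rank-$\mathbf r$ tensors. (If an iterate happens to have smaller Tucker rank, the same formula is used with any choice of $U_k=\mathrm{SVD}_{r_k}(\mathcal M_k(\mathcal X))\in\mathbb O_{p_k,r_k}$ and any $V_k$ with $r_k$ orthonormal columns whose span contains the row space of $\mathcal M_k(\mathcal S)$.) RGD. $\mathcal X^0$ is a given tensor of Tucker rank $\mathbf r$. For $t\ge0$: $\mathcal G^t=P_{T_{\mathcal X^t}}\mathscr A^*(\mathscr A(\mathcal X^t)-\mathcal Y)$, $\alpha_t=\|\mathcal G^t\|_F^2/\|\mathscr A(\mathcal G^t)\|_F^2$, $\mathcal X^{t+0.5}=\mathcal X^t-\alpha_t\mathcal G^t$ (equal to $\mathcal X^t$ if $\mathcal G^t=0$), $\mathcal X^{t+1}=\mathcal H_{\mathbf r}(\mathcal X^{t+0.5})$. Here $\mathcal H_{\mathbf r}$ is either T-HOSVD, $\mathcal H_{\mathbf r}(\mathcal Z)=\mathcal Z\times_{k=1}^NP_{U_k^0}$ with $U_k^0=\mathrm{SVD}_{r_k}(\mathcal M_k(\mathcal Z))$, or ST-HOSVD, the same with $U_k^0$ computed sequentially as $U_k^0=\mathrm{SVD}_{r_k}(\mathcal M_k(\mathcal Z\times_{l=1}^{k-1}P_{U_l^0}))$. *)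

theory Defs
  imports
    Complex_Main
    "HOL-Library.Function_Algebras"
    "Jordan_Normal_Form.DL_Rank"
    "Jordan_Normal_Form.Char_Poly"
begin

section \<open>Matrices\<close>

definition orth_proj :: "real mat \<Rightarrow> real mat" where
  "orth_proj U = U * U\<^sup>T"

definition orthonormal_mats :: "nat \<Rightarrow> nat \<Rightarrow> real mat set" where
  "orthonormal_mats p r = {U \<in> carrier_mat p r. U\<^sup>T * U = 1\<^sub>m r}"

definition is_svd :: "real mat \<Rightarrow> real mat \<Rightarrow> real mat \<Rightarrow> real mat \<Rightarrow> bool" where
  "is_svd D U S V \<longleftrightarrow>
     U \<in> orthonormal_mats (dim_row D) (dim_row D) \<and>
     V \<in> orthonormal_mats (dim_col D) (dim_col D) \<and>
     S \<in> carrier_mat (dim_row D) (dim_col D) \<and>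
     (\<forall>i<dim_row D. \<forall>j<dim_col D. i \<noteq> j \<longrightarrow> S $$ (i, j) = 0) \<and>
     (\<forall>i<min (dim_row D) (dim_col D). 0 \<le> S $$ (i, i)) \<and>
     (\<forall>j<min (dim_row D) (dim_col D). \<forall>i\<le>j. S $$ (j, j) \<le> S $$ (i, i)) \<and>
     D = U * S * V\<^sup>T"

text \<open>\<open>SVD\<^sub>r(D)\<close> is not unique when singular values coincide or vanish, so it is a relation:
  \<open>is_SVD r D U\<close> means that \<open>U\<close> is one of the admissible values of \<open>SVD\<^sub>r(D)\<close>.\<close>

definition is_SVD :: "nat \<Rightarrow> real mat \<Rightarrow> real mat \<Rightarrow> bool" where
  "is_SVD r D U \<longleftrightarrow> r \<le> dim_row D \<and>
     (\<exists>U' S V. is_svd D U' S V \<and> U = mat (dim_row D) r (\<lambda>(i, j). U' $$ (i, j)))"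

text \<open>\<open>singular_value j D\<close> is the \<open>j\<close>-th largest singular value, counted from \<open>j = 1\<close>: the singular
  values are the square roots of the eigenvalues, with multiplicity, of the positive
  semidefinite matrix \<open>D D\<^sup>T\<close>. The value outside \<open>1 \<le> j \<le> min p q\<close> is \<open>0\<close>.\<close>

definition singular_value :: "nat \<Rightarrow> real mat \<Rightarrow> real" where
  "singular_value j D =
     (if 1 \<le> j \<and> j \<le> min (dim_row D) (dim_col D)
      then rev (sorted_list_of_multiset (image_mset sqrt (proots (char_poly (D * D\<^sup>T))))) ! (j - 1)
      else 0)"

definition kron :: "real mat \<Rightarrow> real mat \<Rightarrow> real mat" where
  "kron A B = mat (dim_row A * dim_row B) (dim_col A * dim_col B)
     (\<lambda>(i, j). A $$ (i div dim_row B, j div dim_col B) * B $$ (i mod dim_row B, j mod dim_col B))"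


section \<open>Tensors\<close>

text \<open>Modes and entries are counted from \<open>0\<close>. A tensor of format \<open>p\<^sub>0 \<times> \<dots> \<times> p\<^sub>N\<^sub>-\<^sub>1\<close> is a function on
  multi-indices that vanishes outside \<open>idx p\<close>, so that equality of tensors is equality of
  functions and the vector space operations are the pointwise ones.\<close>

type_synonym tensor = "nat list \<Rightarrow> real"

definition idx :: "nat list \<Rightarrow> nat list set" where
  "idx p = {i. length i = length p \<and> (\<forall>k<length p. i ! k < p ! k)}"

definition tensors :: "nat list \<Rightarrow> tensor set" where
  "tensors p = {X. \<forall>i. i \<notin> idx p \<longrightarrow> X i = 0}"

definition tinner :: "nat list \<Rightarrow> tensor \<Rightarrow> tensor \<Rightarrow> real" where
  "tinner p X Y = (\<Sum>i\<in>idx p. X i * Y i)"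

definition fnorm :: "nat list \<Rightarrow> tensor \<Rightarrow> real" where
  "fnorm p X = sqrt (\<Sum>i\<in>idx p. (X i)\<^sup>2)"

definition other_dim :: "nat list \<Rightarrow> nat \<Rightarrow> nat" where
  "other_dim p k = (\<Prod>j\<in>{..<length p} - {k}. p ! j)"

text \<open>The multi-index at row \<open>a\<close> and column \<open>b\<close> of the mode-\<open>k\<close> matricization: the entries at the
  modes other than \<open>k\<close> are the mixed-radix digits of \<open>b\<close>, least significant first.\<close>

definition unfold_index :: "nat list \<Rightarrow> nat \<Rightarrow> nat \<Rightarrow> nat \<Rightarrow> nat list" where
  "unfold_index p k a b =
     map (\<lambda>j. if j = k then a else (b div (\<Prod>l\<in>{..<j} - {k}. p ! l)) mod (p ! j)) [0..<length p]"

definition matricize :: "nat list \<Rightarrow> nat \<Rightarrow> tensor \<Rightarrow> real mat" where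
  "matricize p k X = mat (p ! k) (other_dim p k) (\<lambda>(a, b). X (unfold_index p k a b))"

definition tensorize :: "nat list \<Rightarrow> nat \<Rightarrow> real mat \<Rightarrow> tensor" where
  "tensorize p k = inv_into (tensors p) (matricize p k)"

text \<open>\<open>mode_prod p k B X\<close> is \<open>X \<times>\<^sub>k B\<close> for \<open>X\<close> of format \<open>p\<close>; \<open>mode_prods p B k X\<close> is
  \<open>X \<times>\<^sub>0 B\<^sub>0 \<dots> \<times>\<^sub>k\<^sub>-\<^sub>1 B\<^sub>k\<^sub>-\<^sub>1\<close>.\<close>

definition mode_prod :: "nat list \<Rightarrow> nat \<Rightarrow> real mat \<Rightarrow> tensor \<Rightarrow> tensor" where
  "mode_prod p k B X =
     (\<lambda>i. if i \<in> idx (p[k := dim_row B]) then \<Sum>a<p ! k. B $$ (i ! k, a) * X (i[k := a]) else 0)"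

primrec mode_prods :: "nat list \<Rightarrow> (nat \<Rightarrow> real mat) \<Rightarrow> nat \<Rightarrow> tensor \<Rightarrow> tensor" where
  "mode_prods p B 0 X = X"
| "mode_prods p B (Suc k) X =
     mode_prod (map (\<lambda>l. dim_row (B l)) [0..<k] @ drop k p) k (B k) (mode_prods p B k X)"

definition tucrank :: "nat list \<Rightarrow> tensor \<Rightarrow> nat list" where
  "tucrank p X = map (\<lambda>k. vec_space.rank (p ! k) (matricize p k X)) [0..<length p]"

definition tucrank_le :: "nat list \<Rightarrow> tensor \<Rightarrow> nat list \<Rightarrow> bool" where
  "tucrank_le p X s \<longleftrightarrow> list_all2 (\<le>) (tucrank p X) s"

definition best_approx :: "nat list \<Rightarrow> nat list \<Rightarrow> tensor \<Rightarrow> tensor \<Rightarrow> bool" where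
  "best_approx p s Z W \<longleftrightarrow> W \<in> tensors p \<and> tucrank_le p W s \<and>
     (\<forall>W'\<in>tensors p. tucrank_le p W' s \<longrightarrow> fnorm p (Z - W) \<le> fnorm p (Z - W'))"

definition tadjoint :: "nat list \<Rightarrow> nat list \<Rightarrow> (tensor \<Rightarrow> tensor) \<Rightarrow> tensor \<Rightarrow> tensor" where
  "tadjoint p q F Y =
     (THE Z. Z \<in> tensors p \<and> (\<forall>X\<in>tensors p. tinner q (F X) Y = tinner p X Z))"


section \<open>The measurement map\<close>

definition meas :: "nat \<Rightarrow> nat \<Rightarrow> nat list \<Rightarrow> (nat \<Rightarrow> tensor) \<Rightarrow> tensor \<Rightarrow> tensor" where
  "meas n d p A X =
     (\<lambda>i. if i \<in> idx (n # drop d p)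
          then \<Sum>k\<in>idx (take d p). A (hd i) k * X (k @ tl i) else 0)"

definition meas_adj :: "nat \<Rightarrow> nat \<Rightarrow> nat list \<Rightarrow> (nat \<Rightarrow> tensor) \<Rightarrow> tensor \<Rightarrow> tensor" where
  "meas_adj n d p A = tadjoint p (n # drop d p) (meas n d p A)"

definition trip_const :: "nat \<Rightarrow> nat \<Rightarrow> nat list \<Rightarrow> (nat \<Rightarrow> tensor) \<Rightarrow> nat list \<Rightarrow> real" where
  "trip_const n d p A s =
     (LEAST R. \<forall>Z\<in>tensors p. tucrank_le p Z s \<longrightarrow>
        (1 - R) * (fnorm p Z)\<^sup>2 \<le> (fnorm (n # drop d p) (meas n d p A Z))\<^sup>2 \<and>
        (fnorm (n # drop d p) (meas n d p A Z))\<^sup>2 \<le> (1 + R) * (fnorm p Z)\<^sup>2)"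

definition trip :: "nat \<Rightarrow> nat \<Rightarrow> nat list \<Rightarrow> (nat \<Rightarrow> tensor) \<Rightarrow> nat list \<Rightarrow> bool" where
  "trip n d p A s \<longleftrightarrow> trip_const n d p A s < 1"


section \<open>Riemannian gradient descent\<close>

text \<open>\<open>kron_others N U k\<close> is \<open>U\<^sub>N\<^sub>-\<^sub>1 \<otimes> \<dots> \<otimes> U\<^sub>k\<^sub>+\<^sub>1 \<otimes> U\<^sub>k\<^sub>-\<^sub>1 \<otimes> \<dots> \<otimes> U\<^sub>0\<close>.\<close>

definition kron_others :: "nat \<Rightarrow> (nat \<Rightarrow> real mat) \<Rightarrow> nat \<Rightarrow> real mat" where
  "kron_others N U k = fold (\<lambda>j K. kron (U j) K) (filter (\<lambda>j. j \<noteq> k) [0..<N]) (1\<^sub>m 1)"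

text \<open>If \<open>X\<close> has Tucker rank exactly \<open>r\<close>, then both spaces in the last inclusion have dimension
  \<open>r\<^sub>k\<close>, so that the columns of \<open>V\<^sub>k\<close> span the row space of the matricized core tensor.\<close>

definition tangent_frame ::
  "nat list \<Rightarrow> nat list \<Rightarrow> tensor \<Rightarrow> (nat \<Rightarrow> real mat) \<Rightarrow> (nat \<Rightarrow> real mat) \<Rightarrow> bool" where
  "tangent_frame p r X U V \<longleftrightarrow>
     (\<forall>k<length p. is_SVD (r ! k) (matricize p k X) (U k)) \<and>
     (\<exists>S\<in>tensors r. X = mode_prods r U (length p) S \<and>
        (\<forall>k<length p. V k \<in> orthonormal_mats (other_dim r k) (r ! k) \<and>
           vec_space.row_space (other_dim r k) (matricize r k S)
             \<subseteq> vec_space.col_space (other_dim r k) (V k)))"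

definition tangent_proj ::
  "nat list \<Rightarrow> (nat \<Rightarrow> real mat) \<Rightarrow> (nat \<Rightarrow> real mat) \<Rightarrow> tensor \<Rightarrow> tensor" where
  "tangent_proj p U V Z =
     mode_prods p (\<lambda>k. orth_proj (U k)) (length p) Z +
     (\<Sum>k<length p. tensorize p k
        ((1\<^sub>m (p ! k) - orth_proj (U k)) * matricize p k Z * orth_proj (kron_others (length p) U k * V k)))"

text \<open>\<open>t_hosvd p r Z Z'\<close> and \<open>st_hosvd p r Z Z'\<close> mean that \<open>Z'\<close> is an admissible value of
  \<open>\<H>\<^sub>r(Z)\<close>; it depends on the choice of singular vectors.\<close>

definition t_hosvd :: "nat list \<Rightarrow> nat list \<Rightarrow> tensor \<Rightarrow> tensor \<Rightarrow> bool" where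
  "t_hosvd p r Z Z' \<longleftrightarrow>
     (\<exists>U. (\<forall>k<length p. is_SVD (r ! k) (matricize p k Z) (U k)) \<and>
          Z' = mode_prods p (\<lambda>k. orth_proj (U k)) (length p) Z)"

definition st_hosvd :: "nat list \<Rightarrow> nat list \<Rightarrow> tensor \<Rightarrow> tensor \<Rightarrow> bool" where
  "st_hosvd p r Z Z' \<longleftrightarrow>
     (\<exists>U. (\<forall>k<length p.
             is_SVD (r ! k) (matricize p k (mode_prods p (\<lambda>l. orth_proj (U l)) k Z)) (U k)) \<and>
          Z' = mode_prods p (\<lambda>k. orth_proj (U k)) (length p) Z)"

definition rgd_step ::
  "nat \<Rightarrow> nat \<Rightarrow> nat list \<Rightarrow> (nat \<Rightarrow> tensor) \<Rightarrow> tensor \<Rightarrow> nat list \<Rightarrow>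
   (tensor \<Rightarrow> tensor \<Rightarrow> bool) \<Rightarrow> tensor \<Rightarrow> tensor \<Rightarrow> bool" where
  "rgd_step n d p A Y r H X X' \<longleftrightarrow>
     (\<exists>U V G \<alpha> Xh.
        tangent_frame p r X U V \<and>
        G = tangent_proj p U V (meas_adj n d p A (meas n d p A X - Y)) \<and>
        \<alpha> = (fnorm p G)\<^sup>2 / (fnorm (n # drop d p) (meas n d p A G))\<^sup>2 \<and>
        Xh = (if G = 0 then X else X - (\<lambda>i. \<alpha> * G i)) \<and>
        H Xh X')"

definition rgd_iterates ::
  "nat \<Rightarrow> nat \<Rightarrow> nat list \<Rightarrow> (nat \<Rightarrow> tensor) \<Rightarrow> tensor \<Rightarrow> nat list \<Rightarrow>
   (tensor \<Rightarrow> tensor \<Rightarrow> bool) \<Rightarrow> (nat \<Rightarrow> tensor) \<Rightarrow> bool" where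
  "rgd_iterates n d p A Y r H X \<longleftrightarrow>
     X 0 \<in> tensors p \<and> tucrank p (X 0) = r \<and>
     (\<forall>t. rgd_step n d p A Y r H (X t) (X (Suc t)))"

end

theory Submission
  imports Defs "HOL-Analysis.L2_Norm" "Jordan_Normal_Form.Schur_Decomposition"
begin

text \<open>Let \<open>T\<close> be the tangent projection at an iterate \<open>X\<close>, let \<open>P\<^sub>k\<close> (\<open>Pm k\<close> below) be the projection of
  mode \<open>k\<close> onto the range of \<open>U\<^sub>k\<close>, and let \<open>R\<^sub>k\<close> (\<open>Wm k\<close> below) multiply the mode-\<open>k\<close> matricization from
  the right by the projection onto the range of \<open>W\<^sub>k\<close>. These are orthogonal projections that fix \<open>X\<close>.
  The \<open>P\<^sub>k\<close> commute with each other and with every \<open>R\<^sub>l\<close>, moreover \<open>P\<^sub>l R\<^sub>k = R\<^sub>k\<close> for \<open>l \<noteq> k\<close>, and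
  \<open>T = P\<^sub>0 \<dots> P\<^sub>N\<^sub>-\<^sub>1 + \<Sum>\<^sub>k (1 - P\<^sub>k) R\<^sub>k\<close>.

  The gradient step splits into a part inside the tangent space, contracted by \<open>2 R\<^sub>2\<^sub>r / (1 - R\<^sub>2\<^sub>r)\<close>
  because tangent vectors have Tucker rank at most \<open>2r\<close>, a part controlled by \<open>X' - T X'\<close>, where \<open>X'\<close> is
  the target, and the noise. Telescoping the product of the \<open>P\<^sub>k\<close> gives
  \<open>\<parallel>X' - T X'\<parallel> \<le> \<Sum>\<^sub>k \<parallel>(1 - P\<^sub>k)(1 - R\<^sub>k) X'\<parallel>\<close>. Inserting \<open>D = D D\<^sup>+ D\<close> for the matricization \<open>D\<close> of \<open>X'\<close> between
  the two projections bounds the \<open>k\<close>-th summand by \<open>\<parallel>(1 - P\<^sub>k) X'\<parallel> \<parallel>(1 - R\<^sub>k) X'\<parallel> / \<lambda>\<close>, and both factors are at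
  most \<open>\<parallel>X - X'\<parallel>\<close> since the projections fix \<open>X\<close>. Hence this part is quadratic in the error. Finally the
  truncated HOSVD increases the distance to \<open>X'\<close> by at most the factor \<open>\<surd>N + 1\<close>.\<close>

section \<open>Real symmetric matrices\<close>

text \<open>Only the initial tensor is known to have Tucker rank exactly \<open>r\<close>, and
  singular vectors are not unique. One step is therefore estimated for every admissible frame, using
  only that its projections are orthogonal and fix the iterate; the singular values that enter are
  those of the target.

  The constants come from three demands. The contraction factor, enlarged by the HOSVD factor
  \<open>s = sqrt N + 1\<close>, must be at most 1/4, which is
  \<open>R2 * (8 * s + 1) \<le> 1\<close>. The quadratic part must stay within another quarter while
  the error is at most twice the admissible initial distance; this fixes that distance. The noise
  \<open>c * \<xi>\<close> added in each step accumulates to at most \<open>2 * c * \<xi>\<close>,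
  and the lower bound on \<open>lam\<close> keeps this within the same distance.

  The third rank, twice \<open>r\<close> plus the rank of the target, arises because the part of the
  error normal to the tangent space is a tangent vector minus the target. The noise is measured by a
  best approximation of rank twice \<open>r\<close> because the tangent projection of the noise
  competes with it.\<close>

lemma mat_mult_index:
  assumes "A \<in> carrier_mat a b" "B \<in> carrier_mat b c" "i < a" "j < c"
  shows "(A * B) $$ (i, j) = (\<Sum>k<b. A $$ (i, k) * B $$ (k, j))"
  using assms by (auto simp: scalar_prod_def atLeast0LessThan intro!: sum.cong)

lemma orthonormal_matsD:
  assumes "U \<in> orthonormal_mats p r"
  shows "U \<in> carrier_mat p r" "U\<^sup>T \<in> carrier_mat r p" "U\<^sup>T * U = 1\<^sub>m r"
  using assms by (auto simp: orthonormal_mats_def)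

lemma orthonormal_mats_square:
  assumes "U \<in> orthonormal_mats p p"
  shows "U * U\<^sup>T = 1\<^sub>m p"
  using mat_mult_left_right_inverse[OF orthonormal_matsD(2)[OF assms] orthonormal_matsD(1)[OF assms]
      orthonormal_matsD(3)[OF assms]] .

lemma orthonormal_mats_mult:
  assumes "U \<in> orthonormal_mats a b" "V \<in> orthonormal_mats b c"
  shows "U * V \<in> orthonormal_mats a c"
proof -
  note U = orthonormal_matsD[OF assms(1)] and V = orthonormal_matsD[OF assms(2)]
  have "(U * V)\<^sup>T * (U * V) = V\<^sup>T * U\<^sup>T * (U * V)"
    using U V by (simp add: transpose_mult)
  also have "\<dots> = V\<^sup>T * (U\<^sup>T * U * V)"
    using assoc_mult_mat[OF V(2) U(2), of "U * V" c] assoc_mult_mat[OF U(2,1) V(1)] U V by simp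
  also have "\<dots> = 1\<^sub>m c" unfolding U(3) using V by simp
  finally show ?thesis using U V by (simp add: orthonormal_mats_def)
qed

lemma orthonormal_matsI:
  assumes "U \<in> carrier_mat p r"
    and "\<And>i j. i < r \<Longrightarrow> j < r \<Longrightarrow> (\<Sum>k<p. U $$ (k, i) * U $$ (k, j)) = (if i = j then 1 else 0)"
  shows "U \<in> orthonormal_mats p r"
proof -
  have "U\<^sup>T * U = 1\<^sub>m r"
    using assms by (intro eq_matI) (auto simp: mat_mult_index[of _ r p _ r] simp del: index_mult_mat(1))
  then show ?thesis using assms by (simp add: orthonormal_mats_def)
qed

lemma orthonormal_mats_col_sum:
  assumes "U \<in> orthonormal_mats p r" "i < r" "j < r"
  shows "(\<Sum>k<p. U $$ (k, i) * U $$ (k, j)) = (if i = j then 1 else 0)"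
proof -
  note U = orthonormal_matsD[OF assms(1)]
  have "(U\<^sup>T * U) $$ (i, j) = (\<Sum>k<p. U $$ (k, i) * U $$ (k, j))"
    using U(1) assms(2,3) by (simp add: mat_mult_index[of _ r p _ r] del: index_mult_mat(1))
  then show ?thesis unfolding U(3) using assms by simp
qed

text \<open>Over the complex numbers the characteristic polynomial has a root \<open>e\<close>, with
  eigenvector \<open>v\<close>. The Hermitian form of \<open>A\<close> at \<open>v\<close> is
  \<open>e\<close> times a positive number, and it is its own conjugate because \<open>A\<close> is
  real and symmetric. So \<open>e\<close> is real, and hence a root of the real characteristic
  polynomial.\<close>

lemma symmetric_real_eigenvalue:
  fixes A :: "real mat"
  assumes A: "A \<in> carrier_mat n n" and sym: "A\<^sup>T = A" and n: "n \<noteq> 0"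
  shows "\<exists>e. eigenvalue A e"
proof -
  let ?C = "map_mat complex_of_real A"
  have C: "?C \<in> carrier_mat n n" using A by simp
  obtain as where as: "char_poly ?C = (\<Prod>a\<leftarrow>as. [:- a, 1:])" "length as = n"
    using char_poly_factorized[OF C] by auto
  then obtain e as' where "as = e # as'" using n by (cases as) auto
  then have root: "poly (char_poly ?C) e = 0" using as by simp
  then obtain v where v: "v \<in> carrier_vec n" "v \<noteq> 0\<^sub>v n" "?C *\<^sub>v v = e \<cdot>\<^sub>v v"
    using C by (auto simp: eigenvalue_root_char_poly[OF C, symmetric] eigenvalue_def eigenvector_def)
  have Cv: "(\<Sum>j<n. of_real (A $$ (i, j)) * v $ j) = e * v $ i" if "i < n" for i
  proof -
    have "(?C *\<^sub>v v) $ i = (\<Sum>j<n. of_real (A $$ (i, j)) * v $ j)"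
      using that v(1) A by (auto simp: scalar_prod_def atLeast0LessThan intro!: sum.cong)
    then show ?thesis unfolding v(3) using v(1) that by simp
  qed
  define s where "s = (\<Sum>i<n. cnj (v $ i) * (\<Sum>j<n. of_real (A $$ (i, j)) * v $ j))"
  define q where "q = (\<Sum>i<n. (cmod (v $ i))\<^sup>2)"
  have s: "s = e * of_real q"
    unfolding s_def q_def of_real_sum sum_distrib_left[of e]
    by (rule sum.cong) (auto simp: Cv complex_norm_square simp del: of_real_power)
  have "cnj s = (\<Sum>i<n. \<Sum>j<n. v $ i * of_real (A $$ (i, j)) * cnj (v $ j))"
    by (simp add: s_def sum_distrib_left mult_ac)
  also have "\<dots> = (\<Sum>j<n. \<Sum>i<n. v $ i * of_real (A $$ (i, j)) * cnj (v $ j))"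
    by (rule sum.swap)
  also have "\<dots> = s"
  proof -
    have "A $$ (i, j) = A $$ (j, i)" if "i < n" "j < n" for i j
      using arg_cong[OF sym, of "\<lambda>M. M $$ (i, j)"] that A by simp
    then show ?thesis unfolding s_def sum_distrib_left
      by (intro sum.cong refl) (auto simp: mult_ac)
  qed
  finally have "cnj s = s" .
  moreover have "q > 0"
  proof -
    obtain i where "i < n" "v $ i \<noteq> 0" using v by (metis carrier_vecD eq_vecI index_zero_vec)
    then have "(cmod (v $ i))\<^sup>2 > 0" "i \<in> {..<n}" by auto
    then show ?thesis unfolding q_def by (intro sum_pos2[of _ i]) auto
  qed
  ultimately have "cnj e = e" unfolding s by simp
  then have e: "e = of_real (Re e)" by (simp add: complex_eq_iff)
  have "poly (map_poly of_real (char_poly A)) (complex_of_real (Re e)) = 0"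
    using root e by (simp add: of_real_hom.char_poly_hom[OF A])
  then have "poly (char_poly A) (Re e) = 0" by (simp only: of_real_hom.poly_map_poly of_real_eq_0_iff)
  then show ?thesis using eigenvalue_root_char_poly[OF A] by auto
qed

text \<open>Gram-Schmidt, started from a basis that begins with \<open>v\<close>, keeps its first
  vector but does not normalize. Dividing every column by its length \<open>nn\<close> leaves a
  multiple of \<open>v\<close> in front, which is enough when \<open>v\<close> is an
  eigenvector.\<close>

lemma orthonormal_completion:
  fixes v :: "real vec"
  assumes v: "v \<in> carrier_vec n" "v \<noteq> 0\<^sub>v n"
  obtains W c where "W \<in> orthonormal_mats n n" "col W 0 = c \<cdot>\<^sub>v v"
proof -
  interpret cof_vec_space n "TYPE(real)" .
  define b where "b = basis_completion v"
  define ws where "ws = gram_schmidt n b"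
  note bc = basis_completion[OF v, folded b_def]
  have n: "n \<noteq> 0" using v by auto
  note gs = gram_schmidt_result[OF bc(2,4,5) ws_def]
  have len: "length ws = n" using gs(4) bc(6) by simp
  have hd: "ws ! 0 = v"
  proof -
    have "b = v # tl b" using bc(6,7) n by (cases b) auto
    then have "hd ws = v" using gram_schmidt_hd[OF v(1), of "tl b"] by (simp add: ws_def)
    then show ?thesis using len n by (metis hd_conv_nth length_0_conv)
  qed
  have wsc: "ws ! i \<in> carrier_vec n" if "i < n" for i using gs(3) len that by auto
  have orth: "(\<Sum>k<n. ws ! i $ k * ws ! j $ k) = 0 \<longleftrightarrow> i \<noteq> j" if "i < n" "j < n" for i j
    using corthogonalD[OF gs(2), of i j] that len wsc[of j]
    by (simp add: scalar_prod_def atLeast0LessThan)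
  define nn where "nn i = sqrt (\<Sum>k<n. ws ! i $ k * ws ! i $ k)" for i
  have nn: "nn i \<noteq> 0" "nn i * nn i = (\<Sum>k<n. ws ! i $ k * ws ! i $ k)" if "i < n" for i
    using orth[OF that that] by (auto simp: nn_def intro!: abs_of_nonneg sum_nonneg)
  define W where "W = mat n n (\<lambda>(i, j). ws ! j $ i / nn j)"
  have "W \<in> orthonormal_mats n n"
  proof (rule orthonormal_matsI)
    show "W \<in> carrier_mat n n" by (simp add: W_def)
    fix i j assume ij: "i < n" "j < n"
    have "(\<Sum>k<n. W $$ (k, i) * W $$ (k, j)) = (\<Sum>k<n. ws ! i $ k * ws ! j $ k) / (nn i * nn j)"
      unfolding sum_divide_distrib by (rule sum.cong) (auto simp: W_def ij)
    also have "\<dots> = (if i = j then 1 else 0)"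
      using orth[OF ij] nn[OF ij(1)] by auto
    finally show "(\<Sum>k<n. W $$ (k, i) * W $$ (k, j)) = (if i = j then 1 else 0)" .
  qed
  moreover have "col W 0 = (1 / nn 0) \<cdot>\<^sub>v v"
    using n v hd by (intro eq_vecI) (auto simp: W_def)
  ultimately show ?thesis using that by blast
qed

text \<open>Deflation: in an orthonormal basis that starts with an eigenvector, the first column of
  \<open>A'\<close> vanishes below the diagonal, symmetry clears the first row, and the induction
  hypothesis applies to the remaining symmetric block \<open>B\<close>.\<close>

lemma symmetric_real_diagonalization:
  fixes A :: "real mat"
  assumes "A \<in> carrier_mat n n" and "A\<^sup>T = A"
  shows "\<exists>U f. U \<in> orthonormal_mats n n \<and> A = U * mat n n (\<lambda>(i, j). if i = j then f i else 0) * U\<^sup>T"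
  using assms
proof (induction n arbitrary: A)
  case 0
  then show ?case
    by (intro exI[of _ "1\<^sub>m 0"] exI[of _ "\<lambda>_. 0"]) (auto simp: orthonormal_mats_def)
next
  case (Suc n)
  note A = Suc.prems(1) and sym = Suc.prems(2)
  obtain e v where ev: "v \<in> carrier_vec (Suc n)" "v \<noteq> 0\<^sub>v (Suc n)" "A *\<^sub>v v = e \<cdot>\<^sub>v v"
    using symmetric_real_eigenvalue[OF A sym] A by (auto simp: eigenvalue_def eigenvector_def)
  obtain W c where W: "W \<in> orthonormal_mats (Suc n) (Suc n)" and W0: "col W 0 = c \<cdot>\<^sub>v v"
    using orthonormal_completion[OF ev(1,2)] .
  note WD = orthonormal_matsD[OF W]
  define A' where "A' = W\<^sup>T * A * W"
  have A': "A' \<in> carrier_mat (Suc n) (Suc n)" using A WD by (simp add: A'_def)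
  have symA': "A'\<^sup>T = A'"
    using A WD sym
    by (simp add: A'_def transpose_mult[of _ "Suc n" "Suc n" _ "Suc n"]
        assoc_mult_mat[of _ "Suc n" "Suc n" _ "Suc n" _ "Suc n"])
  have AW0: "A *\<^sub>v col W 0 = e \<cdot>\<^sub>v col W 0"
    unfolding W0 using A ev by (simp add: mult_mat_vec smult_smult_assoc mult.commute)
  have col0: "A' $$ (i, 0) = (if i = 0 then e else 0)" if i: "i < Suc n" for i
  proof -
    have AW: "A * W \<in> carrier_mat (Suc n) (Suc n)" using A WD by simp
    have 1: "(A * W) $$ (k, 0) = e * W $$ (k, 0)" if "k < Suc n" for k
    proof -
      have "(A * W) $$ (k, 0) = (A *\<^sub>v col W 0) $ k" using A WD(1) that by simp
      also have "\<dots> = e * W $$ (k, 0)" unfolding AW0 using WD(1) that by simp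
      finally show ?thesis .
    qed
    have "A' $$ (i, 0) = (W\<^sup>T * (A * W)) $$ (i, 0)"
      using A WD by (simp add: A'_def assoc_mult_mat[of _ "Suc n" "Suc n" _ "Suc n" _ "Suc n"])
    also have "\<dots> = (\<Sum>k<Suc n. W $$ (k, i) * (e * W $$ (k, 0)))"
      using i WD(1) by (subst mat_mult_index[OF WD(2) AW]) (auto simp: 1 simp del: sum.lessThan_Suc)
    also have "\<dots> = e * (\<Sum>k<Suc n. W $$ (k, i) * W $$ (k, 0))"
      by (simp add: sum_distrib_left mult_ac del: sum.lessThan_Suc)
    also have "\<dots> = (if i = 0 then e else 0)"
      using orthonormal_mats_col_sum[OF W i, of 0] by simp
    finally show ?thesis .
  qed
  have row0: "A' $$ (0, i) = (if i = 0 then e else 0)" if "i < Suc n" for i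
    using col0[OF that] arg_cong[OF symA', of "\<lambda>M. M $$ (0, i)"] that A' by simp
  define B where "B = mat n n (\<lambda>(i, j). A' $$ (Suc i, Suc j))"
  have B: "B \<in> carrier_mat n n" by (simp add: B_def)
  have "B\<^sup>T = B"
  proof (rule eq_matI)
    fix i j assume "i < dim_row B" "j < dim_col B"
    then show "B\<^sup>T $$ (i, j) = B $$ (i, j)"
      using arg_cong[OF symA', of "\<lambda>M. M $$ (Suc i, Suc j)"] A' by (simp add: B_def)
  qed (auto simp: B_def)
  from Suc.IH[OF B this] obtain U f where U: "U \<in> orthonormal_mats n n"
    and BU: "B = U * mat n n (\<lambda>(i, j). if i = j then f i else 0) * U\<^sup>T" by blast
  note UD = orthonormal_matsD[OF U]
  define D where "D = mat n n (\<lambda>(i, j). if i = j then f i else 0 :: real)"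
  define g where "g i = (case i of 0 \<Rightarrow> e | Suc j \<Rightarrow> f j)" for i
  define U' where "U' = four_block_mat (1\<^sub>m 1) (0\<^sub>m 1 n) (0\<^sub>m n 1) U"
  define D' where "D' = mat (Suc n) (Suc n) (\<lambda>(i, j). if i = j then g i else 0)"
  have D: "D \<in> carrier_mat n n" by (simp add: D_def)
  have U'T: "U'\<^sup>T = four_block_mat (1\<^sub>m 1) (0\<^sub>m 1 n) (0\<^sub>m n 1) U\<^sup>T"
    unfolding U'_def using UD by (subst transpose_four_block_mat[of _ 1 1 _ n _ n]) auto
  have U': "U' \<in> orthonormal_mats (Suc n) (Suc n)"
  proof -
    have "U'\<^sup>T * U' = four_block_mat (1\<^sub>m 1) (0\<^sub>m 1 n) (0\<^sub>m n 1) (1\<^sub>m n)"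
      unfolding U'T unfolding U'_def using UD by (subst mult_four_block_mat[of _ 1 1 _ n _ n _ _ 1 _ n]) auto
    then show ?thesis using UD by (auto simp: orthonormal_mats_def U'_def)
  qed
  have D'_eq: "D' = four_block_mat (e \<cdot>\<^sub>m 1\<^sub>m 1) (0\<^sub>m 1 n) (0\<^sub>m n 1) D"
    by (rule eq_matI) (auto simp: D'_def D_def g_def split: nat.split)
  have A'_eq: "A' = four_block_mat (e \<cdot>\<^sub>m 1\<^sub>m 1) (0\<^sub>m 1 n) (0\<^sub>m n 1) B"
    using A' by (intro eq_matI) (auto simp: B_def col0 row0)
  have "U' * D' * U'\<^sup>T = A'"
  proof -
    have "U' * D' = four_block_mat (e \<cdot>\<^sub>m 1\<^sub>m 1) (0\<^sub>m 1 n) (0\<^sub>m n 1) (U * D)"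
      unfolding U'_def D'_eq using UD D by (subst mult_four_block_mat[of _ 1 1 _ n _ n _ _ 1 _ n]) auto
    then show ?thesis
      unfolding U'T A'_eq BU D_def[symmetric] using UD D
      by (simp only:, subst mult_four_block_mat[of _ 1 1 _ n _ n _ _ 1 _ n]) auto
  qed
  then have A'f: "A' = U' * D' * U'\<^sup>T" by simp
  have D': "D' \<in> carrier_mat (Suc n) (Suc n)" by (simp add: D'_def)
  note U'D = orthonormal_matsD[OF U']
  have "A = (W * W\<^sup>T) * A * (W * W\<^sup>T)"
    using A by (simp add: orthonormal_mats_square[OF W])
  also have "\<dots> = W * A' * W\<^sup>T"
    using A WD by (simp add: A'_def assoc_mult_mat[of _ "Suc n" "Suc n" _ "Suc n" _ "Suc n"])
  also have "\<dots> = (W * U') * D' * (W * U')\<^sup>T"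
    using A WD U'D D' by (simp add: A'f transpose_mult[of _ "Suc n" "Suc n" _ "Suc n"]
         assoc_mult_mat[of _ "Suc n" "Suc n" _ "Suc n" _ "Suc n"])
  finally show ?case using orthonormal_mats_mult[OF W U'] unfolding D'_def by blast
qed

section \<open>Frobenius norm and singular values\<close>

definition frob2 :: "real mat \<Rightarrow> real" where
  "frob2 M = (\<Sum>i<dim_row M. \<Sum>j<dim_col M. (M $$ (i, j))\<^sup>2)"

lemma frob2_carrier:
  "M \<in> carrier_mat a b \<Longrightarrow> frob2 M = (\<Sum>i<a. \<Sum>j<b. (M $$ (i, j))\<^sup>2)"
  by (auto simp: frob2_def)

lemma frob2_nonneg: "0 \<le> frob2 M"
  by (simp add: frob2_def sum_nonneg)

lemma sum_square_expand:
  fixes a :: "nat \<Rightarrow> 'b::comm_semiring_1"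
  shows "(\<Sum>i<n. a i)\<^sup>2 = (\<Sum>i<n. \<Sum>j<n. a i * a j)"
  by (simp add: power2_eq_square sum_product)

text \<open>The rows of \<open>B\<close> are orthogonal with squared lengths \<open>f\<close>, so
  the cross terms of the expanded squares vanish. With \<open>f = 1\<close> this is invariance under
  orthonormal columns; with squared singular values it evaluates norms in a singular basis.\<close>

lemma frob2_mult_gram:
  assumes A: "A \<in> carrier_mat a b" and B: "B \<in> carrier_mat b c"
    and gram: "\<And>k l. k < b \<Longrightarrow> l < b \<Longrightarrow> (\<Sum>j<c. B $$ (k, j) * B $$ (l, j)) = (if k = l then f k else 0)"
  shows "frob2 (A * B) = (\<Sum>i<a. \<Sum>k<b. (A $$ (i, k))\<^sup>2 * f k)"
proof -
  have "(\<Sum>j<c. ((A * B) $$ (i, j))\<^sup>2) = (\<Sum>k<b. (A $$ (i, k))\<^sup>2 * f k)" if i: "i < a" for i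
  proof -
    have "(\<Sum>j<c. ((A * B) $$ (i, j))\<^sup>2)
        = (\<Sum>j<c. \<Sum>k<b. \<Sum>l<b. (A $$ (i, k) * B $$ (k, j)) * (A $$ (i, l) * B $$ (l, j)))"
      by (rule sum.cong) (simp_all add: mat_mult_index[OF A B i] sum_square_expand del: index_mult_mat(1))
    also have "\<dots> = (\<Sum>k<b. \<Sum>l<b. \<Sum>j<c. (A $$ (i, k) * B $$ (k, j)) * (A $$ (i, l) * B $$ (l, j)))"
      by (subst sum.swap, rule sum.cong[OF refl], subst sum.swap, rule refl)
    also have "\<dots> = (\<Sum>k<b. \<Sum>l<b. A $$ (i, k) * A $$ (i, l) * (\<Sum>j<c. B $$ (k, j) * B $$ (l, j)))"
      by (simp add: sum_distrib_left mult_ac)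
    also have "\<dots> = (\<Sum>k<b. \<Sum>l<b. if l = k then (A $$ (i, k))\<^sup>2 * f k else 0)"
      by (intro sum.cong refl) (auto simp: gram power2_eq_square)
    also have "\<dots> = (\<Sum>k<b. (A $$ (i, k))\<^sup>2 * f k)" by (simp add: sum.delta)
    finally show ?thesis .
  qed
  then show ?thesis using A B by (subst frob2_carrier[of _ a c]) auto
qed

lemma frob2_transpose: "frob2 (M\<^sup>T) = frob2 M"
  unfolding frob2_def by (subst sum.swap) auto

lemma frob2_orthonormal_right:
  assumes "V \<in> orthonormal_mats q r" "M \<in> carrier_mat a r"
  shows "frob2 (M * V\<^sup>T) = frob2 M"
proof -
  note V = orthonormal_matsD[OF assms(1)]
  have "frob2 (M * V\<^sup>T) = (\<Sum>i<a. \<Sum>k<r. (M $$ (i, k))\<^sup>2 * 1)"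
    using V(1) orthonormal_mats_col_sum[OF assms(1)] by (intro frob2_mult_gram[OF assms(2) V(2)]) auto
  then show ?thesis using assms by (simp add: frob2_carrier)
qed

lemma frob2_orthonormal_left:
  assumes "U \<in> orthonormal_mats p r" "M \<in> carrier_mat r a"
  shows "frob2 (U * M) = frob2 M"
proof -
  have "frob2 (U * M) = frob2 ((U * M)\<^sup>T)" by (simp add: frob2_transpose)
  also have "(U * M)\<^sup>T = M\<^sup>T * U\<^sup>T" using orthonormal_matsD(1)[OF assms(1)] assms(2) by (rule transpose_mult)
  also have "frob2 \<dots> = frob2 M"
    using assms by (simp add: frob2_orthonormal_right[of _ p r _ a] frob2_transpose)
  finally show ?thesis .
qed

lemma sum_product_abs_le:
  "\<bar>\<Sum>i\<in>A. f i * g i :: real\<bar> \<le> sqrt (\<Sum>i\<in>A. (f i)\<^sup>2) * sqrt (\<Sum>i\<in>A. (g i)\<^sup>2)"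
  using L2_set_mult_ineq[of f g A] sum_abs[of "\<lambda>i. f i * g i" A]
  unfolding L2_set_def abs_mult by linarith

lemma sum_product_square_le:
  "(\<Sum>i\<in>A. f i * g i :: real)\<^sup>2 \<le> (\<Sum>i\<in>A. (f i)\<^sup>2) * (\<Sum>i\<in>A. (g i)\<^sup>2)"
proof -
  have "(\<Sum>i\<in>A. f i * g i)\<^sup>2 \<le> (sqrt (\<Sum>i\<in>A. (f i)\<^sup>2) * sqrt (\<Sum>i\<in>A. (g i)\<^sup>2))\<^sup>2"
    by (metis abs_ge_zero power2_abs power_mono sum_product_abs_le)
  then show ?thesis by (simp add: power_mult_distrib sum_nonneg)
qed

lemma frob2_mult_le:
  assumes A: "A \<in> carrier_mat a b" and B: "B \<in> carrier_mat b c"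
  shows "frob2 (A * B) \<le> frob2 A * frob2 B"
proof -
  have "frob2 (A * B) = (\<Sum>i<a. \<Sum>j<c. (\<Sum>k<b. A $$ (i, k) * B $$ (k, j))\<^sup>2)"
    using A B by (subst frob2_carrier[of _ a c]) (auto simp: mat_mult_index[OF A B] simp del: index_mult_mat(1))
  also have "\<dots> \<le> (\<Sum>i<a. \<Sum>j<c. (\<Sum>k<b. (A $$ (i, k))\<^sup>2) * (\<Sum>k<b. (B $$ (k, j))\<^sup>2))"
    by (intro sum_mono sum_product_square_le)
  also have "\<dots> = frob2 A * (\<Sum>j<c. \<Sum>k<b. (B $$ (k, j))\<^sup>2)"
    unfolding frob2_carrier[OF A] sum_product ..
  also have "(\<Sum>j<c. \<Sum>k<b. (B $$ (k, j))\<^sup>2) = frob2 B"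
    unfolding frob2_carrier[OF B] by (rule sum.swap)
  finally show ?thesis .
qed

text \<open>The \<open>i\<close>-th row of \<open>C * C\<^sup>T\<close> has squared length
  \<open>w\<close>, and its \<open>i\<close>-th entry is \<open>w\<close> as well. Hence
  \<open>w\<^sup>2 \<le> w\<close>.\<close>

lemma orthonormal_row_sum_le_1:
  assumes C: "C \<in> orthonormal_mats p m" and i: "i < p"
  shows "(\<Sum>j<m. (C $$ (i, j))\<^sup>2) \<le> 1"
proof -
  note CD = orthonormal_matsD[OF C]
  define w where "w = (\<Sum>j<m. (C $$ (i, j))\<^sup>2)"
  define R where "R = mat 1 m (\<lambda>(_, j). C $$ (i, j))"
  have R: "R \<in> carrier_mat 1 m" by (simp add: R_def)
  have RC: "R * C\<^sup>T \<in> carrier_mat 1 p" using R CD by simp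
  have fr: "frob2 R = w" unfolding frob2_carrier[OF R] by (simp add: w_def R_def)
  have "(R * C\<^sup>T) $$ (0, i) = w"
    using i CD(1) by (subst mat_mult_index[OF R CD(2)]) (auto simp: R_def w_def power2_eq_square)
  then have "w\<^sup>2 \<le> (\<Sum>j<p. ((R * C\<^sup>T) $$ (0, j))\<^sup>2)"
    using member_le_sum[of i "{..<p}" "\<lambda>j. ((R * C\<^sup>T) $$ (0, j))\<^sup>2"] i by simp
  also have "\<dots> = frob2 (R * C\<^sup>T)" by (simp add: frob2_carrier[OF RC])
  also have "\<dots> = w" using frob2_orthonormal_right[OF C R] fr by simp
  finally have "w * w \<le> w * 1" by (simp add: power2_eq_square)
  moreover have "0 \<le> w" by (simp add: w_def sum_nonneg)
  ultimately have "w \<le> 1" by (cases "w = 0") (auto simp: mult_le_cancel_left)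
  then show ?thesis by (simp add: w_def)
qed

text \<open>A small linear program: weights in the unit interval do best on the largest values.
  Every \<open>s i\<close> is compared with the threshold \<open>t = s (r - 1)\<close>. Before the
  threshold \<open>w i - 1\<close> is nonpositive, after it \<open>w i\<close> is nonnegative, so
  replacing \<open>s i\<close> by \<open>t\<close> only increases the difference of the two
  sides.\<close>

lemma weighted_sum_le_top_sum:
  fixes s w :: "nat \<Rightarrow> real"
  assumes "\<And>i j. i \<le> j \<Longrightarrow> j < p \<Longrightarrow> s j \<le> s i" "\<And>i. i < p \<Longrightarrow> 0 \<le> s i"
    and "\<And>i. i < p \<Longrightarrow> 0 \<le> w i \<and> w i \<le> 1" and "(\<Sum>i<p. w i) \<le> real r" and "1 \<le> r" "r \<le> p"
  shows "(\<Sum>i<p. s i * w i) \<le> (\<Sum>i<r. s i)"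
proof -
  define t where "t = s (r - 1)"
  have split: "{..<p} = {..<r} \<union> {r..<p}" using assms by auto
  have sp: "(\<Sum>i<p. g i) = (\<Sum>i<r. g i) + (\<Sum>i\<in>{r..<p}. g i)" for g :: "nat \<Rightarrow> real"
    unfolding split by (rule sum.union_disjoint) auto
  have "(\<Sum>i<p. s i * w i) - (\<Sum>i<r. s i) = (\<Sum>i<r. s i * (w i - 1)) + (\<Sum>i\<in>{r..<p}. s i * w i)"
    unfolding sp by (simp add: algebra_simps sum_subtractf)
  also have "\<dots> \<le> (\<Sum>i<r. t * (w i - 1)) + (\<Sum>i\<in>{r..<p}. t * w i)"
  proof (intro add_mono sum_mono)
    fix i assume "i \<in> {..<r}"
    then have "t \<le> s i" "w i - 1 \<le> 0" using assms by (auto simp: t_def)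
    then show "s i * (w i - 1) \<le> t * (w i - 1)" by (rule mult_right_mono_neg)
  next
    fix i assume "i \<in> {r..<p}"
    then have "s i \<le> t" "0 \<le> w i" using assms by (auto simp: t_def)
    then show "s i * w i \<le> t * w i" by (rule mult_right_mono)
  qed
  also have "\<dots> = t * ((\<Sum>i<p. w i) - real r)"
    unfolding sp by (simp add: algebra_simps sum_subtractf sum_distrib_left)
  also have "\<dots> \<le> 0" using assms by (intro mult_nonneg_nonpos) (auto simp: t_def)
  finally show ?thesis by simp
qed

text \<open>\<open>S\<close> is rectangular, so a row whose index reaches the number of columns is
  zero; this is the inner default.\<close>

lemma is_svd_row_gram:
  assumes svd: "is_svd D U S V" and "k < dim_row D" "l < dim_row D"
  shows "(\<Sum>j<dim_col D. S $$ (k, j) * S $$ (l, j))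
    = (if k = l then (if k < dim_col D then (S $$ (k, k))\<^sup>2 else 0) else 0)"
proof -
  have "(\<Sum>j<dim_col D. S $$ (k, j) * S $$ (l, j))
     = (\<Sum>j<dim_col D. if j = k then (if k = l then (S $$ (k, k))\<^sup>2 else 0) else 0)"
    using assms by (intro sum.cong refl) (auto simp: is_svd_def power2_eq_square)
  then show ?thesis by auto
qed

lemma is_SVD_orthonormal:
  assumes "is_SVD r D U"
  shows "U \<in> orthonormal_mats (dim_row D) r"
proof -
  obtain U' S V where svd: "is_svd D U' S V" and U: "U = mat (dim_row D) r (\<lambda>(i, j). U' $$ (i, j))"
    and r: "r \<le> dim_row D" using assms by (auto simp: is_SVD_def)
  have U': "U' \<in> orthonormal_mats (dim_row D) (dim_row D)" using svd unfolding is_svd_def by (rule conjunct1)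
  show ?thesis
    using orthonormal_mats_col_sum[OF U'] r by (intro orthonormal_matsI) (auto simp: U)
qed

text \<open>Ky Fan's maximum principle.\<close>

lemma is_SVD_maximal:
  assumes SVD: "is_SVD r D U" and C: "C \<in> orthonormal_mats (dim_row D) m" and mr: "m \<le> r" "1 \<le> r"
  shows "frob2 (C\<^sup>T * D) \<le> frob2 (U\<^sup>T * D)"
proof -
  define p q where "p = dim_row D" and "q = dim_col D"
  obtain U' S V where svd: "is_svd D U' S V" and U: "U = mat p r (\<lambda>(i, j). U' $$ (i, j))"
    and r: "r \<le> p" using SVD by (auto simp: is_SVD_def p_def)
  have U': "U' \<in> orthonormal_mats p p" and V: "V \<in> orthonormal_mats q q" and S: "S \<in> carrier_mat p q"
    and D: "D = U' * S * V\<^sup>T" using svd by (auto simp: is_svd_def p_def q_def)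
  note U'D = orthonormal_matsD[OF U'] and VD = orthonormal_matsD[OF V]
  have C: "C \<in> orthonormal_mats p m" using C by (simp add: p_def)
  note CD = orthonormal_matsD[OF C]
  define s where "s k = (if k < q then (S $$ (k, k))\<^sup>2 else 0)" for k
  have gram: "(\<Sum>j<q. S $$ (k, j) * S $$ (l, j)) = (if k = l then s k else 0)" if "k < p" "l < p" for k l
    using is_svd_row_gram[OF svd] that by (simp add: p_def q_def s_def)
  \<comment> \<open>In the coordinates given by the left singular vectors, the energy captured by
    \<open>B\<close> is a weighted sum of the squared singular values \<open>s\<close>.\<close>
  have frob: "frob2 (B\<^sup>T * D) = (\<Sum>i<m. \<Sum>k<p. ((U'\<^sup>T * B) $$ (k, i))\<^sup>2 * s k)"
    if B: "B \<in> carrier_mat p m" for B m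
  proof -
    have "B\<^sup>T * D = (U'\<^sup>T * B)\<^sup>T * S * V\<^sup>T"
      using B U'D(1,2) S VD(1,2) unfolding D
      by (simp add: transpose_mult[of _ p p] assoc_mult_mat[of _ m p _ p _ q] assoc_mult_mat[of _ m p _ q _ q]
          assoc_mult_mat[of _ p p _ q _ q])
    then have "frob2 (B\<^sup>T * D) = frob2 ((U'\<^sup>T * B)\<^sup>T * S)"
      using frob2_orthonormal_right[OF V mult_carrier_mat[OF _ S], of "(U'\<^sup>T * B)\<^sup>T" m] B U'D(1) by simp
    also have "\<dots> = (\<Sum>i<m. \<Sum>k<p. ((U'\<^sup>T * B)\<^sup>T $$ (i, k))\<^sup>2 * s k)"
      using B U'D(1) by (intro frob2_mult_gram[OF _ S gram]) auto
    also have "\<dots> = (\<Sum>i<m. \<Sum>k<p. ((U'\<^sup>T * B) $$ (k, i))\<^sup>2 * s k)"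
      using B U'D(1) by (intro sum.cong refl) auto
    finally show ?thesis .
  qed
  have Uc: "U \<in> carrier_mat p r" by (simp add: U)
  have "frob2 (U\<^sup>T * D) = (\<Sum>i<r. \<Sum>k<p. if k = i then s k else 0)"
  proof -
    have "(U'\<^sup>T * U) $$ (k, i) = (if k = i then 1 else 0)" if "i < r" "k < p" for i k
      using orthonormal_mats_col_sum[OF U', of k i] that r U'D(1)
      by (subst mat_mult_index[OF U'D(2) Uc]) (auto simp: U)
    then show ?thesis unfolding frob[OF Uc] by (intro sum.cong refl) auto
  qed
  also have "\<dots> = (\<Sum>i<r. s i)" using r by (intro sum.cong refl) auto
  finally have fU: "frob2 (U\<^sup>T * D) = (\<Sum>i<r. s i)" .
  define E where "E = U'\<^sup>T * C"
  have "U'\<^sup>T \<in> orthonormal_mats p p"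
    using U'D orthonormal_mats_square[OF U'] by (simp add: orthonormal_mats_def)
  then have E: "E \<in> orthonormal_mats p m" unfolding E_def using C by (rule orthonormal_mats_mult)
  \<comment> \<open>\<open>w k\<close> is the weight that the columns of \<open>C\<close> put on the
    \<open>k\<close>-th left singular vector. Each weight is at most 1, and they add up to
    \<open>m\<close>.\<close>
  define w where "w k = (\<Sum>i<m. (E $$ (k, i))\<^sup>2)" for k
  have "frob2 (C\<^sup>T * D) = (\<Sum>k<p. s k * w k)"
    unfolding frob[OF CD(1)] E_def[symmetric] w_def by (subst sum.swap) (simp add: sum_distrib_left mult_ac)
  also have "\<dots> \<le> (\<Sum>i<r. s i)"
  proof (rule weighted_sum_le_top_sum)
    have "(\<Sum>k<p. w k) = (\<Sum>i<m. \<Sum>k<p. E $$ (k, i) * E $$ (k, i))"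
      unfolding w_def power2_eq_square by (rule sum.swap)
    also have "\<dots> = real m" using orthonormal_mats_col_sum[OF E] by simp
    finally show "(\<Sum>k<p. w k) \<le> real r" using mr by simp
    show "0 \<le> w i \<and> w i \<le> 1" if "i < p" for i
      using orthonormal_row_sum_le_1[OF E that] by (simp add: w_def sum_nonneg)
    show "s j \<le> s i" if "i \<le> j" "j < p" for i j
      using svd that by (auto simp: s_def is_svd_def p_def q_def intro!: power_mono)
    show "0 \<le> s i" for i by (simp add: s_def)
  qed (use mr r in auto)
  finally show ?thesis using fU by simp
qed

section \<open>Ranks of products and of matrices with orthonormal columns\<close>

lemma rank_mult_le:
  fixes A :: "'a::field mat"
  assumes A: "A \<in> carrier_mat n k" and B: "B \<in> carrier_mat k l"
  shows "vec_space.rank n (A * B) \<le> vec_space.rank n A"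
proof -
  interpret vec_space "TYPE('a)" n .
  have AB: "A * B \<in> carrier_mat n l" using A B by simp
  have "col_space (A * B) \<subseteq> col_space A"
    unfolding col_space_eq[OF A] col_space_eq[OF AB] using A B
    by (auto simp: assoc_mult_mat_vec[OF A B] intro!: bexI[of _ "B *\<^sub>v _"])
  then have sub: "span (set (cols (A * B))) \<subseteq> span (set (cols A))" by (simp add: col_space_def)
  have "VectorSpace.subspace class_ring (span (set (cols A))) V" "VectorSpace.subspace class_ring (span (set (cols (A * B)))) V"
    using A AB cols_dim by (metis carrier_matD(1) span_is_subspace)+
  then show ?thesis unfolding rank_def
    using vectorspace.subspace_dim[OF subspace_is_vs nested_subspaces[OF _ _ sub]]
      fin_dim_span_cols[OF A] fin_dim_span_cols[OF AB] by simp
qed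

lemma rank_mult_le_inner:
  fixes A :: "'a::field mat"
  assumes "A \<in> carrier_mat n k" and "B \<in> carrier_mat k l"
  shows "vec_space.rank n (A * B) \<le> k"
  using rank_mult_le[OF assms] vec_space.rank_le_nc[OF assms(1)] by linarith

text \<open>\<open>U\<^sup>T\<close> is a left inverse, so the kernel of \<open>U\<close> is
  trivial. Distinctness is shown separately because independence speaks of the set of columns, in
  which equal columns would merge.\<close>

lemma rank_orthonormal:
  assumes U: "U \<in> orthonormal_mats n m"
  shows "vec_space.rank n U = m"
proof -
  interpret vec_space "TYPE(real)" n .
  note UD = orthonormal_matsD[OF U]
  have dist: "distinct (cols U)"
  proof (unfold distinct_conv_nth, intro allI impI)
    fix i j assume ij: "i < length (cols U)" "j < length (cols U)" "i \<noteq> j"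
    then have lt: "i < m" "j < m" using UD(1) by auto
    show "cols U ! i \<noteq> cols U ! j"
    proof
      assume "cols U ! i = cols U ! j"
      then have "col U i = col U j" using ij by simp
      then have "U $$ (k, i) = U $$ (k, j)" if "k < n" for k
        using that lt UD(1) by (metis carrier_matD index_col)
      then have "(\<Sum>k<n. U $$ (k, i) * U $$ (k, j)) = (\<Sum>k<n. U $$ (k, i) * U $$ (k, i))" by simp
      then show False using orthonormal_mats_col_sum[OF U] lt ij(3) by simp
    qed
  qed
  have "lin_indpt (set (cols U))"
  proof
    assume "lin_dep (set (cols U))"
    then obtain v where v: "v \<in> carrier_vec m" "v \<noteq> 0\<^sub>v m" "U *\<^sub>v v = 0\<^sub>v n"
      using lin_depE[OF UD(1) _ dist] by blast
    have "v = (U\<^sup>T * U) *\<^sub>v v" unfolding UD(3) using v by simp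
    also have "\<dots> = U\<^sup>T *\<^sub>v (U *\<^sub>v v)" using UD(1,2) v(1) by simp
    also have "\<dots> = 0\<^sub>v m" unfolding v(3) using UD(2) by (auto intro!: eq_vecI)
    finally show False using v by simp
  qed
  then show ?thesis using lin_indpt_full_rank[OF UD(1) dist] by simp
qed


text \<open>If a positive entry \<open>y\<close> lay below the \<open>R\<close>-th largest one, the
  top \<open>R\<close> entries together with \<open>y\<close> would be \<open>R + 1\<close> positive
  entries. For singular values this says that the one numbered by the rank bounds every nonzero one
  from below.\<close>

lemma rev_sort_nth_le:
  fixes xs :: "real list"
  assumes "length (filter (\<lambda>x. 0 < x) xs) \<le> R" and "1 \<le> R" "R \<le> length xs" and "y \<in> set xs" "0 < y"
  shows "rev (sort xs) ! (R - 1) \<le> y"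
proof (rule ccontr)
  define L where "L = rev (sort xs)"
  assume "\<not> rev (sort xs) ! (R - 1) \<le> y"
  then have gt: "y < L ! (R - 1)" by (simp add: L_def)
  have len: "length L = length xs" by (simp add: L_def)
  have mono: "L ! j \<le> L ! i" if "i \<le> j" "j < length L" for i j
    unfolding L_def using that
    by (auto simp: L_def rev_nth intro!: sorted_nth_mono)
  obtain j where j: "j < length L" "L ! j = y"
    using assms(4) by (metis L_def in_set_conv_nth set_rev set_sort)
  have "R \<le> j" 
  proof (rule ccontr)
    assume "\<not> R \<le> j"
    then have "j \<le> R - 1" "R - 1 < length L" using assms(2,3) len by linarith+
    then show False using mono[of j "R - 1"] gt j by simp
  qed
  have pos: "0 < L ! i" if "i < R" for i
    using mono[of i "R - 1"] gt assms that len by force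
  have "insert j {..<R} \<subseteq> {i. i < length L \<and> 0 < L ! i}"
    using pos j assms len by auto
  then have "card (insert j {..<R}) \<le> card {i. i < length L \<and> 0 < L ! i}"
    by (intro card_mono) auto
  moreover have "card (insert j {..<R}) = Suc R" using \<open>R \<le> j\<close> by (subst card_insert_disjoint) auto
  moreover have "card {i. i < length L \<and> 0 < L ! i} = length (filter (\<lambda>x. 0 < x) L)"
    by (simp add: length_filter_conv_card)
  moreover have "length (filter (\<lambda>x. 0 < x) L) = length (filter (\<lambda>x. 0 < x) xs)"
    unfolding L_def by (metis mset_filter mset_rev mset_sort size_mset)
  ultimately show False using assms(1) by simp
qed

section \<open>Singular values from a diagonalization\<close>

lemma proots_prod_list_linear: "proots (\<Prod>a\<leftarrow>as. [:- a, 1:] :: real poly) = mset as"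
proof (induction as)
  case (Cons a as)
  have "(\<Prod>a\<leftarrow>as. [:- a, 1:] :: real poly) \<noteq> 0" by (simp add: prod_list_zero_iff image_iff)
  then show ?case using Cons by (subst list.map, subst prod_list.Cons, subst proots_mult) auto
qed auto

text \<open>\<open>singular_value\<close> refers to roots of a characteristic polynomial and not to
  a decomposition. Invariance of that polynomial under similarity connects it with any orthogonal
  diagonalization of \<open>D * D\<^sup>T\<close>.\<close>

lemma singular_value_from_diagonalization:
  assumes D: "D \<in> carrier_mat p q" and U: "U \<in> orthonormal_mats p p"
    and diag: "D * D\<^sup>T = U * mat p p (\<lambda>(i, j). if i = j then f i else 0) * U\<^sup>T"
    and "1 \<le> R" "R \<le> min p q"
  shows "singular_value R D = rev (sort (map (\<lambda>i. sqrt (f i)) [0..<p])) ! (R - 1)"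
proof -
  let ?F = "mat p p (\<lambda>(i, j). if i = j then f i else 0)"
  note UD = orthonormal_matsD[OF U]
  have "similar_mat (D * D\<^sup>T) ?F"
    unfolding similar_mat_def similar_mat_wit_def Let_def
    using D UD orthonormal_mats_square[OF U] diag
    by (intro exI[of _ U] exI[of _ "U\<^sup>T"]) auto
  then have "char_poly (D * D\<^sup>T) = char_poly ?F" by (rule char_poly_similar)
  also have "\<dots> = (\<Prod>a\<leftarrow>diag_mat ?F. [:- a, 1:])"
    by (rule char_poly_upper_triangular[of _ p]) (auto simp: upper_triangular_def)
  also have "diag_mat ?F = map f [0..<p]" by (auto simp: diag_mat_def)
  finally have "proots (char_poly (D * D\<^sup>T)) = mset (map f [0..<p])"
    using proots_prod_list_linear[of "map f [0..<p]"] by simp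
  then have "image_mset sqrt (proots (char_poly (D * D\<^sup>T))) = mset (map (\<lambda>i. sqrt (f i)) [0..<p])"
    by (simp add: image_mset.compositionality o_def flip: mset_map)
  then show ?thesis unfolding singular_value_def using D assms(4,5)
    by (simp del: mset_map)
qed

text \<open>The left half of a singular value decomposition: \<open>C\<close> collects the
  eigenvectors of \<open>D * D\<^sup>T\<close> with nonzero eigenvalue, enumerated by
  \<open>ix\<close>. The rows of \<open>G = U\<^sup>T * D\<close> are orthogonal with squared
  lengths \<open>f\<close>. Rows with \<open>f i = 0\<close> vanish, so \<open>C\<close>
  reconstructs \<open>D\<close>; and \<open>A * D = (A * U) * G\<close> turns the last claim into a
  comparison of \<open>f\<close> with the squared singular value.\<close>

lemma left_singular_basis:
  assumes D: "D \<in> carrier_mat p q"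
  obtains m C where "m \<le> vec_space.rank p D" "C \<in> orthonormal_mats p m" "C * (C\<^sup>T * D) = D"
    and "\<And>a A. A \<in> carrier_mat a p \<Longrightarrow>
      (singular_value (vec_space.rank p D) D)\<^sup>2 * frob2 (A * C) \<le> frob2 (A * D)"
proof -
  have DT: "D\<^sup>T \<in> carrier_mat q p" using D by simp
  have DDT: "D * D\<^sup>T \<in> carrier_mat p p" using D by simp
  have "(D * D\<^sup>T)\<^sup>T = D * D\<^sup>T" using D by (simp add: transpose_mult[of _ p q _ p])
  then obtain U f where U: "U \<in> orthonormal_mats p p"
    and diag: "D * D\<^sup>T = U * mat p p (\<lambda>(i, j). if i = j then f i else 0) * U\<^sup>T"
    using symmetric_real_diagonalization[OF DDT] by blast
  note UD = orthonormal_matsD[OF U]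
  define F where "F = mat p p (\<lambda>(i, j). if i = j then f i else 0 :: real)"
  have F: "F \<in> carrier_mat p p" by (simp add: F_def)
  define G where "G = U\<^sup>T * D"
  have G: "G \<in> carrier_mat p q" using UD D by (simp add: G_def)
  have UG: "U * G = D"
  proof -
    have "U * G = U * U\<^sup>T * D" unfolding G_def using UD(1,2) D by simp
    then show ?thesis unfolding orthonormal_mats_square[OF U] using D by simp
  qed
  have "G * G\<^sup>T = U\<^sup>T * (D * D\<^sup>T) * U"
    unfolding G_def using UD(1,2) D by (simp add: transpose_mult[of _ p p _ q] assoc_mult_mat[of _ p p _ q _ p]
      assoc_mult_mat[of _ q p _ p _ p] assoc_mult_mat[of _ p q _ p _ p] assoc_mult_mat[of _ p p _ p _ p])
  also have "\<dots> = (U\<^sup>T * U) * F * (U\<^sup>T * U)"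
    unfolding diag F_def[symmetric] using UD(1,2) F by (simp add: assoc_mult_mat[of _ p p _ p _ p])
  also have "\<dots> = F" unfolding UD(3) using F by simp
  finally have GGT: "G * G\<^sup>T = F" .
  have gram: "(\<Sum>j<q. G $$ (k, j) * G $$ (l, j)) = (if k = l then f k else 0)" if "k < p" "l < p" for k l
  proof -
    have "(G * G\<^sup>T) $$ (k, l) = (\<Sum>j<q. G $$ (k, j) * G $$ (l, j))"
      using that G by (subst mat_mult_index[of _ p q _ p]) auto
    then show ?thesis using that by (simp add: GGT F_def)
  qed
  have f_nonneg: "0 \<le> f i" if "i < p" for i
  proof -
    have "f i = (\<Sum>j<q. G $$ (i, j) * G $$ (i, j))" using gram[OF that that] by simp
    then show ?thesis by (simp add: sum_nonneg)
  qed
  have G_zero: "G $$ (i, j) = 0" if "i < p" "j < q" "f i = 0" for i j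
  proof -
    have "(\<Sum>j<q. G $$ (i, j) * G $$ (i, j)) = 0" using gram[OF that(1) that(1)] that(3) by simp
    then show ?thesis using that(2) by (subst (asm) sum_nonneg_eq_0_iff) auto
  qed
  define ix where "ix = filter (\<lambda>i. f i \<noteq> 0) [0..<p]"
  define m where "m = length ix"
  have ix_lt: "ix ! j < p" "f (ix ! j) \<noteq> 0" if "j < m" for j
    using that nth_mem[of j "ix"] unfolding m_def by (auto simp: ix_def)
  have ix_dist: "distinct ix" by (simp add: ix_def)
  have bij: "bij_betw ((!) ix) {..<m} {i. i < p \<and> f i \<noteq> 0}"
    unfolding m_def using ix_dist by (intro bij_betw_nth) (auto simp: ix_def)
  define C where "C = mat p m (\<lambda>(i, j). U $$ (i, ix ! j))"
  have C: "C \<in> orthonormal_mats p m"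
  proof (rule orthonormal_matsI)
    fix i j assume ij: "i < m" "j < m"
    then show "(\<Sum>k<p. C $$ (k, i) * C $$ (k, j)) = (if i = j then 1 else 0)"
      using orthonormal_mats_col_sum[OF U ix_lt(1)[OF ij(1)] ix_lt(1)[OF ij(2)]] ix_dist
      by (simp add: C_def nth_eq_iff_index_eq m_def)
  qed (simp add: C_def)
  note CD = orthonormal_matsD[OF C]
  have Ci: "C $$ (i, j) = U $$ (i, ix ! j)" if "i < p" "j < m" for i j
    using that by (simp add: C_def)
  have CTD: "(C\<^sup>T * D) $$ (j, b) = G $$ (ix ! j, b)" if "j < m" "b < q" for j b
    using that ix_lt[OF that(1)] UD(1) unfolding G_def
    by (simp add: mat_mult_index[OF CD(2) D] mat_mult_index[OF UD(2) D] Ci carrier_matD[OF CD(1)] del: index_mult_mat(1))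
  have sum_ix: "(\<Sum>i<p. g i) = (\<Sum>j<m. g (ix ! j))" if "\<And>i. i < p \<Longrightarrow> f i = 0 \<Longrightarrow> g i = 0" for g :: "nat \<Rightarrow> real"
  proof -
    have "(\<Sum>j<m. g (ix ! j)) = (\<Sum>i | i < p \<and> f i \<noteq> 0. g i)" by (rule sum.reindex_bij_betw[OF bij])
    also have "\<dots> = (\<Sum>i<p. g i)" using that by (intro sum.mono_neutral_left) auto
    finally show ?thesis by simp
  qed
  have rec: "C * (C\<^sup>T * D) = D"
  proof (rule eq_matI)
    fix a b assume "a < dim_row D" "b < dim_col D"
    then have ab: "a < p" "b < q" using D by auto
    have "(C * (C\<^sup>T * D)) $$ (a, b) = (\<Sum>j<m. U $$ (a, ix ! j) * G $$ (ix ! j, b))"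
      using ab CTD by (subst mat_mult_index[OF CD(1) mult_carrier_mat[OF CD(2) D]]) (auto simp: Ci simp del: index_mult_mat(1))
    also have "\<dots> = (\<Sum>i<p. U $$ (a, i) * G $$ (i, b))"
      using ab G_zero by (subst sum_ix) auto
    also have "\<dots> = D $$ (a, b)"
      using ab mat_mult_index[OF UD(1) G] by (simp add: UG)
    finally show "(C * (C\<^sup>T * D)) $$ (a, b) = D $$ (a, b)" .
  qed (use CD D in auto)
  have mR: "m \<le> vec_space.rank p D"
  proof -
    \<comment> \<open>\<open>T\<close> inverts \<open>G\<close> on the nonzero rows: they are
      transposed and divided by their squared lengths, so that \<open>D * T = C\<close>. Thus
      \<open>m\<close>, the rank of \<open>C\<close>, is at most the rank of
      \<open>D\<close>.\<close>
    define T where "T = mat q m (\<lambda>(b, j). G $$ (ix ! j, b) / f (ix ! j))"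
    have T: "T \<in> carrier_mat q m" by (simp add: T_def)
    have GT: "(G * T) $$ (i, j) = (if i = ix ! j then 1 else 0)" if "i < p" "j < m" for i j
    proof -
      have "(G * T) $$ (i, j) = (\<Sum>b<q. G $$ (i, b) * G $$ (ix ! j, b)) / f (ix ! j)"
        using that by (subst mat_mult_index[OF G T]) (auto simp: T_def sum_divide_distrib)
      then show ?thesis using gram[OF that(1) ix_lt(1)[OF that(2)]] ix_lt(2)[OF that(2)] by simp
    qed
    have "D * T = U * (G * T)"
      using UG[symmetric] UD(1) G T by (metis assoc_mult_mat)
    moreover have "\<dots> = C"
    proof (rule eq_matI)
      fix a j assume "a < dim_row C" "j < dim_col C"
      then have aj: "a < p" "j < m" using CD by auto
      have "(U * (G * T)) $$ (a, j) = (\<Sum>i<p. if i = ix ! j then U $$ (a, i) else 0)"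
        using aj by (subst mat_mult_index[OF UD(1) mult_carrier_mat[OF G T]]) (auto simp: GT if_distrib[of "times _"] simp del: index_mult_mat(1) cong: if_cong)
      also have "\<dots> = C $$ (a, j)" using aj ix_lt by (simp add: C_def)
      finally show "(U * (G * T)) $$ (a, j) = C $$ (a, j)" .
    qed (use UD T CD in auto)
    ultimately have "vec_space.rank p C \<le> vec_space.rank p D" using rank_mult_le[OF D T] by simp
    then show ?thesis using rank_orthonormal[OF C] by simp
  qed
  define R where "R = vec_space.rank p D"
  define sv where "sv = singular_value R D"
  have sv: "sv\<^sup>2 \<le> f i" if i: "i < p" "f i \<noteq> 0" for i
  proof (cases "1 \<le> R \<and> R \<le> min p q")
    case True
    have sv_eq: "sv = rev (sort (map (\<lambda>i. sqrt (f i)) [0..<p])) ! (R - 1)"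
      unfolding sv_def using singular_value_from_diagonalization[OF D U diag] True by simp
    moreover have "length (filter (\<lambda>x. 0 < x) (map (\<lambda>i. sqrt (f i)) [0..<p])) = m"
      unfolding m_def ix_def filter_map length_map o_def
      using f_nonneg by (intro arg_cong[of _ _ length] filter_cong) (auto simp: less_le)
    ultimately have "sv \<le> sqrt (f i)"
      using True mR f_nonneg[OF i(1)] i
      by (simp only:, intro rev_sort_nth_le) (auto simp: R_def)
    moreover have "0 \<le> sv"
    proof -
      have "sv \<in> set (rev (sort (map (\<lambda>i. sqrt (f i)) [0..<p])))"
        unfolding sv_eq using True by (intro nth_mem) auto
      then show ?thesis using f_nonneg by auto
    qed
    ultimately have "sv\<^sup>2 \<le> (sqrt (f i))\<^sup>2" by (rule power_mono)
    then show ?thesis using f_nonneg[OF i(1)] by simp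
  next
    \<comment> \<open>Outside its range, for example at rank 0, \<open>singular_value\<close> has
      the default value 0 and the bound is trivial.\<close>
    case False
    then have "sv = 0" using D by (auto simp: sv_def singular_value_def)
    then show ?thesis using f_nonneg[OF i(1)] by simp
  qed
  have "sv\<^sup>2 * frob2 (A * C) \<le> frob2 (A * D)" if A: "A \<in> carrier_mat a p" for a A
  proof -
    have AU: "A * U \<in> carrier_mat a p" using A UD by simp
    have AC: "(A * C) $$ (i, j) = (A * U) $$ (i, ix ! j)" if "i < a" "j < m" for i j
      using that ix_lt[OF that(2)]
      by (simp add: mat_mult_index[OF A CD(1)] mat_mult_index[OF A UD(1)] Ci del: index_mult_mat(1))
    have "sv\<^sup>2 * frob2 (A * C) = (\<Sum>i<a. \<Sum>j<m. ((A * U) $$ (i, ix ! j))\<^sup>2 * sv\<^sup>2)"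
      using AC by (simp add: frob2_carrier[OF mult_carrier_mat[OF A CD(1)]] sum_distrib_left mult_ac
          del: index_mult_mat(1))
    also have "\<dots> \<le> (\<Sum>i<a. \<Sum>j<m. ((A * U) $$ (i, ix ! j))\<^sup>2 * f (ix ! j))"
      using sv ix_lt by (intro sum_mono mult_left_mono) auto
    also have "\<dots> = (\<Sum>i<a. \<Sum>k<p. ((A * U) $$ (i, k))\<^sup>2 * f k)"
      by (intro sum.cong refl sum_ix[symmetric]) auto
    also have "\<dots> = frob2 (A * U * G)" by (rule frob2_mult_gram[OF AU G gram, symmetric])
    also have "A * U * G = A * D" using A UD(1) G UG by simp
    finally show ?thesis .
  qed
  then show ?thesis using that[OF mR C rec] by (simp add: sv_def R_def)
qed

text \<open>The factorization \<open>Q * D * R = (Q * C) * (C\<^sup>T * D * R)\<close> takes the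
  place of a pseudoinverse. The first factor is paid for by the smallest nonzero singular value, the
  second has exactly the norm of \<open>D * R\<close> since the columns of \<open>C\<close> are
  orthonormal. With the singular value on the left there is no division, and \<open>D = 0\<close> is
  covered.\<close>

lemma singular_value_sandwich:
  assumes D: "D \<in> carrier_mat p q" and Q: "Q \<in> carrier_mat a p" and R: "R \<in> carrier_mat q b"
  shows "(singular_value (vec_space.rank p D) D)\<^sup>2 * frob2 (Q * D * R) \<le> frob2 (Q * D) * frob2 (D * R)"
proof -
  obtain m C where C: "C \<in> orthonormal_mats p m" and rec: "C * (C\<^sup>T * D) = D"
    and sv: "\<And>a A. A \<in> carrier_mat a p \<Longrightarrow>
      (singular_value (vec_space.rank p D) D)\<^sup>2 * frob2 (A * C) \<le> frob2 (A * D)"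
    using left_singular_basis[OF D] by metis
  note CD = orthonormal_matsD[OF C]
  let ?s = "(singular_value (vec_space.rank p D) D)\<^sup>2"
  define M where "M = C\<^sup>T * D * R"
  have M: "M \<in> carrier_mat m b" using CD D R by (simp add: M_def)
  have CM: "C * M = D * R"
  proof -
    have "C * M = C * (C\<^sup>T * D) * R" unfolding M_def using CD(1,2) D R by (simp add: assoc_mult_mat[of _ p m _ q _ b])
    then show ?thesis by (simp only: rec)
  qed
  have "Q * D * R = Q * (C * M)" unfolding CM using Q D R by simp
  also have "\<dots> = Q * C * M" using Q CD M by simp
  finally have eq: "Q * D * R = Q * C * M" .
  have "?s * frob2 (Q * D * R) \<le> ?s * (frob2 (Q * C) * frob2 M)"
    unfolding eq using frob2_mult_le[of "Q * C" a m M b] Q CD M by (intro mult_left_mono) auto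
  also have "\<dots> \<le> frob2 (Q * D) * frob2 M"
    using mult_right_mono[OF sv[OF Q] frob2_nonneg[of M]] by (simp add: mult_ac)
  also have "frob2 M = frob2 (D * R)" using frob2_orthonormal_left[OF C M] CM by simp
  finally show ?thesis .
qed

section \<open>Euclidean structure of the space of tensors\<close>

lemma idx_Cons: "idx (x # xs) = (\<lambda>(a, i). a # i) ` ({..<x} \<times> idx xs)"
proof (intro equalityI subsetI)
  fix i assume i: "i \<in> idx (x # xs)"
  then obtain a j where aj: "i = a # j" by (cases i) (auto simp: idx_def)
  have all: "i ! k < (x # xs) ! k" if "k < Suc (length xs)" for k
    using i that by (auto simp: idx_def)
  have "a < x" using all[of 0] by (simp add: aj)
  moreover have "j \<in> idx xs"
    using i all[of "Suc _"] by (auto simp: idx_def aj)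
  ultimately show "i \<in> (\<lambda>(a, i). a # i) ` ({..<x} \<times> idx xs)" by (auto simp: aj)
next
  fix i assume "i \<in> (\<lambda>(a, i). a # i) ` ({..<x} \<times> idx xs)"
  then show "i \<in> idx (x # xs)" by (auto simp: idx_def nth_Cons split: nat.split)
qed

lemma idx_Nil: "idx [] = {[]}" by (auto simp: idx_def)

lemma finite_idx [simp]: "finite (idx p)"
  by (induction p) (auto simp: idx_Nil idx_Cons)

lemma card_idx: "card (idx p) = (\<Prod>k<length p. p ! k)"
proof (induction p)
  case (Cons x xs)
  have "card (idx (x # xs)) = x * card (idx xs)"
    unfolding idx_Cons by (subst card_image) (auto simp: inj_on_def card_cartesian_product)
  then show ?case using Cons by (simp add: prod.lessThan_Suc_shift del: prod.lessThan_Suc)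
qed (simp add: idx_Nil)

lemma idx_update: "i \<in> idx p \<Longrightarrow> a < p ! k \<Longrightarrow> i[k := a] \<in> idx p"
  by (auto simp: idx_def) (metis nth_list_update_eq nth_list_update_neq)

lemma idx_nth: "i \<in> idx p \<Longrightarrow> k < length p \<Longrightarrow> i ! k < p ! k"
  by (auto simp: idx_def)

lemma idx_length: "i \<in> idx p \<Longrightarrow> length i = length p"
  by (auto simp: idx_def)

definition tscale :: "real \<Rightarrow> tensor \<Rightarrow> tensor" where
  "tscale c X = (\<lambda>i. c * X i)"

lemma sum_tensor_apply: "(\<Sum>k\<in>K. F k :: tensor) i = (\<Sum>k\<in>K. F k i)"
  by (induction K rule: infinite_finite_induct) auto

lemma tensors_add [simp]: "X \<in> tensors p \<Longrightarrow> Y \<in> tensors p \<Longrightarrow> X + Y \<in> tensors p"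
  and tensors_diff [simp]: "X \<in> tensors p \<Longrightarrow> Y \<in> tensors p \<Longrightarrow> X - Y \<in> tensors p"
  and tensors_zero [simp]: "0 \<in> tensors p"
  and tensors_tscale [simp]: "X \<in> tensors p \<Longrightarrow> tscale c X \<in> tensors p"
  by (auto simp: tensors_def tscale_def)

lemma tensors_sum [simp]: "(\<And>k. k \<in> K \<Longrightarrow> F k \<in> tensors p) \<Longrightarrow> (\<Sum>k\<in>K. F k) \<in> tensors p"
  by (induction K rule: infinite_finite_induct) auto

lemma tensors_eqI:
  assumes "X \<in> tensors p" "Y \<in> tensors p" "\<And>i. i \<in> idx p \<Longrightarrow> X i = Y i"
  shows "X = Y"
proof
  fix i show "X i = Y i" using assms by (cases "i \<in> idx p") (auto simp: tensors_def)
qed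

lemma tinner_commute: "tinner p X Y = tinner p Y X"
  by (simp add: tinner_def mult.commute)

lemma tinner_add_left: "tinner p (X + Y) Z = tinner p X Z + tinner p Y Z"
  and tinner_diff_left: "tinner p (X - Y) Z = tinner p X Z - tinner p Y Z"
  and tinner_tscale_left: "tinner p (tscale c X) Z = c * tinner p X Z"
  and tinner_add_right: "tinner p Z (X + Y) = tinner p Z X + tinner p Z Y"
  and tinner_diff_right: "tinner p Z (X - Y) = tinner p Z X - tinner p Z Y"
  and tinner_tscale_right: "tinner p Z (tscale c X) = c * tinner p Z X"
  and tinner_zero_left: "tinner p 0 Z = 0"
  and tinner_zero_right: "tinner p Z 0 = 0"
  by (simp_all add: tinner_def tscale_def algebra_simps sum.distrib sum_subtractf sum_distrib_left)

lemmas tinner_simps = tinner_add_left tinner_diff_left tinner_tscale_left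
  tinner_add_right tinner_diff_right tinner_tscale_right tinner_zero_left tinner_zero_right

lemma tinner_sum_left: "tinner p (\<Sum>k\<in>K. F k) Z = (\<Sum>k\<in>K. tinner p (F k) Z)"
  by (induction K rule: infinite_finite_induct)
    (simp_all only: sum.infinite sum.empty sum.insert tinner_simps not_False_eq_True)

lemma tinner_sum_right: "tinner p Z (\<Sum>k\<in>K. F k) = (\<Sum>k\<in>K. tinner p Z (F k))"
  by (induction K rule: infinite_finite_induct)
    (simp_all only: sum.infinite sum.empty sum.insert tinner_simps not_False_eq_True)

lemma fnorm_L2: "fnorm p X = L2_set X (idx p)"
  by (simp add: fnorm_def L2_set_def)

lemma fnorm_nonneg [simp]: "0 \<le> fnorm p X"
  by (simp add: fnorm_L2)

lemma fnorm_square: "(fnorm p X)\<^sup>2 = tinner p X X"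
  by (simp add: fnorm_def tinner_def power2_eq_square[symmetric] sum_nonneg)

lemma tinner_abs_le: "\<bar>tinner p X Y\<bar> \<le> fnorm p X * fnorm p Y"
  unfolding tinner_def fnorm_def by (rule sum_product_abs_le)

lemma fnorm_triangle: "fnorm p (X + Y) \<le> fnorm p X + fnorm p Y"
  unfolding fnorm_L2 plus_fun_def by (rule L2_set_triangle_ineq)

lemma fnorm_tscale: "fnorm p (tscale c X) = \<bar>c\<bar> * fnorm p X"
  by (simp add: fnorm_def tscale_def power_mult_distrib sum_distrib_left[symmetric] real_sqrt_mult)

lemma fnorm_zero [simp]: "fnorm p 0 = 0"
  by (simp add: fnorm_def)

lemma fnorm_minus_commute: "fnorm p (X - Y) = fnorm p (Y - X)"
  by (simp add: fnorm_def power2_commute)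

lemma fnorm_triangle_minus: "fnorm p (X - Y) \<le> fnorm p X + fnorm p Y"
  using fnorm_triangle[of p X "0 - Y"] fnorm_minus_commute[of p 0 Y] by simp

lemma fnorm_sum_le: "fnorm p (\<Sum>k\<in>K. F k) \<le> (\<Sum>k\<in>K. fnorm p (F k))"
proof (induction K rule: infinite_finite_induct)
  case (insert x K)
  have "fnorm p (\<Sum>k\<in>insert x K. F k) = fnorm p (F x + (\<Sum>k\<in>K. F k))"
    using insert by (simp only: sum.insert not_False_eq_True)
  then have "fnorm p (\<Sum>k\<in>insert x K. F k) \<le> fnorm p (F x) + (\<Sum>k\<in>K. fnorm p (F k))"
    using insert(3) fnorm_triangle[of p "F x" "\<Sum>k\<in>K. F k"] by linarith
  then show ?case using insert(1,2) by (simp only: sum.insert not_False_eq_True)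
qed (simp_all only: sum.infinite sum.empty fnorm_zero order_refl not_False_eq_True)

lemma fnorm_eq_0: "X \<in> tensors p \<Longrightarrow> fnorm p X = 0 \<longleftrightarrow> X = 0"
  unfolding fnorm_L2 L2_set_eq_0_iff[OF finite_idx]
  by (auto simp: tensors_def fun_eq_iff)

lemma fnorm_le_of_square_le:
  assumes "(fnorm p X)\<^sup>2 \<le> c * fnorm p X" "0 \<le> c"
  shows "fnorm p X \<le> c"
  using assms fnorm_nonneg[of p X]
  by (cases "fnorm p X = 0") (auto simp: power2_eq_square mult_le_cancel_right)

lemma tinner_ext:
  assumes "X \<in> tensors p" "Y \<in> tensors p" "\<And>Z. Z \<in> tensors p \<Longrightarrow> tinner p X Z = tinner p Y Z"
  shows "X = Y"
proof -
  have "(fnorm p (X - Y))\<^sup>2 = 0"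
    unfolding fnorm_square using assms(3)[of "X - Y"] assms(1,2) by (simp add: tinner_diff_left)
  then show ?thesis using fnorm_eq_0[of "X - Y" p] assms by simp
qed

text \<open>Linearity is not part of the definition because self-adjointness implies it, as the
  following lemmas derive by testing against all tensors. The restriction to
  \<open>tensors p\<close> matters: entries outside \<open>idx p\<close> are invisible to the inner
  product.\<close>

definition oproj :: "nat list \<Rightarrow> (tensor \<Rightarrow> tensor) \<Rightarrow> bool" where
  "oproj p P \<longleftrightarrow> (\<forall>X\<in>tensors p. P X \<in> tensors p \<and> P (P X) = P X) \<and>
     (\<forall>X\<in>tensors p. \<forall>Y\<in>tensors p. tinner p (P X) Y = tinner p X (P Y))"

lemma oproj_closed: "oproj p P \<Longrightarrow> X \<in> tensors p \<Longrightarrow> P X \<in> tensors p"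
  and oproj_idem: "oproj p P \<Longrightarrow> X \<in> tensors p \<Longrightarrow> P (P X) = P X"
  and oproj_adj: "oproj p P \<Longrightarrow> X \<in> tensors p \<Longrightarrow> Y \<in> tensors p \<Longrightarrow> tinner p (P X) Y = tinner p X (P Y)"
  by (auto simp: oproj_def)

lemma oproj_id: "oproj p (\<lambda>X. X)"
  by (simp add: oproj_def)

lemma oproj_add: "oproj p P \<Longrightarrow> X \<in> tensors p \<Longrightarrow> Y \<in> tensors p \<Longrightarrow> P (X + Y) = P X + P Y"
  by (rule tinner_ext[of _ p]) (auto simp: oproj_closed oproj_adj tinner_simps)

lemma oproj_diff: "oproj p P \<Longrightarrow> X \<in> tensors p \<Longrightarrow> Y \<in> tensors p \<Longrightarrow> P (X - Y) = P X - P Y"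
  by (rule tinner_ext[of _ p]) (auto simp: oproj_closed oproj_adj tinner_simps)

lemma oproj_tscale: "oproj p P \<Longrightarrow> X \<in> tensors p \<Longrightarrow> P (tscale c X) = tscale c (P X)"
  by (rule tinner_ext[of _ p]) (auto simp: oproj_closed oproj_adj tinner_simps)

lemma oproj_zero: "oproj p P \<Longrightarrow> P 0 = 0"
  using oproj_diff[of p P 0 0] by simp

lemma oproj_sum:
  "oproj p P \<Longrightarrow> (\<And>k. k \<in> K \<Longrightarrow> F k \<in> tensors p) \<Longrightarrow> P (\<Sum>k\<in>K. F k) = (\<Sum>k\<in>K. P (F k))"
  by (induction K rule: infinite_finite_induct) (auto simp: oproj_zero oproj_add)

lemma oproj_compl:
  assumes P: "oproj p P"
  shows "oproj p (\<lambda>X. X - P X)"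
  unfolding oproj_def using P
  by (auto simp: oproj_closed oproj_diff oproj_idem oproj_adj tinner_simps)

lemma oproj_pythagoras:
  assumes P: "oproj p P" and X: "X \<in> tensors p"
  shows "(fnorm p X)\<^sup>2 = (fnorm p (P X))\<^sup>2 + (fnorm p (X - P X))\<^sup>2"
proof -
  have "tinner p (P X) X = tinner p (P X) (P X)"
    using oproj_adj[OF P oproj_closed[OF P X] X] oproj_idem[OF P X] by simp
  then show ?thesis unfolding fnorm_square
    by (simp add: tinner_simps tinner_commute[of p X "P X"])
qed

lemma oproj_fnorm_le:
  assumes "oproj p P" and "X \<in> tensors p"
  shows "fnorm p (P X) \<le> fnorm p X"
  using oproj_pythagoras[OF assms] zero_le_power2[of "fnorm p (X - P X)"]
  by (intro power2_le_imp_le[OF _ fnorm_nonneg]) linarith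

lemma oproj_compose:
  assumes P: "oproj p P" and Q: "oproj p Q" and comm: "\<And>X. X \<in> tensors p \<Longrightarrow> P (Q X) = Q (P X)"
  shows "oproj p (\<lambda>X. P (Q X))"
  unfolding oproj_def
proof (intro conjI ballI)
  fix X assume X: "X \<in> tensors p"
  show "P (Q X) \<in> tensors p" using P Q X by (simp add: oproj_closed)
  show "P (Q (P (Q X))) = P (Q X)"
    using comm[of "P (Q X)"] comm[OF X] oproj_closed[OF P] oproj_closed[OF Q] oproj_idem[OF P] oproj_idem[OF Q] X
    by metis
  fix Y assume Y: "Y \<in> tensors p"
  show "tinner p (P (Q X)) Y = tinner p X (P (Q Y))"
    using oproj_adj[OF P oproj_closed[OF Q X] Y] oproj_adj[OF Q X oproj_closed[OF P Y]] comm[OF Y] by simp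
qed

text \<open>Taking adjoints turns absorption on the left into absorption on the right.\<close>

lemma oproj_absorb:
  assumes P: "oproj p P" and Q: "oproj p Q" and abs: "\<And>X. X \<in> tensors p \<Longrightarrow> P (Q X) = Q X"
    and X: "X \<in> tensors p"
  shows "Q (P X) = Q X"
proof (rule tinner_ext[of _ p])
  fix Z assume Z: "Z \<in> tensors p"
  show "tinner p (Q (P X)) Z = tinner p (Q X) Z"
    using oproj_adj[OF Q oproj_closed[OF P X] Z] oproj_adj[OF P X oproj_closed[OF Q Z]] oproj_adj[OF Q X Z]
      abs[OF Z] by simp
qed (use P Q X in \<open>auto simp: oproj_closed\<close>)

section \<open>Matricization\<close>

lemma unfold_index_length [simp]: "length (unfold_index p k a b) = length p"
  by (simp add: unfold_index_def)

lemma unfold_index_nth: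
  "j < length p \<Longrightarrow> unfold_index p k a b ! j
     = (if j = k then a else (b div (\<Prod>l\<in>{..<j} - {k}. p ! l)) mod (p ! j))"
  by (simp add: unfold_index_def)

lemma unfold_index_update:
  "k < length p \<Longrightarrow> (unfold_index p k a b)[k := a'] = unfold_index p k a' b"
  by (rule nth_equalityI) (auto simp: unfold_index_nth nth_list_update)

lemma prod_lessThan_Suc_minus:
  "(\<Prod>l\<in>{..<Suc j} - {k}. f l :: nat) = (if j = k then \<Prod>l\<in>{..<j} - {k}. f l else (\<Prod>l\<in>{..<j} - {k}. f l) * f j)"
proof -
  have "{..<Suc j} - {k} = (if j = k then {..<j} - {k} else insert j ({..<j} - {k}))" by auto
  then show ?thesis by (auto simp: mult.commute)
qed

lemma prod_eq_nth_times_other_dim: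
  assumes "k < length p"
  shows "(\<Prod>j<length p. p ! j) = p ! k * other_dim p k"
  unfolding other_dim_def by (rule prod.remove) (use assms in auto)

text \<open>With positive dimensions every mixed-radix digit \<open>_ mod (p ! j)\<close> is a legal
  index, so \<open>unfold_index\<close> always lands in \<open>idx p\<close>.\<close>

locale tensor_format =
  fixes p :: "nat list"
  assumes pos: "\<And>k. k < length p \<Longrightarrow> 0 < p ! k"
begin

lemma unfold_index_in_idx: "a < p ! k \<Longrightarrow> unfold_index p k a b \<in> idx p"
  using pos by (auto simp: idx_def unfold_index_nth)

text \<open>The column index is recovered digit by digit: the first \<open>n\<close> entries
  determine \<open>b\<close> modulo the product of the first \<open>n\<close> dimensions, where mode
  \<open>k\<close> contributes no digit. For \<open>n = length p\<close> the modulus exceeds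
  \<open>b\<close>.\<close>

lemma unfold_index_inj:
  assumes k: "k < length p"
  shows "inj_on (\<lambda>(a, b). unfold_index p k a b) ({..<p ! k} \<times> {..<other_dim p k})"
proof (rule inj_onI, clarify)
  fix a b a' b'
  assume lt: "b < other_dim p k" "b' < other_dim p k"
    and eq: "unfold_index p k a b = unfold_index p k a' b'"
  have "a = a'" using arg_cong[OF eq, of "\<lambda>i. i ! k"] k by (simp add: unfold_index_nth)
  moreover have "n \<le> length p \<Longrightarrow>
      b mod (\<Prod>l\<in>{..<n} - {k}. p ! l) = b' mod (\<Prod>l\<in>{..<n} - {k}. p ! l)" for n
  proof (induction n)
    case (Suc n)
    show ?case
    proof (cases "n = k")
      case False
      have "b div (\<Prod>l\<in>{..<n} - {k}. p ! l) mod p ! n = b' div (\<Prod>l\<in>{..<n} - {k}. p ! l) mod p ! n"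
        using arg_cong[OF eq, of "\<lambda>i. i ! n"] Suc.prems False by (simp add: unfold_index_nth)
      then show ?thesis using Suc False by (simp add: prod_lessThan_Suc_minus mod_mult2_eq)
    qed (use Suc in \<open>simp add: prod_lessThan_Suc_minus\<close>)
  qed simp
  from this[of "length p"] have "b = b'" using lt by (simp add: other_dim_def)
  ultimately show "a = a' \<and> b = b'" by simp
qed

text \<open>Surjectivity follows by counting, which avoids writing down the inverse.\<close>

lemma unfold_index_bij:
  assumes k: "k < length p"
  shows "bij_betw (\<lambda>(a, b). unfold_index p k a b) ({..<p ! k} \<times> {..<other_dim p k}) (idx p)"
  unfolding bij_betw_def
proof
  let ?f = "\<lambda>(a, b). unfold_index p k a b" and ?S = "{..<p ! k} \<times> {..<other_dim p k}"
  show inj: "inj_on ?f ?S" by (rule unfold_index_inj[OF k])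
  show "?f ` ?S = idx p"
  proof (rule card_subset_eq)
    show "?f ` ?S \<subseteq> idx p" using unfold_index_in_idx by auto
    show "card (?f ` ?S) = card (idx p)"
      unfolding card_image[OF inj] card_idx prod_eq_nth_times_other_dim[OF k]
      by (simp add: card_cartesian_product)
  qed simp
qed

lemma sum_idx_unfold:
  assumes "k < length p"
  shows "(\<Sum>i\<in>idx p. f i) = (\<Sum>a<p ! k. \<Sum>b<other_dim p k. f (unfold_index p k a b))"
  using sum.reindex_bij_betw[OF unfold_index_bij[OF assms], of f, symmetric]
  by (simp add: sum.cartesian_product case_prod_unfold)

lemma idx_unfoldE:
  assumes "k < length p" "i \<in> idx p"
  obtains a b where "a < p ! k" "b < other_dim p k" "i = unfold_index p k a b"
  using assms(2) unfolding bij_betw_imp_surj_on[OF unfold_index_bij[OF assms(1)], symmetric] by auto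

lemma matricize_carrier [simp]: "matricize p k X \<in> carrier_mat (p ! k) (other_dim p k)"
  and matricize_dims [simp]: "dim_row (matricize p k X) = p ! k" "dim_col (matricize p k X) = other_dim p k"
  by (auto simp: matricize_def)

lemma matricize_index:
  "a < p ! k \<Longrightarrow> b < other_dim p k \<Longrightarrow> matricize p k X $$ (a, b) = X (unfold_index p k a b)"
  by (simp add: matricize_def)

lemma matricize_add: "matricize p k (X + Y) = matricize p k X + matricize p k Y"
  and matricize_diff: "matricize p k (X - Y) = matricize p k X - matricize p k Y"
  and matricize_tscale: "matricize p k (tscale c X) = c \<cdot>\<^sub>m matricize p k X"
  by (auto intro!: eq_matI simp: matricize_index tscale_def)

lemma matricize_inj:
  assumes "k < length p" "X \<in> tensors p" "Y \<in> tensors p" "matricize p k X = matricize p k Y"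
  shows "X = Y"
proof (rule tensors_eqI[OF assms(2,3)])
  fix i assume "i \<in> idx p"
  then obtain a b where ab: "a < p ! k" "b < other_dim p k" "i = unfold_index p k a b"
    by (rule idx_unfoldE[OF assms(1)])
  then show "X i = Y i"
    using arg_cong[OF assms(4), of "\<lambda>M. M $$ (a, b)"] by (simp add: matricize_index)
qed

lemma matricize_surj:
  assumes k: "k < length p" and M: "M \<in> carrier_mat (p ! k) (other_dim p k)"
  shows "M \<in> matricize p k ` tensors p"
proof
  let ?f = "\<lambda>(a, b). unfold_index p k a b" and ?S = "{..<p ! k} \<times> {..<other_dim p k}"
  define X where "X i = (if i \<in> idx p then M $$ (inv_into ?S ?f i) else 0)" for i
  show "X \<in> tensors p" by (simp add: X_def tensors_def)
  have "X (unfold_index p k a b) = M $$ (a, b)" if "a < p ! k" "b < other_dim p k" for a b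
    using inv_into_f_f[OF unfold_index_inj[OF k], of "(a, b)"] that
    by (simp add: X_def unfold_index_in_idx)
  then show "M = matricize p k X"
    using M by (intro eq_matI) (auto simp: matricize_index)
qed

lemma tensorize_in_tensors:
  "k < length p \<Longrightarrow> M \<in> carrier_mat (p ! k) (other_dim p k) \<Longrightarrow> tensorize p k M \<in> tensors p"
  unfolding tensorize_def by (intro inv_into_into matricize_surj)

lemma matricize_tensorize:
  "k < length p \<Longrightarrow> M \<in> carrier_mat (p ! k) (other_dim p k) \<Longrightarrow> matricize p k (tensorize p k M) = M"
  unfolding tensorize_def by (rule f_inv_into_f[of M "matricize p k" "tensors p"], rule matricize_surj)

lemma tinner_matricize:
  assumes "k < length p"
  shows "tinner p X Y = (\<Sum>a<p ! k. \<Sum>b<other_dim p k. matricize p k X $$ (a, b) * matricize p k Y $$ (a, b))"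
  unfolding tinner_def sum_idx_unfold[OF assms] by (simp add: matricize_index)

lemma fnorm_square_matricize:
  assumes "k < length p"
  shows "(fnorm p X)\<^sup>2 = frob2 (matricize p k X)"
  unfolding fnorm_square tinner_matricize[OF assms]
  by (simp add: frob2_carrier[OF matricize_carrier] power2_eq_square)

lemma mode_prod_in_tensors:
  "B \<in> carrier_mat (p ! k) c \<Longrightarrow> mode_prod p k B X \<in> tensors p"
  by (auto simp: mode_prod_def tensors_def)

lemma mode_prod_apply:
  "B \<in> carrier_mat (p ! k) c \<Longrightarrow> i \<in> idx p \<Longrightarrow>
   mode_prod p k B X i = (\<Sum>a<p ! k. B $$ (i ! k, a) * X (i[k := a]))"
  by (auto simp: mode_prod_def)

lemma matricize_mode_prod:
  assumes k: "k < length p" and B: "B \<in> carrier_mat (p ! k) (p ! k)"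
  shows "matricize p k (mode_prod p k B X) = B * matricize p k X"
proof (rule eq_matI)
  fix a b assume "a < dim_row (B * matricize p k X)" "b < dim_col (B * matricize p k X)"
  then have ab: "a < p ! k" "b < other_dim p k" using B by auto
  have "mode_prod p k B X (unfold_index p k a b) = (\<Sum>c<p ! k. B $$ (a, c) * X (unfold_index p k c b))"
    using k ab by (simp add: mode_prod_apply[OF B] unfold_index_in_idx unfold_index_nth unfold_index_update)
  then show "matricize p k (mode_prod p k B X) $$ (a, b) = (B * matricize p k X) $$ (a, b)"
    using ab by (simp add: matricize_index mat_mult_index[OF B matricize_carrier] del: index_mult_mat(1))
qed (use B in auto)

lemma mode_prod_commute:
  assumes k: "k < length p" "l < length p" "k \<noteq> l"
    and B: "B \<in> carrier_mat (p ! k) (p ! k)" and C: "C \<in> carrier_mat (p ! l) (p ! l)"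
  shows "mode_prod p k B (mode_prod p l C X) = mode_prod p l C (mode_prod p k B X)"
proof (rule tensors_eqI)
  fix i assume i: "i \<in> idx p"
  have "mode_prod p k B (mode_prod p l C X) i
      = (\<Sum>a<p ! k. B $$ (i ! k, a) * (\<Sum>c<p ! l. C $$ (i ! l, c) * X (i[k := a, l := c])))"
    using i k by (simp add: mode_prod_apply[OF B] mode_prod_apply[OF C] idx_update)
  also have "\<dots> = (\<Sum>c<p ! l. C $$ (i ! l, c) * (\<Sum>a<p ! k. B $$ (i ! k, a) * X (i[l := c, k := a])))"
    unfolding sum_distrib_left using k by (subst sum.swap) (simp add: list_update_swap mult_ac)
  also have "\<dots> = mode_prod p l C (mode_prod p k B X) i"
    using i k by (simp add: mode_prod_apply[OF B] mode_prod_apply[OF C] idx_update)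
  finally show "mode_prod p k B (mode_prod p l C X) i = mode_prod p l C (mode_prod p k B X) i" .
qed (use B C mode_prod_in_tensors in blast)+

text \<open>Symmetric idempotent factors on both sides of a matrix form an orthogonal projector for
  the Frobenius inner product. The long chain only reorders a fourfold sum. Mode projections are the
  case \<open>R = 1\<close>, projections of the row space the case \<open>L = 1\<close>.\<close>

lemma oproj_two_sided:
  assumes k: "k < length p"
    and L: "L \<in> carrier_mat (p ! k) (p ! k)" "L\<^sup>T = L" "L * L = L"
    and R: "R \<in> carrier_mat (other_dim p k) (other_dim p k)" "R\<^sup>T = R" "R * R = R"
    and P: "\<And>X. X \<in> tensors p \<Longrightarrow> P X \<in> tensors p"
      "\<And>X. X \<in> tensors p \<Longrightarrow> matricize p k (P X) = L * matricize p k X * R"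
  shows "oproj p P"
  unfolding oproj_def
proof (intro conjI ballI)
  let ?p = "p ! k" and ?q = "other_dim p k"
  have Ls: "L $$ (a, c) = L $$ (c, a)" if "a < ?p" "c < ?p" for a c
    using arg_cong[OF L(2), of "\<lambda>M. M $$ (a, c)"] that L(1) by simp
  have Rs: "R $$ (a, c) = R $$ (c, a)" if "a < ?q" "c < ?q" for a c
    using arg_cong[OF R(2), of "\<lambda>M. M $$ (a, c)"] that R(1) by simp
  fix X assume X: "X \<in> tensors p"
  show "P X \<in> tensors p" using P X by simp
  note LM = mult_carrier_mat[OF L(1) matricize_carrier[of k X]]
  have "matricize p k (P (P X)) = (L * L) * matricize p k X * (R * R)"
    unfolding P(2)[OF P(1)[OF X]] P(2)[OF X]
    using assoc_mult_mat[OF L(1) LM R(1)] assoc_mult_mat[OF mult_carrier_mat[OF L(1) LM] R(1) R(1)]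
      assoc_mult_mat[OF L(1) L(1) matricize_carrier[of k X]] by simp
  also have "\<dots> = matricize p k (P X)" unfolding L R using P X by simp
  finally show "P (P X) = P X" using P X k by (intro matricize_inj[OF k]) auto
  fix Y assume Y: "Y \<in> tensors p"
  have ix: "matricize p k (P Z) $$ (a, b) = (\<Sum>d<?q. \<Sum>c<?p. L $$ (a, c) * matricize p k Z $$ (c, d) * R $$ (d, b))"
    if "a < ?p" "b < ?q" "Z \<in> tensors p" for a b Z
    using that L(1) R(1)
    by (simp add: P(2) mat_mult_index[OF mult_carrier_mat[OF L(1) matricize_carrier] R(1)]
        mat_mult_index[OF L(1) matricize_carrier] sum_distrib_right del: index_mult_mat(1))
  have "tinner p (P X) Y = (\<Sum>a<?p. \<Sum>b<?q. \<Sum>d<?q. \<Sum>c<?p.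
      L $$ (a, c) * matricize p k X $$ (c, d) * R $$ (d, b) * matricize p k Y $$ (a, b))"
    unfolding tinner_matricize[OF k] using X by (simp add: ix sum_distrib_right)
  also have "\<dots> = (\<Sum>a<?p. \<Sum>d<?q. \<Sum>b<?q. \<Sum>c<?p.
      L $$ (a, c) * matricize p k X $$ (c, d) * R $$ (d, b) * matricize p k Y $$ (a, b))"
    by (rule sum.cong[OF refl], rule sum.swap)
  also have "\<dots> = (\<Sum>a<?p. \<Sum>d<?q. \<Sum>c<?p. \<Sum>b<?q.
      L $$ (a, c) * matricize p k X $$ (c, d) * R $$ (d, b) * matricize p k Y $$ (a, b))"
    by (rule sum.cong[OF refl], rule sum.cong[OF refl], rule sum.swap)
  also have "\<dots> = (\<Sum>a<?p. \<Sum>c<?p. \<Sum>d<?q. \<Sum>b<?q.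
      L $$ (a, c) * matricize p k X $$ (c, d) * R $$ (d, b) * matricize p k Y $$ (a, b))"
    by (rule sum.cong[OF refl], rule sum.swap)
  also have "\<dots> = (\<Sum>c<?p. \<Sum>a<?p. \<Sum>d<?q. \<Sum>b<?q.
      L $$ (a, c) * matricize p k X $$ (c, d) * R $$ (d, b) * matricize p k Y $$ (a, b))"
    by (rule sum.swap)
  also have "\<dots> = (\<Sum>c<?p. \<Sum>d<?q. \<Sum>a<?p. \<Sum>b<?q.
      L $$ (a, c) * matricize p k X $$ (c, d) * R $$ (d, b) * matricize p k Y $$ (a, b))"
    by (rule sum.cong[OF refl], rule sum.swap)
  also have "\<dots> = (\<Sum>c<?p. \<Sum>d<?q. \<Sum>b<?q. \<Sum>a<?p.
      L $$ (a, c) * matricize p k X $$ (c, d) * R $$ (d, b) * matricize p k Y $$ (a, b))"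
    by (rule sum.cong[OF refl], rule sum.cong[OF refl], rule sum.swap)
  also have "\<dots> = (\<Sum>c<?p. \<Sum>d<?q. \<Sum>b<?q. \<Sum>a<?p.
      matricize p k X $$ (c, d) * (L $$ (c, a) * matricize p k Y $$ (a, b) * R $$ (b, d)))"
    by (intro sum.cong refl) (simp add: Ls Rs mult_ac)
  also have "\<dots> = tinner p X (P Y)"
    unfolding tinner_matricize[OF k] using Y by (simp add: ix sum_distrib_left)
  finally show "tinner p (P X) Y = tinner p X (P Y)" .
qed

end

section \<open>Kronecker products and Tucker factorizations\<close>

lemma sum_div_mod:
  fixes a c :: nat
  shows
  "(\<Sum>k<a * c. f (k div c) (k mod c)) = (\<Sum>x<a. \<Sum>y<c. f x y :: real)"
proof (cases "c = 0")
  case False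
  have "(\<Sum>k<a * c. f (k div c) (k mod c)) = (\<Sum>(x, y)\<in>{..<a} \<times> {..<c}. f x y)"
  proof (rule sum.reindex_bij_witness[where i = "\<lambda>(x, y). x * c + y" and j = "\<lambda>k. (k div c, k mod c)"])
    fix z assume "z \<in> {..<a} \<times> {..<c}"
    then obtain x y where z: "z = (x, y)" "x < a" "y < c" by auto
    have "x * c + y < Suc x * c" using z by simp
    also have "\<dots> \<le> a * c" using z by (intro mult_right_mono) auto
    finally show "(case z of (x, y) \<Rightarrow> x * c + y) \<in> {..<a * c}" using z by simp
    show "((case z of (x, y) \<Rightarrow> x * c + y) div c, (case z of (x, y) \<Rightarrow> x * c + y) mod c) = z"
      using z by simp
  qed (use False in \<open>auto simp: less_mult_imp_div_less\<close>)
  then show ?thesis by (simp add: sum.cartesian_product)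
qed simp

lemma kron_orthonormal:
  assumes A: "A \<in> orthonormal_mats a b" and B: "B \<in> orthonormal_mats c d"
  shows "kron A B \<in> orthonormal_mats (a * c) (b * d)"
proof (rule orthonormal_matsI)
  note AD = orthonormal_matsD(1)[OF A] and BD = orthonormal_matsD(1)[OF B]
  show "kron A B \<in> carrier_mat (a * c) (b * d)" using AD BD by (simp add: kron_def)
  fix i j assume ij: "i < b * d" "j < b * d"
  then have d: "0 < d" by (cases "d = 0") auto
  have lt: "i div d < b" "j div d < b" "i mod d < d" "j mod d < d"
    using ij d by (auto simp: less_mult_imp_div_less)
  have "(\<Sum>k<a * c. kron A B $$ (k, i) * kron A B $$ (k, j))
      = (\<Sum>k<a * c. (A $$ (k div c, i div d) * A $$ (k div c, j div d)) * (B $$ (k mod c, i mod d) * B $$ (k mod c, j mod d)))"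
    using ij AD BD by (intro sum.cong refl) (simp add: kron_def)
  also have "\<dots> = (\<Sum>x<a. \<Sum>y<c. (A $$ (x, i div d) * A $$ (x, j div d)) * (B $$ (y, i mod d) * B $$ (y, j mod d)))"
    by (rule sum_div_mod)
  also have "\<dots> = (\<Sum>x<a. A $$ (x, i div d) * A $$ (x, j div d)) * (\<Sum>y<c. B $$ (y, i mod d) * B $$ (y, j mod d))"
    by (simp add: sum_product)
  also have "\<dots> = (if i div d = j div d \<and> i mod d = j mod d then 1 else 0)"
    using orthonormal_mats_col_sum[OF A lt(1,2)] orthonormal_mats_col_sum[OF B lt(3,4)] by simp
  also have "(i div d = j div d \<and> i mod d = j mod d) = (i = j)"
    by (metis mult_div_mod_eq)
  finally show "(\<Sum>k<a * c. kron A B $$ (k, i) * kron A B $$ (k, j)) = (if i = j then 1 else 0)" .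
qed

lemma kron_others_0: "kron_others 0 U k = 1\<^sub>m 1"
  by (simp add: kron_others_def)

lemma kron_others_Suc:
  "kron_others (Suc n) U k = (if n = k then kron_others n U k else kron (U n) (kron_others n U k))"
  by (simp add: kron_others_def)

lemma kron_others_orthonormal:
  assumes "\<And>j. j < n \<Longrightarrow> U j \<in> orthonormal_mats (p ! j) (r ! j)"
  shows "kron_others n U k \<in> orthonormal_mats (\<Prod>l\<in>{..<n} - {k}. p ! l) (\<Prod>l\<in>{..<n} - {k}. r ! l)"
  using assms
proof (induction n)
  case 0
  then show ?case by (simp add: kron_others_0 orthonormal_mats_def)
next
  case (Suc n)
  then show ?case
    using kron_orthonormal[OF Suc.prems[of n] Suc.IH]
    by (auto simp: kron_others_Suc prod_lessThan_Suc_minus mult.commute)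
qed

lemma mod_div_mod_cancel:
  fixes b x y z :: nat
  assumes "0 < x * y * z"
  shows "(b mod (x * y * z)) div x mod y = b div x mod y"
proof -
  have "b mod (x * (y * z)) = x * (b div x mod (y * z)) + b mod x" by (rule mod_mult2_eq)
  then have "(b mod (x * y * z)) div x = b div x mod (y * z)" using assms by (simp add: mult.assoc)
  then show ?thesis by (simp add: mod_mod_cancel)
qed

text \<open>The product of the first \<open>n\<close> radices is a multiple of the one that includes
  radix \<open>j\<close>, so reduction modulo it leaves digit \<open>j\<close> unchanged.\<close>

lemma digit_mod:
  fixes f :: "nat \<Rightarrow> nat"
  assumes "j < n" "j \<noteq> k" "0 < (\<Prod>l\<in>{..<n} - {k}. f l)"
  shows "(b mod (\<Prod>l\<in>{..<n} - {k}. f l)) div (\<Prod>l\<in>{..<j} - {k}. f l) mod f j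
    = b div (\<Prod>l\<in>{..<j} - {k}. f l) mod f j"
proof -
  have "(\<Prod>l\<in>{..<Suc j} - {k}. f l) dvd (\<Prod>l\<in>{..<n} - {k}. f l)"
    using assms by (intro prod_dvd_prod_subset) auto
  then obtain z where "(\<Prod>l\<in>{..<n} - {k}. f l) = (\<Prod>l\<in>{..<j} - {k}. f l) * f j * z"
    using assms(2) by (auto simp: prod_lessThan_Suc_minus)
  then show ?thesis using mod_div_mod_cancel assms(3) by metis
qed

text \<open>The newest factor \<open>U n\<close> stands in front, so its indices are the quotients
  by the earlier dimensions, that is the top digits, while the remainders index the rest. This is
  the digit order of \<open>unfold_index\<close>, which makes Kronecker products compatible with
  matricization.\<close>

lemma kron_others_index:
  assumes "\<And>j. j < n \<Longrightarrow> U j \<in> carrier_mat (p ! j) (r ! j)"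
    and "b < (\<Prod>l\<in>{..<n} - {k}. p ! l)" "c < (\<Prod>l\<in>{..<n} - {k}. r ! l)"
  shows "dim_row (kron_others n U k) = (\<Prod>l\<in>{..<n} - {k}. p ! l)"
    and "dim_col (kron_others n U k) = (\<Prod>l\<in>{..<n} - {k}. r ! l)"
    and "kron_others n U k $$ (b, c) = (\<Prod>j\<in>{..<n} - {k}.
      U j $$ ((b div (\<Prod>l\<in>{..<j} - {k}. p ! l)) mod (p ! j), (c div (\<Prod>l\<in>{..<j} - {k}. r ! l)) mod (r ! j)))"
  using assms
proof (induction n arbitrary: b c)
  case 0
  case 1 show ?case by (simp add: kron_others_0)
  case 2 show ?case by (simp add: kron_others_0)
  case 3 then show ?case by (simp add: kron_others_0)
next
  case (Suc n)
  let ?D = "\<Prod>l\<in>{..<n} - {k}. p ! l" and ?D' = "\<Prod>l\<in>{..<n} - {k}. r ! l"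
  have pos: "0 < ?D" "0 < ?D'"
    if "b < (\<Prod>l\<in>{..<Suc n} - {k}. p ! l)" "c < (\<Prod>l\<in>{..<Suc n} - {k}. r ! l)" for b c
    using that by (metis gr_zeroI mult_is_0 not_less0 prod_lessThan_Suc_minus)+
  have dims: "dim_row (kron_others n U k) = ?D" "dim_col (kron_others n U k) = ?D'"
    if "\<And>j. j < Suc n \<Longrightarrow> U j \<in> carrier_mat (p ! j) (r ! j)"
      "b < (\<Prod>l\<in>{..<Suc n} - {k}. p ! l)" "c < (\<Prod>l\<in>{..<Suc n} - {k}. r ! l)" for b c
    using Suc.IH(1)[of 0 0] Suc.IH(2)[of 0 0] pos[OF that(2,3)] that(1) by auto
  case 1 then show ?case
    using dims[OF 1] 1(1)[of n] by (auto simp: kron_others_Suc prod_lessThan_Suc_minus kron_def mult.commute)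
  case 2 then show ?case
    using dims[OF 2] 2(1)[of n] by (auto simp: kron_others_Suc prod_lessThan_Suc_minus kron_def mult.commute)
  case 3
  note prem = 3
  show ?case
  proof (cases "n = k")
    case True
    have "{..<Suc n} - {k} = {..<n} - {k}" using True by auto
    then show ?thesis using Suc.IH(3)[of b c] prem True by (simp add: kron_others_Suc)
  next
    case False
    have bc: "b < ?D * p ! n" "c < ?D' * r ! n"
      using prem(2,3) False by (auto simp: prod_lessThan_Suc_minus)
    note P = pos[OF prem(2,3)] and dm = dims[OF prem]
    have lt: "b div ?D < p ! n" "c div ?D' < r ! n"
      using bc by (auto simp: less_mult_imp_div_less mult.commute)
    have lt': "b mod ?D < ?D" "c mod ?D' < ?D'" using P by auto
    have Un: "U n \<in> carrier_mat (p ! n) (r ! n)" using prem(1) by simp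
    have "kron_others (Suc n) U k $$ (b, c) = U n $$ (b div ?D, c div ?D') * kron_others n U k $$ (b mod ?D, c mod ?D')"
      using False bc Un dm by (simp add: kron_others_Suc kron_def mult.commute)
    also have "kron_others n U k $$ (b mod ?D, c mod ?D') = (\<Prod>j\<in>{..<n} - {k}.
      U j $$ ((b div (\<Prod>l\<in>{..<j} - {k}. p ! l)) mod (p ! j), (c div (\<Prod>l\<in>{..<j} - {k}. r ! l)) mod (r ! j)))"
      using Suc.IH(3)[OF _ lt'] prem(1) P by (simp add: digit_mod)
    also have "U n $$ (b div ?D, c div ?D') = U n $$ ((b div ?D) mod (p ! n), (c div ?D') mod (r ! n))"
      using lt by simp
    finally show ?thesis using False by (simp add: lessThan_Suc insert_Diff_if)
  qed
qed

lemma idx_snoc: "idx (xs @ [x]) = (\<lambda>(i, a). i @ [a]) ` (idx xs \<times> {..<x})"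
proof (intro equalityI subsetI)
  fix i assume i: "i \<in> idx (xs @ [x])"
  then obtain j a where aj: "i = j @ [a]" by (cases i rule: rev_cases) (auto simp: idx_def)
  have len: "length j = length xs" using i by (simp add: idx_def aj)
  have all: "i ! k < (xs @ [x]) ! k" if "k < Suc (length xs)" for k
    using i that by (auto simp: idx_def)
  have "a < x" using all[of "length xs"] len by (simp add: aj nth_append)
  moreover have "j \<in> idx xs"
    unfolding idx_def using len all by (auto simp: aj nth_append) (metis less_SucI)
  ultimately show "i \<in> (\<lambda>(i, a). i @ [a]) ` (idx xs \<times> {..<x})" by (auto simp: aj)
next
  fix i assume "i \<in> (\<lambda>(i, a). i @ [a]) ` (idx xs \<times> {..<x})"
  then show "i \<in> idx (xs @ [x])" by (auto simp: idx_def nth_append)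
qed

text \<open>After \<open>k\<close> products the first \<open>k\<close> modes have the dimensions of
  \<open>p\<close> and the others still those of \<open>r\<close>, hence the mixed index set. The
  first \<open>k\<close> indices of \<open>S\<close> are summed over, the remaining ones are passed
  through.\<close>

lemma mode_prods_index:
  assumes len: "length r = length p" and k: "k \<le> length p"
    and U: "\<And>j. j < length p \<Longrightarrow> U j \<in> carrier_mat (p ! j) (r ! j)"
    and i: "i \<in> idx (take k p @ drop k r)"
  shows "mode_prods r U k S i = (\<Sum>c\<in>idx (take k r). (\<Prod>j<k. U j $$ (i ! j, c ! j)) * S (c @ drop k i))"
  using k i
proof (induction k arbitrary: i)
  case 0
  then show ?case by (simp add: idx_Nil)
next
  case (Suc k)
  have k: "k < length p" using Suc.prems by simp
  have fmt: "map (\<lambda>l. dim_row (U l)) [0..<k] @ drop k r = take k p @ drop k r"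
    using k carrier_matD(1)[OF U] by (intro arg_cong2[of _ _ _ _ "(@)"] refl nth_equalityI) auto
  have Uk: "dim_row (U k) = p ! k" using U[OF k] by simp
  have fmt': "(take k p @ drop k r)[k := p ! k] = take (Suc k) p @ drop (Suc k) r"
    using k len by (simp add: list_update_append take_Suc_conv_app_nth Cons_nth_drop_Suc[symmetric])
  have nthk: "(take k p @ drop k r) ! k = r ! k" using k len by (simp add: nth_append)
  have leni: "length i = length p" using idx_length[OF Suc.prems(2)] len by simp
  have upd: "i[k := a] \<in> idx (take k p @ drop k r)" if a: "a < r ! k" for a
    unfolding idx_def
  proof (intro CollectI conjI allI impI)
    show "length (i[k := a]) = length (take k p @ drop k r)" using leni len by simp
    fix l assume l: "l < length (take k p @ drop k r)"
    show "i[k := a] ! l < (take k p @ drop k r) ! l"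
    proof (cases "l = k")
      case True
      then show ?thesis using a k leni nthk by simp
    next
      case False
      have "i ! l < (take (Suc k) p @ drop (Suc k) r) ! l"
        using idx_nth[OF Suc.prems(2), of l] l len k by simp
      then show ?thesis using False by (simp add: fmt'[symmetric])
    qed
  qed
  have dropi: "drop k (i[k := a]) = a # drop (Suc k) i" for a
    using k leni by (simp add: Cons_nth_drop_Suc[symmetric] drop_update_swap)
  have "mode_prods r U (Suc k) S i = (\<Sum>a<r ! k. U k $$ (i ! k, a) * mode_prods r U k S (i[k := a]))"
    using Suc.prems(2) by (simp add: fmt mode_prod_def Uk fmt' nthk)
  also have "\<dots> = (\<Sum>a<r ! k. \<Sum>c\<in>idx (take k r).
      U k $$ (i ! k, a) * ((\<Prod>j<k. U j $$ (i ! j, c ! j)) * S (c @ a # drop (Suc k) i)))"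
    using k by (intro sum.cong refl) (simp add: Suc.IH[OF _ upd] dropi sum_distrib_left)
  also have "\<dots> = (\<Sum>c\<in>idx (take k r). \<Sum>a<r ! k.
      U k $$ (i ! k, a) * ((\<Prod>j<k. U j $$ (i ! j, c ! j)) * S (c @ a # drop (Suc k) i)))"
    by (rule sum.swap)
  also have "\<dots> = (\<Sum>z\<in>idx (take k r) \<times> {..<r ! k}.
      (\<Prod>j<Suc k. U j $$ (i ! j, (fst z @ [snd z]) ! j)) * S ((fst z @ [snd z]) @ drop (Suc k) i))"
    unfolding sum.cartesian_product
  proof (rule sum.cong[OF refl], clarify)
    fix c a assume c: "c \<in> idx (take k r)"
    have lc: "length c = k" using idx_length[OF c] k len by simp
    then show "U k $$ (i ! k, a) * ((\<Prod>j<k. U j $$ (i ! j, c ! j)) * S (c @ a # drop (Suc k) i))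
      = (\<Prod>j<Suc k. U j $$ (i ! j, (fst (c, a) @ [snd (c, a)]) ! j)) * S ((fst (c, a) @ [snd (c, a)]) @ drop (Suc k) i)"
      by (simp add: nth_append)
  qed
  also have "\<dots> = (\<Sum>c\<in>idx (take k r @ [r ! k]). (\<Prod>j<Suc k. U j $$ (i ! j, c ! j)) * S (c @ drop (Suc k) i))"
    unfolding idx_snoc by (subst sum.reindex) (auto simp: inj_on_def case_prod_unfold simp del: prod.lessThan_Suc)
  also have "take k r @ [r ! k] = take (Suc k) r" using k len by (simp add: take_Suc_conv_app_nth)
  finally show ?case .
qed

section \<open>Orthogonal projectors of matrices with orthonormal columns\<close>

lemma orth_proj_carrier: "U \<in> carrier_mat a b \<Longrightarrow> orth_proj U \<in> carrier_mat a a"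
  by (simp add: orth_proj_def)

lemma orth_proj_sym: "U \<in> carrier_mat a b \<Longrightarrow> (orth_proj U)\<^sup>T = orth_proj U"
  by (simp add: orth_proj_def transpose_mult[of _ a b])

lemma orth_proj_fix: "U \<in> orthonormal_mats a b \<Longrightarrow> orth_proj U * U = U"
  using assoc_mult_mat[of U a b "U\<^sup>T" a U b] orthonormal_matsD[of U a b] by (simp add: orth_proj_def)

lemma orth_proj_idem: "U \<in> orthonormal_mats a b \<Longrightarrow> orth_proj U * orth_proj U = orth_proj U"
  using assoc_mult_mat[of "orth_proj U" a a U b "U\<^sup>T" a] orth_proj_fix[of U a b] orthonormal_matsD[of U a b]
    orth_proj_carrier[of U a b]
  unfolding orth_proj_def by simp

text \<open>Each row of \<open>M\<close> has the form \<open>V *\<^sub>v x\<close> and is fixed by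
  the projector, which being symmetric may act from the right. An inclusion of spaces is what
  \<open>tangent_frame\<close> supplies, also at an iterate of smaller Tucker rank.\<close>

lemma row_space_mult_orth_proj:
  assumes M: "M \<in> carrier_mat a b" and V: "V \<in> orthonormal_mats b c"
    and sub: "vec_space.row_space b M \<subseteq> vec_space.col_space b V"
  shows "M * orth_proj V = M"
proof (rule eq_matI)
  interpret vec_space "TYPE(real)" b .
  note VD = orthonormal_matsD[OF V]
  have PV: "orth_proj V \<in> carrier_mat b b" by (rule orth_proj_carrier[OF VD(1)])
  fix i j assume "i < dim_row M" "j < dim_col M"
  then have ij: "i < a" "j < b" using M by auto
  have "row M i \<in> row_space M"
    unfolding row_space_def using M ij by (intro span_mem) (auto simp: rows_def)
  then obtain x where x: "x \<in> carrier_vec c" "row M i = V *\<^sub>v x"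
    using sub VD(1) unfolding col_space_eq[OF VD(1)] by auto
  have "orth_proj V *\<^sub>v row M i = (orth_proj V * V) *\<^sub>v x"
    unfolding x(2) using PV VD(1) x(1) by simp
  also have "\<dots> = row M i" unfolding orth_proj_fix[OF V] x(2) ..
  finally have row_fixed: "orth_proj V *\<^sub>v row M i = row M i" .
  have "(M * orth_proj V) $$ (i, j) = row M i \<bullet> col (orth_proj V) j" using M PV ij by simp
  also have "col (orth_proj V) j = row (orth_proj V) j"
    using orth_proj_sym[OF VD(1)] PV ij by (metis carrier_matD(1) col_transpose)
  also have "row M i \<bullet> row (orth_proj V) j = (orth_proj V *\<^sub>v row M i) $ j"
    using M PV ij by (simp add: comm_scalar_prod[of _ b])
  also have "\<dots> = M $$ (i, j)" unfolding row_fixed using M ij by simp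
  finally show "(M * orth_proj V) $$ (i, j) = M $$ (i, j)" .
qed (use M orthonormal_matsD(1)[OF V] in \<open>auto simp: orth_proj_def\<close>)

section \<open>Projections onto the modes\<close>

text \<open>Only orthonormality is assumed, so the locale serves both the tangent frame at an
  iterate and the factors of a truncated HOSVD.\<close>

locale mode_projections = tensor_format p for p :: "nat list" +
  fixes r :: "nat list" and U :: "nat \<Rightarrow> real mat"
  assumes orthU: "\<And>k. k < length p \<Longrightarrow> U k \<in> orthonormal_mats (p ! k) (r ! k)"
begin

definition Pm :: "nat \<Rightarrow> tensor \<Rightarrow> tensor" where
  "Pm k X = mode_prod p k (orth_proj (U k)) X"

text \<open>The partial products of the mode projections are kept because the telescoping sums and
  the sequential HOSVD both refer to the intermediate stages.\<close>

definition Cm :: "nat \<Rightarrow> tensor \<Rightarrow> tensor" where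
  "Cm k X = mode_prods p (\<lambda>l. orth_proj (U l)) k X"

lemma orth_proj_U_carrier: "k < length p \<Longrightarrow> orth_proj (U k) \<in> carrier_mat (p ! k) (p ! k)"
  using orth_proj_carrier[OF orthonormal_matsD(1)[OF orthU]] .

lemma Pm_in_tensors [simp]: "k < length p \<Longrightarrow> Pm k X \<in> tensors p"
  unfolding Pm_def by (rule mode_prod_in_tensors[OF orth_proj_U_carrier])

lemma matricize_Pm: "k < length p \<Longrightarrow> matricize p k (Pm k X) = orth_proj (U k) * matricize p k X"
  unfolding Pm_def by (rule matricize_mode_prod[OF _ orth_proj_U_carrier])

lemma oproj_Pm:
  assumes k: "k < length p"
  shows "oproj p (Pm k)"
proof (rule oproj_two_sided[OF k orth_proj_U_carrier[OF k]
      orth_proj_sym[OF orthonormal_matsD(1)[OF orthU[OF k]]] orth_proj_idem[OF orthU[OF k]],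
      of "1\<^sub>m (other_dim p k)"])
  show "matricize p k (Pm k X) = orth_proj (U k) * matricize p k X * 1\<^sub>m (other_dim p k)" for X
    unfolding matricize_Pm[OF k]
    by (rule right_mult_one_mat[OF mult_carrier_mat[OF orth_proj_U_carrier[OF k] matricize_carrier], symmetric])
qed (use k orthonormal_matsD(1)[OF orthU[OF k]] in auto)

lemma Pm_commute:
  "k < length p \<Longrightarrow> l < length p \<Longrightarrow> Pm k (Pm l X) = Pm l (Pm k X)"
  unfolding Pm_def by (cases "k = l") (auto intro: mode_prod_commute orth_proj_U_carrier)

lemma Cm_0: "Cm 0 X = X"
  by (simp add: Cm_def)

lemma Cm_Suc:
  assumes k: "k < length p"
  shows "Cm (Suc k) X = Pm k (Cm k X)"
proof -
  have "map (\<lambda>l. dim_row (orth_proj (U l))) [0..<k] @ drop k p = take k p @ drop k p"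
    using k carrier_matD(1)[OF orth_proj_U_carrier]
    by (intro arg_cong2[of _ _ _ _ "(@)"] refl nth_equalityI) auto
  then show ?thesis by (simp add: Cm_def Pm_def)
qed

lemma Cm_in_tensors: "k \<le> length p \<Longrightarrow> X \<in> tensors p \<Longrightarrow> Cm k X \<in> tensors p"
  by (cases k) (auto simp: Cm_0 Cm_Suc)

text \<open>\<open>Q\<close> is arbitrary so that it can later be a mode projection, or a projection
  onto the column space of a competitor.\<close>

lemma Cm_commute:
  assumes "k \<le> length p" and X: "X \<in> tensors p"
    and "\<And>X l. X \<in> tensors p \<Longrightarrow> l < k \<Longrightarrow> Q (Pm l X) = Pm l (Q X)"
  shows "Q (Cm k X) = Cm k (Q X)"
  using assms(1,3)
proof (induction k)
  case (Suc k)
  then show ?case using Cm_in_tensors[OF _ X, of k] by (simp add: Cm_Suc)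
qed (simp add: Cm_0)

lemma Pm_Cm_commute:
  assumes "k < length p" "l \<le> length p" "X \<in> tensors p"
  shows "Pm k (Cm l X) = Cm l (Pm k X)"
  using assms(2,3)
proof (rule Cm_commute)
  show "Pm k (Pm j Y) = Pm j (Pm k Y)" if "j < l" for Y j
    using that assms by (intro Pm_commute) simp_all
qed

lemma oproj_Cm: "k \<le> length p \<Longrightarrow> oproj p (Cm k)"
proof (induction k)
  case 0
  then show ?case using oproj_id by (simp add: Cm_0[abs_def])
next
  case (Suc k)
  then have k: "k < length p" by simp
  have "oproj p (\<lambda>X. Pm k (Cm k X))"
    using oproj_compose[of p "Pm k" "Cm k", OF oproj_Pm[OF k] Suc.IH Pm_Cm_commute] k by simp
  moreover have "Cm (Suc k) = (\<lambda>X. Pm k (Cm k X))" using Cm_Suc[OF k] by auto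
  ultimately show ?case by simp
qed

lemma Pm_Cm:
  assumes "k \<le> length p" "j < k" "X \<in> tensors p"
  shows "Pm j (Cm k X) = Cm k X"
  using assms(1,2)
proof (induction k)
  case (Suc k)
  then have k: "k < length p" by simp
  show ?case
  proof (cases "j = k")
    case True
    then show ?thesis using oproj_idem[OF oproj_Pm[OF k]] Cm_in_tensors[of k X] assms k by (simp add: Cm_Suc)
  next
    case False
    then show ?thesis using Suc k Pm_commute[of j k "Cm k X"] by (simp add: Cm_Suc)
  qed
qed simp

lemma Cm_Pm:
  assumes "k \<le> length p" "j < k" "X \<in> tensors p"
  shows "Cm k (Pm j X) = Cm k X"
  using assms by (intro oproj_absorb[OF oproj_Pm oproj_Cm]) (auto intro: Pm_Cm)

lemma Cm_fixed:
  assumes "X \<in> tensors p" "\<And>k. k < length p \<Longrightarrow> Pm k X = X" "k \<le> length p"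
  shows "Cm k X = X"
  using assms(3) by (induction k) (auto simp: Cm_0 Cm_Suc assms)

lemma Cm_telescope:
  assumes "k \<le> length p"
  shows "X - Cm k X = (\<Sum>l<k. Cm l X - Pm l (Cm l X))"
  using assms
proof (induction k)
  case (Suc k)
  have "X - Cm (Suc k) X = (X - Cm k X) + (Cm k X - Pm k (Cm k X))"
    using Suc.prems by (simp add: Cm_Suc)
  then show ?case using Suc by simp
qed (simp add: Cm_0)

text \<open>The new increment lies in the range of \<open>Cm k\<close>, the error so far in its
  kernel. This orthogonality is why the quasi-optimality constant contains the square root of the
  number of modes.\<close>

lemma Cm_error_square:
  assumes "k \<le> length p" and X: "X \<in> tensors p"
  shows "(fnorm p (X - Cm k X))\<^sup>2 = (\<Sum>l<k. (fnorm p (Cm l X - Pm l (Cm l X)))\<^sup>2)"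
  using assms(1)
proof (induction k)
  case 0
  show ?case by (simp add: Cm_0 fnorm_def)
next
  case (Suc k)
  then have k: "k < length p" by simp
  define Y where "Y = Cm k X - Pm k (Cm k X)"
  note C = oproj_Cm[of k] and CX = Cm_in_tensors[of k X]
  have Y: "Y \<in> tensors p" using k CX X by (simp add: Y_def)
  have "Cm k (Pm k (Cm k X)) = Pm k (Cm k (Cm k X))"
    using k X CX by (intro Pm_Cm_commute[symmetric]) simp_all
  then have "Cm k Y = Y"
    unfolding Y_def using oproj_diff[OF C CX Pm_in_tensors[OF k]] oproj_idem[OF C X] k X by (metis less_imp_le)
  then have "tinner p (X - Cm k X) Y = 0"
    using oproj_adj[OF C tensors_diff[OF X CX] Y] oproj_diff[OF C X CX] oproj_idem[OF C X] X k
    by (metis cancel_comm_monoid_add_class.diff_cancel less_imp_le tinner_zero_left)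
  moreover have "X - Cm (Suc k) X = (X - Cm k X) + Y" using k by (simp add: Cm_Suc Y_def)
  ultimately have "(fnorm p (X - Cm (Suc k) X))\<^sup>2 = (fnorm p (X - Cm k X))\<^sup>2 + (fnorm p Y)\<^sup>2"
    using tinner_commute[of p Y "X - Cm k X"] by (simp only: fnorm_square tinner_add_left tinner_add_right)
  then show ?case using Suc.IH k by (simp only: sum.lessThan_Suc Y_def less_imp_le)
qed

end

section \<open>Quasi-optimality of the truncated higher-order SVD\<close>

context tensor_format
begin

text \<open>By Pythagoras, a small residual means much captured energy, and leading singular vectors
  capture the most among all choices of at most \<open>r\<close> orthonormal columns.\<close>

lemma is_SVD_mode_error:
  assumes k: "k < length p" and Z: "Z \<in> tensors p"
    and SVD: "is_SVD r (matricize p k Z) U" and C: "C \<in> orthonormal_mats (p ! k) m" and mr: "m \<le> r" "1 \<le> r"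
  shows "fnorm p (Z - mode_prod p k (orth_proj U) Z) \<le> fnorm p (Z - mode_prod p k (orth_proj C) Z)"
proof -
  have proj: "(fnorm p Z)\<^sup>2 = frob2 (B\<^sup>T * matricize p k Z) + (fnorm p (Z - mode_prod p k (orth_proj B) Z))\<^sup>2"
    if B: "B \<in> orthonormal_mats (p ! k) c" for B c
  proof -
    note BD = orthonormal_matsD[OF B]
    have Bc: "orth_proj B \<in> carrier_mat (p ! k) (p ! k)" by (rule orth_proj_carrier[OF BD(1)])
    have M: "matricize p k (mode_prod p k (orth_proj B) X) = orth_proj B * matricize p k X" for X
      by (rule matricize_mode_prod[OF k Bc])
    have "oproj p (mode_prod p k (orth_proj B))"
      by (rule oproj_two_sided[OF k Bc orth_proj_sym[OF BD(1)] orth_proj_idem[OF B],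
            of "1\<^sub>m (other_dim p k)"])
        (auto simp: M mode_prod_in_tensors[OF Bc]
          right_mult_one_mat[OF mult_carrier_mat[OF Bc matricize_carrier]])
    moreover have "(fnorm p (mode_prod p k (orth_proj B) Z))\<^sup>2 = frob2 (B\<^sup>T * matricize p k Z)"
    proof -
      have "orth_proj B * matricize p k Z = B * (B\<^sup>T * matricize p k Z)"
        unfolding orth_proj_def by (rule assoc_mult_mat[OF BD(1,2) matricize_carrier])
      then show ?thesis
        unfolding fnorm_square_matricize[OF k] M
        using frob2_orthonormal_left[OF B mult_carrier_mat[OF BD(2) matricize_carrier]] by simp
    qed
    ultimately show ?thesis using oproj_pythagoras[OF _ Z] by simp
  qed
  have "U \<in> orthonormal_mats (p ! k) r" using is_SVD_orthonormal[OF SVD] by simp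
  moreover have "frob2 (C\<^sup>T * matricize p k Z) \<le> frob2 (U\<^sup>T * matricize p k Z)"
    using is_SVD_maximal[OF SVD _ mr] C by simp
  ultimately have "(fnorm p (Z - mode_prod p k (orth_proj U) Z))\<^sup>2 \<le> (fnorm p (Z - mode_prod p k (orth_proj C) Z))\<^sup>2"
    using proj[of U r] proj[OF C] by linarith
  then show ?thesis by (rule power2_le_imp_le) simp
qed

text \<open>Each of the orthogonal increments of \<open>Z - Z'\<close> is at most the distance from
  \<open>Z\<close> to the competitor \<open>X\<close>, so together they give the square root; the
  additional 1 is the triangle inequality through \<open>Z\<close>.\<close>

lemma hosvd_quasi_optimal:
  assumes Z: "Z \<in> tensors p" and X: "X \<in> tensors p" and len: "length r = length p"
    and r: "\<And>k. k < length p \<Longrightarrow> 1 \<le> r ! k" and rank: "list_all2 (\<le>) (tucrank p X) r"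
    and H: "t_hosvd p r Z Z' \<or> st_hosvd p r Z Z'"
  shows "Z' \<in> tensors p" and "fnorm p (Z' - X) \<le> (sqrt (real (length p)) + 1) * fnorm p (Z - X)"
proof -
  obtain U where Z': "Z' = mode_prods p (\<lambda>k. orth_proj (U k)) (length p) Z"
    and SVD: "(\<forall>k<length p. is_SVD (r ! k) (matricize p k Z) (U k)) \<or>
      (\<forall>k<length p. is_SVD (r ! k) (matricize p k (mode_prods p (\<lambda>l. orth_proj (U l)) k Z)) (U k))"
    using H by (auto simp: t_hosvd_def st_hosvd_def)
  interpret mode_projections p r U
  proof
    fix k assume "k < length p"
    then show "U k \<in> orthonormal_mats (p ! k) (r ! k)"
      using SVD is_SVD_orthonormal[of "r ! k" _ "U k"] by (metis matricize_dims(1))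
  qed
  have Z'C: "Z' = Cm (length p) Z" by (simp add: Z' Cm_def)
  show "Z' \<in> tensors p" using Cm_in_tensors[of "length p" Z] Z by (simp add: Z'C)
  have err: "fnorm p (Cm k Z - Pm k (Cm k Z)) \<le> fnorm p (Z - X)" if k: "k < length p" for k
  proof -
    let ?D = "matricize p k X"
    obtain m C where m: "m \<le> vec_space.rank (p ! k) ?D" and C: "C \<in> orthonormal_mats (p ! k) m"
      and rec: "C * (C\<^sup>T * ?D) = ?D"
      using left_singular_basis[OF matricize_carrier] by metis
    have "vec_space.rank (p ! k) ?D \<le> r ! k"
      using list_all2_nthD2[OF rank, of k] k len by (simp add: tucrank_def)
    then have mr: "m \<le> r ! k" using m by simp
    \<comment> \<open>\<open>Q\<close> projects mode \<open>k\<close> onto the column space of the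
      matricized \<open>X\<close>. It fixes \<open>X\<close>, so its residual at \<open>Z\<close> is
      its residual at \<open>Z - X\<close>; and \<open>C\<close> has at most \<open>r ! k\<close>
      columns, so the singular vectors do at least as well.\<close>
    define Q where "Q Y = mode_prod p k (orth_proj C) Y" for Y
    note CD = orthonormal_matsD[OF C]
    have Cc: "orth_proj C \<in> carrier_mat (p ! k) (p ! k)" by (rule orth_proj_carrier[OF CD(1)])
    have M: "matricize p k (Q Y) = orth_proj C * matricize p k Y" for Y
      unfolding Q_def by (rule matricize_mode_prod[OF k Cc])
    have Qt: "Q Y \<in> tensors p" for Y unfolding Q_def by (rule mode_prod_in_tensors[OF Cc])
    have Q: "oproj p Q"
      by (rule oproj_two_sided[OF k Cc orth_proj_sym[OF CD(1)] orth_proj_idem[OF C],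
            of "1\<^sub>m (other_dim p k)"])
        (auto simp: M Qt right_mult_one_mat[OF mult_carrier_mat[OF Cc matricize_carrier]])
    have "matricize p k (Q X) = ?D"
      using rec unfolding M orth_proj_def assoc_mult_mat[OF CD(1,2) matricize_carrier] .
    then have QX: "Q X = X" using X Qt by (intro matricize_inj[OF k]) auto
    have QZ: "fnorm p (Z - Q Z) \<le> fnorm p (Z - X)"
    proof -
      have eq: "(Z - X) - Q (Z - X) = Z - Q Z" using oproj_diff[OF Q Z X] QX by simp
      show ?thesis
        using oproj_fnorm_le[OF oproj_compl[OF Q] tensors_diff[OF Z X]] unfolding eq .
    qed
    note C_k = oproj_Cm[of k] and CZ = Cm_in_tensors[of k Z]
    have comm: "Cm k Z - Pm k (Cm k Z) = Cm k (Z - Pm k Z)"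
    proof -
      have "Pm k (Cm k Z) = Cm k (Pm k Z)"
        using k Z by (intro Pm_Cm_commute) simp_all
      then show ?thesis using oproj_diff[OF C_k] k Z by simp
    qed
    have commQ: "Cm k Z - Q (Cm k Z) = Cm k (Z - Q Z)"
    proof -
      have "Q (Cm k Z) = Cm k (Q Z)"
        unfolding Q_def Pm_def using k Z
        by (intro Cm_commute) (auto simp: Pm_def intro!: mode_prod_commute Cc orth_proj_U_carrier)
      then show ?thesis using oproj_diff[OF C_k] k Z Qt by simp
    qed
    \<comment> \<open>T-HOSVD is compared with \<open>Q\<close> at \<open>Z\<close>, and then
      \<open>Cm k\<close> contracts. ST-HOSVD is compared with \<open>Q\<close> at
      \<open>Cm k Z\<close>; since \<open>Q\<close> commutes with \<open>Cm k\<close>, that residual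
      is again a contraction of the one at \<open>Z\<close>.\<close>
    from SVD show ?thesis
    proof
      assume "\<forall>k<length p. is_SVD (r ! k) (matricize p k Z) (U k)"
      then have "fnorm p (Z - Pm k Z) \<le> fnorm p (Z - Q Z)"
        unfolding Pm_def Q_def using k r by (intro is_SVD_mode_error[OF k Z _ C mr]) auto
      moreover have "fnorm p (Cm k (Z - Pm k Z)) \<le> fnorm p (Z - Pm k Z)"
        using k Z by (intro oproj_fnorm_le[OF C_k]) auto
      ultimately show ?thesis using QZ unfolding comm by linarith
    next
      assume "\<forall>k<length p. is_SVD (r ! k) (matricize p k (mode_prods p (\<lambda>l. orth_proj (U l)) k Z)) (U k)"
      then have "fnorm p (Cm k Z - Pm k (Cm k Z)) \<le> fnorm p (Cm k Z - Q (Cm k Z))"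
        unfolding Pm_def Q_def using k r CZ Z
        by (intro is_SVD_mode_error[OF k _ _ C mr]) (auto simp: Cm_def)
      also have "\<dots> \<le> fnorm p (Z - Q Z)"
        unfolding commQ using k Z Qt by (intro oproj_fnorm_le[OF C_k]) auto
      finally show ?thesis using QZ by linarith
    qed
  qed
  have "(fnorm p (Z - Z'))\<^sup>2 \<le> (\<Sum>l<length p. (fnorm p (Z - X))\<^sup>2)"
    unfolding Z'C Cm_error_square[OF order_refl Z] using err by (intro sum_mono power_mono) auto
  also have "\<dots> = (sqrt (real (length p)) * fnorm p (Z - X))\<^sup>2"
    by (simp add: power_mult_distrib)
  finally have "fnorm p (Z - Z') \<le> sqrt (real (length p)) * fnorm p (Z - X)"
    by (rule power2_le_imp_le) simp
  moreover have "fnorm p (Z' - X) \<le> fnorm p (Z - Z') + fnorm p (Z - X)"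
    using fnorm_triangle[of p "Z' - Z" "Z - X"] fnorm_minus_commute[of p Z Z'] by simp
  ultimately show "fnorm p (Z' - X) \<le> (sqrt (real (length p)) + 1) * fnorm p (Z - X)"
    by (simp add: algebra_simps)
qed

end

section \<open>The tangent projection\<close>

text \<open>No base point occurs: that the tangent projection is orthogonal and has values of Tucker
  rank at most \<open>2 * r\<close> depends on orthonormality alone. An iterate enters later as a
  tensor fixed by the projections.\<close>

locale tangent_projections = mode_projections p r U for p r :: "nat list" and U :: "nat \<Rightarrow> real mat" +
  fixes V :: "nat \<Rightarrow> real mat"
  assumes len_r: "length r = length p"
    and r_pos: "\<And>k. k < length p \<Longrightarrow> 0 < r ! k"
    and orthV: "\<And>k. k < length p \<Longrightarrow> V k \<in> orthonormal_mats (other_dim r k) (r ! k)"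
begin

sublocale R: tensor_format r
  using len_r r_pos by unfold_locales simp

definition Km :: "nat \<Rightarrow> real mat" where
  "Km k = kron_others (length p) U k"

definition Wm :: "nat \<Rightarrow> tensor \<Rightarrow> tensor" where
  "Wm k X = tensorize p k (matricize p k X * orth_proj (Km k * V k))"

definition Dm :: "nat \<Rightarrow> tensor \<Rightarrow> tensor" where
  "Dm k X = Wm k X - Pm k (Wm k X)"

definition Tm :: "tensor \<Rightarrow> tensor" where
  "Tm X = tangent_proj p U V X"

lemma orthK: "Km k \<in> orthonormal_mats (other_dim p k) (other_dim r k)"
  unfolding Km_def other_dim_def len_r using orthU by (rule kron_others_orthonormal)

lemma orthKV: "k < length p \<Longrightarrow> Km k * V k \<in> orthonormal_mats (other_dim p k) (r ! k)"
  by (rule orthonormal_mats_mult[OF orthK orthV])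

text \<open>The indices \<open>a\<close> and \<open>a'\<close> are arbitrary, since they affect only
  the entry at mode \<open>k\<close>, which the product leaves out.\<close>

lemma Km_index:
  assumes "b < other_dim p k" "c < other_dim r k"
  shows "Km k $$ (b, c) = (\<Prod>j\<in>{..<length p} - {k}. U j $$ (unfold_index p k a b ! j, unfold_index r k a' c ! j))"
proof -
  have "Km k $$ (b, c) = (\<Prod>j\<in>{..<length p} - {k}.
      U j $$ ((b div (\<Prod>l\<in>{..<j} - {k}. p ! l)) mod (p ! j), (c div (\<Prod>l\<in>{..<j} - {k}. r ! l)) mod (r ! j)))"
    unfolding Km_def using assms orthonormal_matsD(1)[OF orthU]
    by (intro kron_others_index(3)) (auto simp: other_dim_def len_r)
  then show ?thesis using len_r by (auto simp: unfold_index_nth intro!: prod.cong)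
qed

lemma orth_proj_KV_carrier: "k < length p \<Longrightarrow> orth_proj (Km k * V k) \<in> carrier_mat (other_dim p k) (other_dim p k)"
  using orth_proj_carrier[OF orthonormal_matsD(1)[OF orthKV]] .

lemma mult_KV_carrier:
  "k < length p \<Longrightarrow> matricize p k X * orth_proj (Km k * V k) \<in> carrier_mat (p ! k) (other_dim p k)"
  by (rule mult_carrier_mat[OF matricize_carrier orth_proj_KV_carrier])

lemma Wm_in_tensors [simp]: "k < length p \<Longrightarrow> Wm k X \<in> tensors p"
  unfolding Wm_def by (rule tensorize_in_tensors[OF _ mult_KV_carrier])

lemma matricize_Wm: "k < length p \<Longrightarrow> matricize p k (Wm k X) = matricize p k X * orth_proj (Km k * V k)"
  unfolding Wm_def by (rule matricize_tensorize[OF _ mult_KV_carrier])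

lemma oproj_Wm:
  assumes k: "k < length p"
  shows "oproj p (Wm k)"
proof (rule oproj_two_sided[OF k one_carrier_mat transpose_one left_mult_one_mat[OF one_carrier_mat]
      orth_proj_KV_carrier[OF k] orth_proj_sym[OF orthonormal_matsD(1)[OF orthKV[OF k]]]
      orth_proj_idem[OF orthKV[OF k]]])
  show "matricize p k (Wm k X) = 1\<^sub>m (p ! k) * matricize p k X * orth_proj (Km k * V k)" for X
    unfolding matricize_Wm[OF k] left_mult_one_mat[OF matricize_carrier] ..
qed (use k in simp)

lemma Pm_Wm_same:
  assumes k: "k < length p"
  shows "Pm k (Wm k X) = Wm k (Pm k X)"
  using k assoc_mult_mat[OF orth_proj_U_carrier[OF k] matricize_carrier orth_proj_KV_carrier[OF k]]
  by (intro matricize_inj[OF k]) (simp_all only: matricize_Pm matricize_Wm Pm_in_tensors Wm_in_tensors)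

text \<open>The rows of the matricization of \<open>Wm k X\<close> lie in the range of the Kronecker product, on
  which the mode projections other than the \<open>k\<close>-th act trivially.\<close>

lemma Pm_Wm_other:
  assumes k: "k < length p" and l: "l < length p" "l \<noteq> k"
  shows "Pm l (Wm k X) = Wm k X"
proof (rule tensors_eqI[OF Pm_in_tensors[OF l(1)] Wm_in_tensors[OF k]])
  let ?q = "other_dim r k"
  note KD = orthonormal_matsD[OF orthK[of k]] and VD = orthonormal_matsD[OF orthV[OF k]]
    and KV = orthonormal_matsD[OF orthKV[OF k]] and UD = orthonormal_matsD[OF orthU]
  \<comment> \<open>\<open>F\<close> gathers everything in front of the transposed Kronecker
    product, so that all dependence on the entries at other modes sits in the factors
    \<open>U j\<close>.\<close>
  define F where "F = matricize p k X * (Km k * V k) * (V k)\<^sup>T"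
  have M1: "matricize p k X * (Km k * V k) \<in> carrier_mat (p ! k) (r ! k)"
    by (rule mult_carrier_mat[OF matricize_carrier KV(1)])
  have F: "F \<in> carrier_mat (p ! k) ?q" unfolding F_def by (rule mult_carrier_mat[OF M1 VD(2)])
  have WF: "matricize p k (Wm k X) = F * (Km k)\<^sup>T"
  proof -
    have "orth_proj (Km k * V k) = (Km k * V k) * ((V k)\<^sup>T * (Km k)\<^sup>T)"
      unfolding orth_proj_def transpose_mult[OF KD(1) VD(1)] ..
    then show ?thesis
      unfolding matricize_Wm[OF k] F_def assoc_mult_mat[OF M1 VD(2) KD(2)]
      using assoc_mult_mat[OF matricize_carrier KV(1) mult_carrier_mat[OF VD(2) KD(2)]] by simp
  qed
  define w where "w c j = unfold_index r k 0 c ! j" for c j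
  have W_index: "Wm k X i = (\<Sum>c<?q. F $$ (i ! k, c) * (\<Prod>j\<in>{..<length p} - {k}. U j $$ (i ! j, w c j)))"
    if i: "i \<in> idx p" for i
  proof -
    obtain a b where ab: "a < p ! k" "b < other_dim p k" "i = unfold_index p k a b"
      using idx_unfoldE[OF k i] .
    have "Wm k X i = (F * (Km k)\<^sup>T) $$ (a, b)"
      unfolding WF[symmetric] using ab by (simp add: matricize_index)
    also have "\<dots> = (\<Sum>c<?q. F $$ (a, c) * Km k $$ (b, c))"
      using ab KD(1) by (subst mat_mult_index[OF F KD(2)]) auto
    also have "\<dots> = (\<Sum>c<?q. F $$ (i ! k, c) * (\<Prod>j\<in>{..<length p} - {k}. U j $$ (i ! j, w c j)))"
      using ab k unfolding w_def
      by (intro sum.cong refl) (simp add: Km_index[of b k _ a 0] unfold_index_nth)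
    finally show ?thesis .
  qed
  fix i assume i: "i \<in> idx p"
  have li: "l < length i" using idx_length[OF i] l by simp
  define G where "G c = (\<Prod>j\<in>{..<length p} - {k} - {l}. U j $$ (i ! j, w c j))" for c
  have split: "(\<Prod>j\<in>{..<length p} - {k}. U j $$ (i[l := x] ! j, w c j)) = U l $$ (x, w c l) * G c" for x c
  proof -
    have "(\<Prod>j\<in>{..<length p} - {k}. U j $$ (i[l := x] ! j, w c j))
        = U l $$ (i[l := x] ! l, w c l) * (\<Prod>j\<in>{..<length p} - {k} - {l}. U j $$ (i[l := x] ! j, w c j))"
      using l by (intro prod.remove) auto
    then show ?thesis using li by (simp add: G_def)
  qed
  have wl: "w c l < r ! l" for c
    using R.pos[of l] l len_r by (simp add: w_def unfold_index_nth)
  \<comment> \<open>Only the \<open>l\<close>-th factor depends on entry \<open>l\<close>, and the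
    projection fixes the columns of \<open>U l\<close>.\<close>
  have PU: "(\<Sum>x<p ! l. orth_proj (U l) $$ (i ! l, x) * U l $$ (x, w c l)) = U l $$ (i ! l, w c l)" for c
    using mat_mult_index[OF orth_proj_U_carrier[OF l(1)] UD(1)[OF l(1)] idx_nth[OF i l(1)] wl[of c]]
    unfolding orth_proj_fix[OF orthU[OF l(1)]] by simp
  have "Pm l (Wm k X) i = (\<Sum>x<p ! l. orth_proj (U l) $$ (i ! l, x) * Wm k X (i[l := x]))"
    unfolding Pm_def by (rule mode_prod_apply[OF orth_proj_U_carrier[OF l(1)] i])
  also have "\<dots> = (\<Sum>x<p ! l. \<Sum>c<?q. F $$ (i ! k, c) * G c * (orth_proj (U l) $$ (i ! l, x) * U l $$ (x, w c l)))"
    using i l by (intro sum.cong refl) (simp add: W_index idx_update split sum_distrib_left mult_ac)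
  also have "\<dots> = (\<Sum>c<?q. F $$ (i ! k, c) * G c * U l $$ (i ! l, w c l))"
    by (subst sum.swap) (simp only: sum_distrib_left[symmetric] PU)
  also have "\<dots> = Wm k X i"
    unfolding W_index[OF i] using split[of "i ! l"] by (intro sum.cong refl) (simp add: mult_ac)
  finally show "Pm l (Wm k X) i = Wm k X i" .
qed

section \<open>Orthogonal decomposition of the tangent projection\<close>

lemma Dm_in_tensors [simp]: "k < length p \<Longrightarrow> Dm k X \<in> tensors p"
  by (simp only: Dm_def tensors_diff Wm_in_tensors Pm_in_tensors)

lemma Pm_Dm_other:
  assumes "k < length p" "l < length p" "l \<noteq> k"
  shows "Pm l (Dm k X) = Dm k X"
  unfolding Dm_def oproj_diff[OF oproj_Pm[OF assms(2)] Wm_in_tensors[OF assms(1)] Pm_in_tensors[OF assms(1)]]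
    Pm_commute[OF assms(2,1)] Pm_Wm_other[OF assms] ..

lemma Pm_Dm_same:
  assumes k: "k < length p"
  shows "Pm k (Dm k X) = 0"
  unfolding Dm_def oproj_diff[OF oproj_Pm[OF k] Wm_in_tensors[OF k] Pm_in_tensors[OF k]]
    oproj_idem[OF oproj_Pm[OF k] Wm_in_tensors[OF k]] by (rule diff_self)

lemma Dm_eq_0:
  assumes k: "k < length p" and "Pm k X = X"
  shows "Dm k X = 0"
  unfolding Dm_def Pm_Wm_same[OF k] assms(2) by (rule diff_self)

lemma oproj_Dm:
  assumes k: "k < length p"
  shows "oproj p (Dm k)"
proof -
  have "Wm k X - Pm k (Wm k X) = Wm k (X - Pm k X)" if "X \<in> tensors p" for X
    unfolding oproj_diff[OF oproj_Wm[OF k] that Pm_in_tensors[OF k]] Pm_Wm_same[OF k] ..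
  with oproj_compose[of p "\<lambda>X. X - Pm k X" "Wm k", OF oproj_compl[OF oproj_Pm[OF k]] oproj_Wm[OF k]]
  have "oproj p (\<lambda>X. Wm k X - Pm k (Wm k X))" by blast
  then show ?thesis unfolding Dm_def[abs_def] .
qed

lemma Tm_eq: "Tm X = Cm (length p) X + (\<Sum>k<length p. Dm k X)"
proof -
  have "tensorize p k ((1\<^sub>m (p ! k) - orth_proj (U k)) * matricize p k X
      * orth_proj (kron_others (length p) U k * V k)) = Dm k X" if k: "k < length p" for k
  proof -
    let ?P = "orth_proj (U k)" and ?W = "orth_proj (Km k * V k)"
    note P = orth_proj_U_carrier[OF k] and W = orth_proj_KV_carrier[OF k]
    have IP: "1\<^sub>m (p ! k) - ?P \<in> carrier_mat (p ! k) (p ! k)" using P by (rule minus_carrier_mat)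
    have c: "(1\<^sub>m (p ! k) - ?P) * matricize p k X * ?W \<in> carrier_mat (p ! k) (other_dim p k)"
      by (rule mult_carrier_mat[OF mult_carrier_mat[OF IP matricize_carrier] W])
    have "matricize p k (tensorize p k ((1\<^sub>m (p ! k) - ?P) * matricize p k X * ?W))
        = (1\<^sub>m (p ! k) - ?P) * (matricize p k X * ?W)"
      unfolding matricize_tensorize[OF k c] by (rule assoc_mult_mat[OF IP matricize_carrier W])
    also have "\<dots> = matricize p k X * ?W - ?P * (matricize p k X * ?W)"
      using minus_mult_distrib_mat[OF one_carrier_mat P mult_KV_carrier[OF k]]
        left_mult_one_mat[OF mult_KV_carrier[OF k]] by simp
    also have "\<dots> = matricize p k (Dm k X)"
      unfolding Dm_def matricize_diff matricize_Pm[OF k] matricize_Wm[OF k] ..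
    finally show ?thesis unfolding Km_def[symmetric]
      by (rule matricize_inj[OF k tensorize_in_tensors[OF k c] Dm_in_tensors[OF k]])
  qed
  then show ?thesis unfolding Tm_def tangent_proj_def Cm_def[symmetric] by (intro arg_cong2[of _ _ _ _ "(+)"] refl sum.cong) simp_all
qed

lemma Cm_Dm:
  assumes k: "k < length p"
  shows "Cm (length p) (Dm k X) = 0"
proof -
  have "Cm (length p) (Dm k X) = Cm (length p) (Pm k (Dm k X))"
    by (rule Cm_Pm[symmetric]) (use k in simp_all)
  then show ?thesis unfolding Pm_Dm_same[OF k] oproj_zero[OF oproj_Cm[OF order_refl]] .
qed

lemma Tm_in_tensors [simp]: "X \<in> tensors p \<Longrightarrow> Tm X \<in> tensors p"
  unfolding Tm_eq by (intro tensors_add tensors_sum Cm_in_tensors) simp_all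

text \<open>\<open>Pm k\<close> fixes the core part and every \<open>Dm l X\<close> with
  \<open>l \<noteq> k\<close>, and annihilates \<open>Dm k X\<close>. This splitting yields both the
  idempotence of \<open>Tm\<close> and the rank of its values.\<close>

lemma Pm_Tm:
  assumes k: "k < length p" and X: "X \<in> tensors p"
  shows "Tm X = Pm k (Tm X) + Dm k X"
proof -
  have "Pm k (Tm X) = Pm k (Cm (length p) X) + (\<Sum>l<length p. Pm k (Dm l X))"
    unfolding Tm_eq
    using oproj_add[OF oproj_Pm[OF k] Cm_in_tensors[OF order_refl X] tensors_sum[of "{..<length p}" "\<lambda>l. Dm l X"]]
      oproj_sum[OF oproj_Pm[OF k], of "{..<length p}" "\<lambda>l. Dm l X"] by simp
  also have "Pm k (Cm (length p) X) = Cm (length p) X" by (rule Pm_Cm[OF order_refl k X])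
  also have "(\<Sum>l<length p. Pm k (Dm l X)) = (\<Sum>l\<in>{..<length p} - {k}. Dm l X)"
  proof -
    have "(\<Sum>l<length p. Pm k (Dm l X)) = Pm k (Dm k X) + (\<Sum>l\<in>{..<length p} - {k}. Pm k (Dm l X))"
      using k by (intro sum.remove) auto
    also have "\<dots> = (\<Sum>l\<in>{..<length p} - {k}. Pm k (Dm l X))"
      unfolding Pm_Dm_same[OF k] by (rule add_0)
    also have "\<dots> = (\<Sum>l\<in>{..<length p} - {k}. Dm l X)"
      using k Pm_Dm_other by (intro sum.cong) auto
    finally show ?thesis .
  qed
  finally have "Pm k (Tm X) + Dm k X = Cm (length p) X + (Dm k X + (\<Sum>l\<in>{..<length p} - {k}. Dm l X))"
    by (simp only: add_ac)
  also have "Dm k X + (\<Sum>l\<in>{..<length p} - {k}. Dm l X) = (\<Sum>l<length p. Dm l X)"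
    using k by (intro sum.remove[symmetric]) auto
  finally show ?thesis unfolding Tm_eq by (rule sym)
qed

text \<open>Each summand of \<open>Tm\<close>, applied to \<open>Tm X\<close>, returns its value at
  \<open>X\<close>: \<open>Cm\<close> annihilates every \<open>Dm k X\<close>, and
  \<open>Dm k\<close> annihilates the range of \<open>Pm k\<close>. Self-adjointness is inherited
  from the summands.\<close>

lemma oproj_Tm: "oproj p Tm"
  unfolding oproj_def
proof (intro conjI ballI)
  fix X assume X: "X \<in> tensors p"
  show T: "Tm X \<in> tensors p" using X by simp
  have "Dm k (Tm X) = Dm k X" if k: "k < length p" for k
  proof -
    note D = oproj_Dm[OF k]
    have "Pm k (Pm k (Tm X)) = Pm k (Tm X)" by (rule oproj_idem[OF oproj_Pm[OF k] T])
    then have "Dm k (Pm k (Tm X)) = 0" by (rule Dm_eq_0[OF k])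
    then show ?thesis
      using oproj_add[OF D Pm_in_tensors[OF k, of "Tm X"] Dm_in_tensors[OF k, of X]]
        oproj_idem[OF D X] Pm_Tm[OF k X] by (metis add_0)
  qed
  moreover have "Cm (length p) (Tm X) = Cm (length p) X"
  proof -
    note C = oproj_Cm[OF order_refl]
    have "Cm (length p) (Tm X) = Cm (length p) (Cm (length p) X) + (\<Sum>k<length p. Cm (length p) (Dm k X))"
      unfolding Tm_eq
      using oproj_add[OF C Cm_in_tensors[OF order_refl X] tensors_sum[of "{..<length p}" "\<lambda>l. Dm l X"]]
        oproj_sum[OF C, of "{..<length p}" "\<lambda>l. Dm l X"] by simp
    also have "(\<Sum>k<length p. Cm (length p) (Dm k X)) = 0"
      by (rule sum.neutral) (simp add: Cm_Dm)
    finally show ?thesis unfolding oproj_idem[OF C X] by (simp only: add_0_right)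
  qed
  ultimately show "Tm (Tm X) = Tm X"
    unfolding Tm_eq[of "Tm X"] unfolding Tm_eq[of X] by (intro arg_cong2[of _ _ _ _ "(+)"] sum.cong) simp_all
  fix Y assume Y: "Y \<in> tensors p"
  have "tinner p (Dm k X) Y = tinner p X (Dm k Y)" if "k < length p" for k
    by (rule oproj_adj[OF oproj_Dm[OF that] X Y])
  then show "tinner p (Tm X) Y = tinner p X (Tm Y)"
    unfolding Tm_eq tinner_add_left tinner_add_right tinner_sum_left tinner_sum_right
      oproj_adj[OF oproj_Cm[OF order_refl] X Y] by simp
qed

lemma Tm_fixed:
  assumes "X \<in> tensors p" "\<And>k. k < length p \<Longrightarrow> Pm k X = X"
  shows "Tm X = X"
proof -
  have "(\<Sum>k<length p. Dm k X) = 0" using Dm_eq_0 assms(2) by (intro sum.neutral) simp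
  moreover have "Cm (length p) X = X" using assms by (intro Cm_fixed) simp_all
  ultimately show ?thesis unfolding Tm_eq by (simp only: add_0_right)
qed

text \<open>In mode \<open>k\<close> a tangent vector is a sum of two matrices, one factoring
  through the \<open>r ! k\<close> columns of \<open>U k\<close>, the other through the
  \<open>r ! k\<close> rows of the transposed \<open>Km k * V k\<close>.\<close>

lemma rank_matricize_Tm:
  assumes k: "k < length p" and X: "X \<in> tensors p"
  shows "vec_space.rank (p ! k) (matricize p k (Tm X)) \<le> 2 * r ! k"
proof -
  let ?M = "matricize p k X" and ?T = "matricize p k (Tm X)" and ?W = "Km k * V k"
  note UD = orthonormal_matsD[OF orthU[OF k]] and WD = orthonormal_matsD[OF orthKV[OF k]]
  have 1: "matricize p k (Pm k (Tm X)) = U k * ((U k)\<^sup>T * ?T)"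
    unfolding matricize_Pm[OF k] orth_proj_def by (rule assoc_mult_mat[OF UD(1,2) matricize_carrier])
  have eq: "Dm k X = Wm k (X - Pm k X)"
    unfolding Dm_def oproj_diff[OF oproj_Wm[OF k] X Pm_in_tensors[OF k]] Pm_Wm_same[OF k] ..
  have 2: "matricize p k (Dm k X) = (matricize p k (X - Pm k X) * ?W) * ?W\<^sup>T"
    unfolding eq matricize_Wm[OF k] orth_proj_def
    by (rule assoc_mult_mat[OF matricize_carrier WD(1,2), symmetric])
  have "?T = matricize p k (Pm k (Tm X)) + matricize p k (Dm k X)"
    unfolding matricize_add[symmetric] Pm_Tm[OF k X, symmetric] ..
  then have "vec_space.rank (p ! k) ?T
      \<le> vec_space.rank (p ! k) (matricize p k (Pm k (Tm X))) + vec_space.rank (p ! k) (matricize p k (Dm k X))"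
    using vec_space.rank_subadditive[OF matricize_carrier[of k "Pm k (Tm X)"] matricize_carrier[of k "Dm k X"]] by simp
  also have "\<dots> \<le> r ! k + r ! k"
    unfolding 1 2
    by (intro add_mono rank_mult_le_inner[OF UD(1) mult_carrier_mat[OF UD(2) matricize_carrier]]
        rank_mult_le_inner[OF mult_carrier_mat[OF matricize_carrier WD(1)] WD(2)])
  finally show ?thesis by simp
qed

text \<open>The singular values are those of the target \<open>Y\<close>; \<open>X\<close> enters
  only as a common fixed point, so an iterate of small or degenerate rank does no harm.\<close>

lemma Tm_residual_le:
  assumes X: "X \<in> tensors p" "\<And>k. k < length p \<Longrightarrow> Pm k X = X" "\<And>k. k < length p \<Longrightarrow> Wm k X = X"
    and Y: "Y \<in> tensors p" and lam: "0 < lam"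
      "\<And>k. k < length p \<Longrightarrow> lam \<le> singular_value (vec_space.rank (p ! k) (matricize p k Y)) (matricize p k Y)"
  shows "fnorm p (Y - Tm Y) \<le> real (length p) * (fnorm p (X - Y))\<^sup>2 / lam"
proof -
  define B where "B k = (Y - Wm k Y) - Pm k (Y - Wm k Y)" for k
  have Bt: "B k \<in> tensors p" if "k < length p" for k
    unfolding B_def using that Y by (intro tensors_diff Pm_in_tensors Wm_in_tensors)
  \<comment> \<open>\<open>Cm k\<close> uses only modes below \<open>k\<close>, and these fix
    \<open>Wm k Y\<close>. So \<open>Dm k Y\<close> can be drawn into \<open>Cm k\<close>, and the
    telescoping increment becomes a contraction of the doubly projected \<open>B k\<close>.\<close>
  have summand: "(Cm k Y - Pm k (Cm k Y)) - Dm k Y = Cm k (B k)" if k: "k < length p" for k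
  proof -
    have kl: "k \<le> length p" using k by simp
    note C = oproj_Cm[OF kl]
    have CW: "Cm k (Wm k Y) = Wm k Y"
    proof -
      have "j \<le> k \<Longrightarrow> Cm j (Wm k Y) = Wm k Y" for j
        by (induction j) (use k Pm_Wm_other[OF k] in \<open>auto simp: Cm_0 Cm_Suc\<close>)
      then show ?thesis by simp
    qed
    have t: "Y - Wm k Y \<in> tensors p" using Y k by (intro tensors_diff Wm_in_tensors)
    have "Cm k (B k) = Cm k (Y - Wm k Y) - Pm k (Cm k (Y - Wm k Y))"
      unfolding B_def oproj_diff[OF C t Pm_in_tensors[OF k]] Pm_Cm_commute[OF k kl t] ..
    also have "Cm k (Y - Wm k Y) = Cm k Y - Wm k Y"
      unfolding oproj_diff[OF C Y Wm_in_tensors[OF k]] CW ..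
    also have "Pm k (Cm k Y - Wm k Y) = Pm k (Cm k Y) - Pm k (Wm k Y)"
      by (rule oproj_diff[OF oproj_Pm[OF k] Cm_in_tensors[OF kl Y] Wm_in_tensors[OF k]])
    finally show ?thesis unfolding Dm_def by (simp only: algebra_simps)
  qed
  have bound: "fnorm p (B k) \<le> (fnorm p (X - Y))\<^sup>2 / lam" if k: "k < length p" for k
  proof -
    let ?M = "matricize p k Y" and ?I = "1\<^sub>m (p ! k)" and ?J = "1\<^sub>m (other_dim p k)"
    let ?P = "orth_proj (U k)" and ?W = "orth_proj (Km k * V k)"
    let ?s = "singular_value (vec_space.rank (p ! k) ?M) ?M"
    note P = orth_proj_U_carrier[OF k] and W = orth_proj_KV_carrier[OF k]
    have IP: "?I - ?P \<in> carrier_mat (p ! k) (p ! k)" using P by (rule minus_carrier_mat)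
    have JW: "?J - ?W \<in> carrier_mat (other_dim p k) (other_dim p k)" using W by (rule minus_carrier_mat)
    have left: "(?I - ?P) * matricize p k Z = matricize p k (Z - Pm k Z)" for Z
      unfolding minus_mult_distrib_mat[OF one_carrier_mat P matricize_carrier] matricize_diff matricize_Pm[OF k]
        left_mult_one_mat[OF matricize_carrier] ..
    have right: "?M * (?J - ?W) = matricize p k (Y - Wm k Y)"
      unfolding mult_minus_distrib_mat[OF matricize_carrier one_carrier_mat W] matricize_diff matricize_Wm[OF k]
        right_mult_one_mat[OF matricize_carrier] ..
    have both: "(?I - ?P) * ?M * (?J - ?W) = matricize p k (B k)"
      unfolding assoc_mult_mat[OF IP matricize_carrier JW] right unfolding left B_def ..
    have "?s\<^sup>2 * frob2 ((?I - ?P) * ?M * (?J - ?W)) \<le> frob2 ((?I - ?P) * ?M) * frob2 (?M * (?J - ?W))"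
      by (rule singular_value_sandwich[OF matricize_carrier IP JW])
    then have "?s\<^sup>2 * (fnorm p (B k))\<^sup>2 \<le> (fnorm p (Y - Pm k Y))\<^sup>2 * (fnorm p (Y - Wm k Y))\<^sup>2"
      unfolding both unfolding left right fnorm_square_matricize[OF k] .
    moreover have "fnorm p (Y - Pm k Y) \<le> fnorm p (X - Y)"
    proof -
      have "(Y - X) - Pm k (Y - X) = Y - Pm k Y"
        unfolding oproj_diff[OF oproj_Pm[OF k] Y X(1)] X(2)[OF k] by simp
      then show ?thesis
        using oproj_fnorm_le[OF oproj_compl[OF oproj_Pm[OF k]] tensors_diff[OF Y X(1)]]
        by (simp only: fnorm_minus_commute[of p X])
    qed
    moreover have "fnorm p (Y - Wm k Y) \<le> fnorm p (X - Y)"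
    proof -
      have "(Y - X) - Wm k (Y - X) = Y - Wm k Y"
        unfolding oproj_diff[OF oproj_Wm[OF k] Y X(1)] X(3)[OF k] by simp
      then show ?thesis
        using oproj_fnorm_le[OF oproj_compl[OF oproj_Wm[OF k]] tensors_diff[OF Y X(1)]]
        by (simp only: fnorm_minus_commute[of p X])
    qed
    ultimately have "?s\<^sup>2 * (fnorm p (B k))\<^sup>2 \<le> (fnorm p (X - Y))\<^sup>2 * (fnorm p (X - Y))\<^sup>2"
      by (meson fnorm_nonneg mult_mono order_trans power_mono zero_le_power2)
    moreover have "lam\<^sup>2 \<le> ?s\<^sup>2" using lam(1) lam(2)[OF k] by (intro power_mono) auto
    ultimately have "lam\<^sup>2 * (fnorm p (B k))\<^sup>2 \<le> (fnorm p (X - Y))\<^sup>2 * (fnorm p (X - Y))\<^sup>2"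
      by (meson mult_right_mono order_trans zero_le_power2)
    then have "(lam * fnorm p (B k))\<^sup>2 \<le> ((fnorm p (X - Y))\<^sup>2)\<^sup>2"
      by (simp only: power_mult_distrib power2_eq_square[of "(fnorm p (X - Y))\<^sup>2"])
    then have "lam * fnorm p (B k) \<le> (fnorm p (X - Y))\<^sup>2" by (rule power2_le_imp_le) simp
    then show ?thesis using lam(1) by (simp add: field_simps)
  qed
  have "Y - Tm Y = (\<Sum>k<length p. Cm k (B k))"
  proof -
    have "Y - Tm Y = (Y - Cm (length p) Y) - (\<Sum>k<length p. Dm k Y)"
      unfolding Tm_eq by (simp only: diff_diff_eq)
    also have "\<dots> = (\<Sum>k<length p. (Cm k Y - Pm k (Cm k Y)) - Dm k Y)"
      unfolding Cm_telescope[OF order_refl] by (simp only: sum_subtractf)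
    also have "\<dots> = (\<Sum>k<length p. Cm k (B k))" using summand by (intro sum.cong) simp_all
    finally show ?thesis .
  qed
  then have "fnorm p (Y - Tm Y) \<le> (\<Sum>k<length p. fnorm p (Cm k (B k)))"
    using fnorm_sum_le[of p "\<lambda>k. Cm k (B k)" "{..<length p}"] by simp
  also have "\<dots> \<le> (\<Sum>k<length p. (fnorm p (X - Y))\<^sup>2 / lam)"
  proof (rule sum_mono)
    fix k assume "k \<in> {..<length p}"
    then have k: "k < length p" by simp
    have "fnorm p (Cm k (B k)) \<le> fnorm p (B k)"
      using oproj_fnorm_le[OF oproj_Cm Bt[OF k], of k] k by simp
    then show "fnorm p (Cm k (B k)) \<le> (fnorm p (X - Y))\<^sup>2 / lam" using bound[OF k] by linarith
  qed
  finally show ?thesis by simp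
qed

text \<open>Grouping the sum over the core by its mode-\<open>k\<close> unfolding splits each
  product of factors into the mode-\<open>k\<close> factor and an entry of the Kronecker
  product.\<close>

lemma matricize_tucker:
  assumes S: "S \<in> tensors r" and k: "k < length p"
  shows "matricize p k (mode_prods r U (length p) S) = U k * (matricize r k S * (Km k)\<^sup>T)"
proof (rule eq_matI)
  note KD = orthonormal_matsD[OF orthK[of k]] and UD = orthonormal_matsD[OF orthU]
  let ?q = "other_dim r k" and ?M = "matricize r k S * (Km k)\<^sup>T"
  have M: "?M \<in> carrier_mat (r ! k) (other_dim p k)" by (rule mult_carrier_mat[OF R.matricize_carrier KD(2)])
  fix a b assume "a < dim_row (U k * ?M)" "b < dim_col (U k * ?M)"
  then have ab: "a < p ! k" "b < other_dim p k" using UD(1)[OF k] M by auto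
  define i where "i = unfold_index p k a b"
  have i: "i \<in> idx p" unfolding i_def by (rule unfold_index_in_idx[OF ab(1)])
  have "mode_prods r U (length p) S i = (\<Sum>c\<in>idx r. (\<Prod>j<length p. U j $$ (i ! j, c ! j)) * S c)"
    using mode_prods_index[OF len_r order_refl UD(1), of i S] i idx_length[OF i] by (simp add: len_r)
  also have "\<dots> = (\<Sum>c<r ! k. \<Sum>d<?q. (\<Prod>j<length p. U j $$ (i ! j, unfold_index r k c d ! j)) * S (unfold_index r k c d))"
    by (rule R.sum_idx_unfold) (simp add: k len_r)
  also have "\<dots> = (\<Sum>c<r ! k. \<Sum>d<?q. U k $$ (a, c) * (S (unfold_index r k c d) * Km k $$ (b, d)))"
  proof (intro sum.cong refl)
    fix c d assume cd: "c \<in> {..<r ! k}" "d \<in> {..<?q}"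
    have "(\<Prod>j<length p. U j $$ (i ! j, unfold_index r k c d ! j))
        = U k $$ (i ! k, unfold_index r k c d ! k) * (\<Prod>j\<in>{..<length p} - {k}. U j $$ (i ! j, unfold_index r k c d ! j))"
      using k by (intro prod.remove) auto
    also have "\<dots> = U k $$ (a, c) * Km k $$ (b, d)"
      using ab cd k len_r unfolding i_def by (simp add: Km_index[of b k d a c] unfold_index_nth)
    finally show "(\<Prod>j<length p. U j $$ (i ! j, unfold_index r k c d ! j)) * S (unfold_index r k c d)
        = U k $$ (a, c) * (S (unfold_index r k c d) * Km k $$ (b, d))" by simp
  qed
  also have "\<dots> = (\<Sum>c<r ! k. U k $$ (a, c) * ?M $$ (c, b))"
  proof (rule sum.cong[OF refl])
    fix c assume c: "c \<in> {..<r ! k}"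
    have "?M $$ (c, b) = (\<Sum>d<?q. S (unfold_index r k c d) * Km k $$ (b, d))"
      using c ab KD(1) by (subst mat_mult_index[OF R.matricize_carrier KD(2)]) (auto simp: R.matricize_index)
    then show "(\<Sum>d<?q. U k $$ (a, c) * (S (unfold_index r k c d) * Km k $$ (b, d))) = U k $$ (a, c) * ?M $$ (c, b)"
      by (simp only: sum_distrib_left)
  qed
  also have "\<dots> = (U k * ?M) $$ (a, b)" by (rule mat_mult_index[OF UD(1)[OF k] M ab, symmetric])
  finally show "matricize p k (mode_prods r U (length p) S) $$ (a, b) = (U k * ?M) $$ (a, b)"
    unfolding matricize_index[OF ab] i_def .
qed (use orthonormal_matsD(1)[OF orthU[OF k]] orthonormal_matsD(1)[OF orthK[of k]] in auto)

text \<open>The matricized \<open>X\<close> starts with \<open>U k\<close>, which the mode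
  projection fixes. On the right, orthonormality of \<open>Km k\<close> moves the projector through
  the Kronecker product, where it becomes \<open>orth_proj (V k)\<close> and is absorbed by the rows
  of the core.\<close>

lemma tucker_fixed:
  assumes S: "S \<in> tensors r" and X: "X = mode_prods r U (length p) S" "X \<in> tensors p" and k: "k < length p"
    and sub: "vec_space.row_space (other_dim r k) (matricize r k S) \<subseteq> vec_space.col_space (other_dim r k) (V k)"
  shows "Pm k X = X" and "Wm k X = X"
proof -
  note KD = orthonormal_matsD[OF orthK[of k]] and UD = orthonormal_matsD[OF orthU[OF k]]
    and VD = orthonormal_matsD[OF orthV[OF k]] and KV = orthonormal_matsD[OF orthKV[OF k]]
  let ?S = "matricize r k S"
  have M: "?S * (Km k)\<^sup>T \<in> carrier_mat (r ! k) (other_dim p k)" by (rule mult_carrier_mat[OF R.matricize_carrier KD(2)])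
  have MX: "matricize p k X = U k * (?S * (Km k)\<^sup>T)" unfolding X(1) by (rule matricize_tucker[OF S k])
  have "matricize p k (Pm k X) = matricize p k X"
    unfolding matricize_Pm[OF k] MX
    using assoc_mult_mat[OF orth_proj_U_carrier[OF k] UD(1) M] orth_proj_fix[OF orthU[OF k]] by simp
  then show "Pm k X = X" by (rule matricize_inj[OF k Pm_in_tensors[OF k] X(2)])
  have SV: "?S * orth_proj (V k) = ?S"
    by (rule row_space_mult_orth_proj[OF R.matricize_carrier orthV[OF k] sub])
  have OV: "orth_proj (V k) \<in> carrier_mat (other_dim r k) (other_dim r k)" by (rule orth_proj_carrier[OF VD(1)])
  have KW: "(Km k)\<^sup>T * orth_proj (Km k * V k) = orth_proj (V k) * (Km k)\<^sup>T"
  proof -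
    have "(Km k)\<^sup>T * orth_proj (Km k * V k) = (Km k)\<^sup>T * (Km k * V k) * ((V k)\<^sup>T * (Km k)\<^sup>T)"
      unfolding orth_proj_def transpose_mult[OF KD(1) VD(1)]
      by (rule assoc_mult_mat[OF KD(2) KV(1) mult_carrier_mat[OF VD(2) KD(2)], symmetric])
    also have "(Km k)\<^sup>T * (Km k * V k) = V k"
      using assoc_mult_mat[OF KD(2,1) VD(1)] KD(3) VD(1) by simp
    also have "V k * ((V k)\<^sup>T * (Km k)\<^sup>T) = orth_proj (V k) * (Km k)\<^sup>T"
      unfolding orth_proj_def by (rule assoc_mult_mat[OF VD(1,2) KD(2), symmetric])
    finally show ?thesis .
  qed
  have "?S * (Km k)\<^sup>T * orth_proj (Km k * V k) = ?S * (Km k)\<^sup>T"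
    unfolding assoc_mult_mat[OF R.matricize_carrier KD(2) orth_proj_KV_carrier[OF k]] KW
      assoc_mult_mat[OF R.matricize_carrier OV KD(2), symmetric] SV ..
  then have "matricize p k (Wm k X) = matricize p k X"
    unfolding matricize_Wm[OF k] MX assoc_mult_mat[OF UD(1) M orth_proj_KV_carrier[OF k]] by simp
  then show "Wm k X = X" by (rule matricize_inj[OF k Wm_in_tensors[OF k] X(2)])
qed

end

section \<open>Linear maps, adjoints and restricted isometry\<close>

definition tlinear :: "(tensor \<Rightarrow> tensor) \<Rightarrow> bool" where
  "tlinear F \<longleftrightarrow> (\<forall>X Y. F (X + Y) = F X + F Y) \<and> (\<forall>c X. F (tscale c X) = tscale c (F X))"

lemma tlinear_add: "tlinear F \<Longrightarrow> F (X + Y) = F X + F Y"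
  and tlinear_tscale: "tlinear F \<Longrightarrow> F (tscale c X) = tscale c (F X)"
  by (auto simp: tlinear_def)

lemma tscale_zero: "tscale 0 X = 0" and tscale_zero_right: "tscale c 0 = 0"
  and tscale_one: "tscale 1 X = X" and tscale_tscale: "tscale a (tscale b X) = tscale (a * b) X"
  and tscale_minus_one: "X + tscale (-1) Y = X - Y"
  by (auto simp: tscale_def fun_eq_iff algebra_simps)

lemma tlinear_zero: "tlinear F \<Longrightarrow> F 0 = 0"
  using tlinear_tscale[of F 0 0] by (simp only: tscale_zero)

lemma tlinear_diff: "tlinear F \<Longrightarrow> F (X - Y) = F X - F Y"
  by (simp only: tscale_minus_one[symmetric] tlinear_add tlinear_tscale)

lemma tlinear_sum:
  assumes "tlinear F"
  shows "F (\<Sum>k\<in>K. G k) = (\<Sum>k\<in>K. F (G k))"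
  by (induction K rule: infinite_finite_induct)
    (simp_all only: sum.infinite sum.empty sum.insert tlinear_zero[OF assms] tlinear_add[OF assms] not_False_eq_True)

section \<open>Adjoints and boundedness through the standard basis\<close>

definition tbasis :: "nat list \<Rightarrow> tensor" where
  "tbasis j = (\<lambda>i. if i = j then 1 else 0)"

lemma tbasis_expand:
  assumes "X \<in> tensors p"
  shows "X = (\<Sum>j\<in>idx p. tscale (X j) (tbasis j))"
proof
  fix i
  have "(\<Sum>j\<in>idx p. tscale (X j) (tbasis j)) i = (\<Sum>j\<in>idx p. if j = i then X i else 0)"
    unfolding sum_tensor_apply by (rule sum.cong) (auto simp: tscale_def tbasis_def)
  also have "\<dots> = X i" using assms by (auto simp: tensors_def)
  finally show "X i = (\<Sum>j\<in>idx p. tscale (X j) (tbasis j)) i" by simp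
qed

lemma tlinear_expand:
  assumes "tlinear F" "X \<in> tensors p"
  shows "F X = (\<Sum>j\<in>idx p. tscale (X j) (F (tbasis j)))"
  using arg_cong[OF tbasis_expand[OF assms(2)], of F]
  by (simp only: tlinear_sum[OF assms(1)] tlinear_tscale[OF assms(1)])

text \<open>The adjoint is given by a definite description, so a witness is required: its entries
  pair \<open>Y\<close> with the images of the basis tensors. Nondegeneracy of the inner product
  gives uniqueness.\<close>

lemma tadjoint:
  assumes F: "tlinear F"
  shows "tadjoint p q F Y \<in> tensors p"
    and "X \<in> tensors p \<Longrightarrow> tinner q (F X) Y = tinner p X (tadjoint p q F Y)"
proof -
  define Z where "Z j = (if j \<in> idx p then tinner q (F (tbasis j)) Y else 0)" for j
  have Z: "Z \<in> tensors p" by (simp add: Z_def tensors_def)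
  have adj: "tinner q (F X) Y = tinner p X Z" if "X \<in> tensors p" for X
    unfolding tlinear_expand[OF F that] tinner_sum_left tinner_tscale_left tinner_def[of p]
    by (rule sum.cong) (simp_all add: Z_def)
  have "tadjoint p q F Y = Z" unfolding tadjoint_def
  proof (rule the_equality)
    fix Z' assume Z': "Z' \<in> tensors p \<and> (\<forall>X\<in>tensors p. tinner q (F X) Y = tinner p X Z')"
    show "Z' = Z"
    proof (rule tinner_ext[OF _ Z])
      fix X assume "X \<in> tensors p"
      then show "tinner p Z' X = tinner p Z X"
        using Z' adj[of X] tinner_commute[of p X] by metis
    qed (use Z' in simp)
  qed (use Z adj in simp)
  then show "tadjoint p q F Y \<in> tensors p"
    and "X \<in> tensors p \<Longrightarrow> tinner q (F X) Y = tinner p X (tadjoint p q F Y)" using Z adj by simp_all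
qed

lemma tadjoint_diff:
  assumes F: "tlinear F"
  shows "tadjoint p q F (Y - Y') = tadjoint p q F Y - tadjoint p q F Y'"
proof (rule tinner_ext[OF tadjoint(1)[OF F] tensors_diff[OF tadjoint(1)[OF F] tadjoint(1)[OF F]]])
  fix X assume X: "X \<in> tensors p"
  have "tinner p X (tadjoint p q F (Y - Y')) = tinner p X (tadjoint p q F Y - tadjoint p q F Y')"
    by (simp only: tadjoint(2)[OF F X, symmetric] tinner_diff_right)
  then show "tinner p (tadjoint p q F (Y - Y')) X = tinner p (tadjoint p q F Y - tadjoint p q F Y') X"
    by (simp only: tinner_commute[of p _ X])
qed

text \<open>This guarantees that some constant satisfies the upper isometry inequality at
  all.\<close>

lemma tlinear_bounded:
  assumes F: "tlinear F"
  obtains c where "0 \<le> c" "\<And>X. X \<in> tensors p \<Longrightarrow> fnorm q (F X) \<le> c * fnorm p X"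
proof
  let ?c = "\<Sum>j\<in>idx p. fnorm q (F (tbasis j))"
  show "0 \<le> ?c" by (simp add: sum_nonneg)
  fix X assume X: "X \<in> tensors p"
  have "fnorm q (F X) \<le> (\<Sum>j\<in>idx p. \<bar>X j\<bar> * fnorm q (F (tbasis j)))"
    unfolding tlinear_expand[OF F X] fnorm_tscale[symmetric] by (rule fnorm_sum_le)
  also have "\<dots> \<le> (\<Sum>j\<in>idx p. fnorm p X * fnorm q (F (tbasis j)))"
  proof (intro sum_mono mult_right_mono)
    fix j assume "j \<in> idx p"
    then have "\<bar>X j\<bar> \<le> L2_set (\<lambda>j. \<bar>X j\<bar>) (idx p)" by (rule member_le_L2_set[OF finite_idx])
    then show "\<bar>X j\<bar> \<le> fnorm p X" by (simp add: L2_set_def fnorm_def)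
  qed simp
  finally show "fnorm q (F X) \<le> ?c * fnorm p X" by (simp add: sum_distrib_left mult.commute)
qed

text \<open>Stated for a single tensor, so that the class on which it is required can vary: tensors
  of bounded rank, tangent vectors, or tangent vectors plus multiples of the target.\<close>

definition rip :: "nat list \<Rightarrow> nat list \<Rightarrow> (tensor \<Rightarrow> tensor) \<Rightarrow> real \<Rightarrow> tensor \<Rightarrow> bool" where
  "rip p q F R Z \<longleftrightarrow> (1 - R) * (fnorm p Z)\<^sup>2 \<le> (fnorm q (F Z))\<^sup>2 \<and> (fnorm q (F Z))\<^sup>2 \<le> (1 + R) * (fnorm p Z)\<^sup>2"

text \<open>Restricted isometry controls squared norms only; polarization transfers it to inner
  products, provided it holds on the whole span of \<open>u\<close> and \<open>v\<close>.\<close>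

lemma rip_polarized:
  assumes F: "tlinear F" and u: "u \<in> tensors p" and v: "v \<in> tensors p"
    and rip: "\<And>a b. rip p q F R (tscale a u + tscale b v)"
  shows "\<bar>tinner q (F u) (F v) - tinner p u v\<bar> \<le> R * fnorm p u * fnorm p v"
proof (cases "fnorm p u = 0 \<or> fnorm p v = 0")
  case True
  then have "u = 0 \<or> v = 0" using fnorm_eq_0 u v by blast
  then show ?thesis by (auto simp: tlinear_zero[OF F] tinner_simps)
next
  case False
  define x y where "x = fnorm p u" and "y = fnorm p v"
  have xy: "0 < x * y" using False fnorm_nonneg[of p u] fnorm_nonneg[of p v]
    by (simp add: x_def y_def less_le)
  define I J where "I = tinner p u v" and "J = tinner q (F u) (F v)"
  define a b where "a = tinner q (F u) (F u)" and "b = tinner q (F v) (F v)"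
  have P: "(fnorm p (tscale s u + tscale t v))\<^sup>2 = s\<^sup>2 * x\<^sup>2 + 2 * s * t * I + t\<^sup>2 * y\<^sup>2" for s t
    unfolding fnorm_square x_def y_def I_def tinner_add_left tinner_add_right tinner_tscale_left tinner_tscale_right
      tinner_commute[of p v u] by (simp add: power2_eq_square algebra_simps)
  have Q: "(fnorm q (F (tscale s u + tscale t v)))\<^sup>2 = s\<^sup>2 * a + 2 * s * t * J + t\<^sup>2 * b" for s t
    unfolding fnorm_square a_def b_def J_def tlinear_add[OF F] tlinear_tscale[OF F]
      tinner_add_left tinner_add_right tinner_tscale_left tinner_tscale_right
      tinner_commute[of q "F v" "F u"] by (simp add: power2_eq_square algebra_simps)
  \<comment> \<open>The weights \<open>y\<close> and \<open>x\<close> or \<open>-x\<close> give both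
    terms the norm \<open>x * y\<close> without dividing. The upper inequality for one sign minus
    the lower one for the other leaves \<open>4 * x * y * (J - I)\<close> on the left, up to sign,
    and \<open>4 * R * (x * y)\<^sup>2\<close> on the right.\<close>
  have 1: "(1 - R) * (2 * (x * y)\<^sup>2 + 2 * (x * y) * I) \<le> y\<^sup>2 * a + 2 * (x * y) * J + x\<^sup>2 * b"
    "y\<^sup>2 * a + 2 * (x * y) * J + x\<^sup>2 * b \<le> (1 + R) * (2 * (x * y)\<^sup>2 + 2 * (x * y) * I)"
    using rip[of y x] unfolding rip_def P Q by (simp_all add: power_mult_distrib mult_ac)
  have 2: "(1 - R) * (2 * (x * y)\<^sup>2 - 2 * (x * y) * I) \<le> y\<^sup>2 * a - 2 * (x * y) * J + x\<^sup>2 * b"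
    "y\<^sup>2 * a - 2 * (x * y) * J + x\<^sup>2 * b \<le> (1 + R) * (2 * (x * y)\<^sup>2 - 2 * (x * y) * I)"
    using rip[of y "-x"] unfolding rip_def P Q by (simp_all add: power_mult_distrib mult_ac)
  have "(x * y) * (J - I) \<le> (x * y) * (R * (x * y))" "(x * y) * (I - J) \<le> (x * y) * (R * (x * y))"
    using 1 2 by (simp_all add: algebra_simps power2_eq_square)
  then have "J - I \<le> R * (x * y)" "I - J \<le> R * (x * y)"
    using xy by (simp_all only: mult_le_cancel_left_pos)
  then show ?thesis by (simp add: I_def J_def x_def y_def abs_le_iff mult.assoc)
qed

text \<open>The tangent space appears only through an orthogonal projector \<open>T\<close> that
  fixes \<open>X\<close>. The error after the step splits into a tangent part \<open>a\<close>, a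
  normal part \<open>v\<close> with its leakage \<open>b\<close> into the gradient, and the noise
  \<open>c\<close>.\<close>

lemma projected_gradient_step:
  fixes T F :: "tensor \<Rightarrow> tensor"
  assumes T: "oproj p T" and F: "tlinear F" and X: "X \<in> tensors p" "T X = X" and Y: "Y \<in> tensors p"
    and R: "0 < R2" "R2 < 1"
    and rip2: "\<And>W. W \<in> tensors p \<Longrightarrow> rip p q F R2 (T W)"
    and rip3: "\<And>W b. W \<in> tensors p \<Longrightarrow> rip p q F R3 (T W + tscale b Y)"
    and R3: "0 \<le> R3"
    and noise: "fnorm p (T (tadjoint p q F E)) \<le> \<xi>"
    and G: "G = T (tadjoint p q F (F X - (F Y + E)))"
    and Xh: "Xh = (if G = 0 then X else X - tscale ((fnorm p G)\<^sup>2 / (fnorm q (F G))\<^sup>2) G)"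
  shows "Xh \<in> tensors p"
    and "fnorm p (Xh - Y) \<le> 2 * R2 / (1 - R2) * fnorm p (X - Y)
      + (1 + R3 - R2) / (1 - R2) * fnorm p (Y - T Y) + \<xi> / (1 - R2)"
proof -
  let ?S = "tadjoint p q F"
  note St = tadjoint(1)[OF F, of p q] and adj = tadjoint(2)[OF F]
  have Gt: "G \<in> tensors p" unfolding G by (rule oproj_closed[OF T St])
  have TG: "T G = G" unfolding G by (rule oproj_idem[OF T St])
  \<comment> \<open>\<open>\<beta>\<close> is the step size; if \<open>G = 0\<close> any value gives
    the same \<open>Xh\<close>, and 1 lies between the two bounds. Otherwise the bounds are
    restricted isometry at \<open>G\<close>, which is a tangent vector.\<close>
  obtain \<beta> where \<beta>: "Xh = X - tscale \<beta> G" "\<beta> \<le> 1 / (1 - R2)" "1 / (1 + R2) \<le> \<beta>"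
  proof (cases "G = 0")
    case True
    show ?thesis by (rule that[of 1]) (use R True in \<open>simp_all add: Xh tscale_zero_right\<close>)
  next
    case False
    then have g: "0 < (fnorm p G)\<^sup>2" using fnorm_eq_0[OF Gt] by simp
    have "rip p q F R2 G" using rip2[OF Gt] unfolding TG .
    then have *: "(1 - R2) * (fnorm p G)\<^sup>2 \<le> (fnorm q (F G))\<^sup>2" "(fnorm q (F G))\<^sup>2 \<le> (1 + R2) * (fnorm p G)\<^sup>2"
      by (simp_all add: rip_def)
    have "0 < (1 - R2) * (fnorm p G)\<^sup>2" using g R by simp
    then have h: "0 < (fnorm q (F G))\<^sup>2" using *(1) by linarith
    show ?thesis
    proof (rule that[of "(fnorm p G)\<^sup>2 / (fnorm q (F G))\<^sup>2"])
      show "(fnorm p G)\<^sup>2 / (fnorm q (F G))\<^sup>2 \<le> 1 / (1 - R2)"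
        using * h R by (simp add: field_simps)
      show "1 / (1 + R2) \<le> (fnorm p G)\<^sup>2 / (fnorm q (F G))\<^sup>2"
        using * h R by (simp add: field_simps)
    qed (use False in \<open>simp add: Xh\<close>)
  qed
  show "Xh \<in> tensors p" unfolding \<beta>(1) using X Gt by (intro tensors_diff tensors_tscale)
  have \<beta>0: "0 \<le> \<beta>" using \<beta>(3) R by (smt (verit) divide_nonneg_nonneg)
  have \<beta>1: "\<bar>1 - \<beta>\<bar> \<le> R2 / (1 - R2)"
  proof -
    have "1 / (1 - R2) - 1 = R2 / (1 - R2)" "1 - 1 / (1 + R2) = R2 / (1 + R2)" using R by (simp_all add: field_simps)
    moreover have "R2 / (1 + R2) \<le> R2 / (1 - R2)" using R by (simp add: frac_le)
    ultimately show ?thesis using \<beta>(2,3) by linarith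
  qed
  have \<beta>R: "\<beta> * c \<le> c / (1 - R2)" if "0 \<le> c" for c
    using mult_right_mono[OF \<beta>(2) that] by simp
  define e u v where "e = X - Y" and "u = T e" and "v = e - T e"
  have e: "e \<in> tensors p" unfolding e_def using X Y by (intro tensors_diff)
  have u: "u \<in> tensors p" unfolding u_def by (rule oproj_closed[OF T e])
  have v: "v \<in> tensors p" unfolding v_def using e u unfolding u_def by (rule tensors_diff)
  have Tu: "T u = u" unfolding u_def by (rule oproj_idem[OF T e])
  have v_eq: "v = T Y - Y"
    unfolding v_def e_def oproj_diff[OF T X(1) Y] X(2) by simp
  have TYt: "T Y \<in> tensors p" by (rule oproj_closed[OF T Y])
  have nv: "fnorm p v = fnorm p (Y - T Y)" unfolding v_eq by (rule fnorm_minus_commute)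
  define a where "a = u - tscale \<beta> (T (?S (F u)))"
  define b where "b = T (?S (F v))"
  define c where "c = T (?S E)"
  have at: "a \<in> tensors p" unfolding a_def using u oproj_closed[OF T St] by (intro tensors_diff tensors_tscale)
  have bt: "b \<in> tensors p" unfolding b_def by (rule oproj_closed[OF T St])
  have Ta: "T a = a"
    unfolding a_def oproj_diff[OF T u tensors_tscale[OF oproj_closed[OF T St]]]
      oproj_tscale[OF T oproj_closed[OF T St]] oproj_idem[OF T St] Tu ..
  have Tb: "T b = b" unfolding b_def by (rule oproj_idem[OF T St])
  have G_eq: "G = T (?S (F u)) + b - c"
  proof -
    have "F X - (F Y + E) = F e - E" unfolding e_def tlinear_diff[OF F] by (simp only: diff_diff_eq)
    also have "F e = F u - (0 - F v)"
      unfolding u_def v_def tlinear_diff[OF F] by simp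
    finally have eq: "F X - (F Y + E) = F u - (0 - F v) - E" .
    have S0: "?S 0 = 0" using tadjoint_diff[OF F, of p q 0 0] by simp
    have "?S (F X - (F Y + E)) = ?S (F u) - (0 - ?S (F v)) - ?S E"
      unfolding eq tadjoint_diff[OF F] S0 ..
    then have "?S (F X - (F Y + E)) = ?S (F u) + ?S (F v) - ?S E" by simp
    then show ?thesis unfolding G b_def c_def
      using oproj_diff[OF T tensors_add[OF St[of "F u"] St[of "F v"]] St[of E]]
        oproj_add[OF T St[of "F u"] St[of "F v"]] by simp
  qed
  have split: "Xh - Y = a + (v - tscale \<beta> b) + tscale \<beta> c"
  proof -
    have "Xh - Y = e - tscale \<beta> (T (?S (F u)) + b - c)" unfolding \<beta>(1) G_eq e_def by simp
    also have "e = u + v" unfolding u_def v_def by simp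
    finally show ?thesis unfolding a_def by (simp add: tscale_def fun_eq_iff algebra_simps)
  qed
  \<comment> \<open>Pairing \<open>a\<close> with itself gives \<open>(1 - \<beta>)\<close> times an
    inner product and \<open>\<beta>\<close> times an isometry defect. Each is at most
    \<open>R2 / (1 - R2)\<close> times the norms, whence the factor 2.\<close>
  have na: "fnorm p a \<le> 2 * R2 / (1 - R2) * fnorm p e"
  proof -
    have "\<bar>tinner q (F a) (F u) - tinner p a u\<bar> \<le> R2 * fnorm p a * fnorm p u"
    proof (rule rip_polarized[OF F at u])
      fix s t
      have "tscale s a + tscale t u = T (tscale s a + tscale t u)"
        unfolding oproj_add[OF T tensors_tscale[OF at] tensors_tscale[OF u]] oproj_tscale[OF T at]
          oproj_tscale[OF T u] Ta Tu ..
      then show "rip p q F R2 (tscale s a + tscale t u)"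
        using rip2[OF tensors_add[OF tensors_tscale[OF at] tensors_tscale[OF u], of s t]] by simp
    qed
    moreover have "(fnorm p a)\<^sup>2 = (1 - \<beta>) * tinner p a u - \<beta> * (tinner q (F a) (F u) - tinner p a u)"
    proof -
      have "tinner p a (T (?S (F u))) = tinner q (F a) (F u)"
        using oproj_adj[OF T at St[of "F u"]] adj[OF at, of q "F u"] unfolding Ta by simp
      moreover have "(fnorm p a)\<^sup>2 = tinner p a u - \<beta> * tinner p a (T (?S (F u)))"
        unfolding fnorm_square using arg_cong[OF a_def, of "tinner p a"]
        by (simp only: tinner_diff_right tinner_tscale_right)
      ultimately show ?thesis by (simp add: algebra_simps)
    qed
    moreover have "(1 - \<beta>) * tinner p a u \<le> R2 / (1 - R2) * (fnorm p a * fnorm p u)"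
    proof -
      have "(1 - \<beta>) * tinner p a u \<le> \<bar>1 - \<beta>\<bar> * \<bar>tinner p a u\<bar>" by (simp add: abs_mult[symmetric])
      also have "\<dots> \<le> R2 / (1 - R2) * (fnorm p a * fnorm p u)"
        using \<beta>1 tinner_abs_le[of p a u] R by (intro mult_mono) auto
      finally show ?thesis .
    qed
    moreover have "- (\<beta> * (tinner q (F a) (F u) - tinner p a u)) \<le> R2 / (1 - R2) * (fnorm p a * fnorm p u)"
      if "\<bar>tinner q (F a) (F u) - tinner p a u\<bar> \<le> R2 * fnorm p a * fnorm p u"
    proof -
      have "- (\<beta> * (tinner q (F a) (F u) - tinner p a u)) \<le> \<beta> * (R2 * fnorm p a * fnorm p u)"
        unfolding mult_minus_right[symmetric] using that \<beta>0 by (intro mult_left_mono) auto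
      also have "\<dots> \<le> (R2 * fnorm p a * fnorm p u) / (1 - R2)" using R by (intro \<beta>R) simp
      finally show ?thesis by (simp add: mult.assoc)
    qed
    ultimately have "(fnorm p a)\<^sup>2 \<le> 2 * (R2 / (1 - R2) * (fnorm p a * fnorm p u))" by fastforce
    then have "(fnorm p a)\<^sup>2 \<le> (2 * R2 / (1 - R2) * fnorm p u) * fnorm p a" by (simp add: mult_ac)
    then have "fnorm p a \<le> 2 * R2 / (1 - R2) * fnorm p u"
      using R by (intro fnorm_le_of_square_le) simp_all
    also have "\<dots> \<le> 2 * R2 / (1 - R2) * fnorm p e"
      unfolding u_def using oproj_fnorm_le[OF T e] R by (intro mult_left_mono) simp_all
    finally show ?thesis .
  qed
  \<comment> \<open>\<open>b\<close> is tangent and \<open>v\<close> normal, so their inner product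
    vanishes and only the isometry defect remains. Since \<open>v = T Y - Y\<close>, the span of
    \<open>b\<close> and \<open>v\<close> consists of tangent vectors plus multiples of
    \<open>Y\<close>, where \<open>R3\<close> applies. With the step size this becomes
    \<open>1 + R3 / (1 - R2) = (1 + R3 - R2) / (1 - R2)\<close>.\<close>
  have nb: "fnorm p b \<le> R3 * fnorm p v"
  proof -
    have "\<bar>tinner q (F b) (F v) - tinner p b v\<bar> \<le> R3 * fnorm p b * fnorm p v"
    proof (rule rip_polarized[OF F bt v])
      fix s t
      have "T (tscale s b + tscale t (T Y)) + tscale (- t) Y = tscale s b + tscale t v"
        unfolding oproj_add[OF T tensors_tscale[OF bt] tensors_tscale[OF TYt]] oproj_tscale[OF T bt]
          oproj_tscale[OF T TYt] Tb oproj_idem[OF T Y] v_eq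
        by (simp add: tscale_def fun_eq_iff algebra_simps)
      then show "rip p q F R3 (tscale s b + tscale t v)"
        using rip3[OF tensors_add[OF tensors_tscale[OF bt] tensors_tscale[OF TYt], of s t], of "- t"] by simp
    qed
    moreover have "tinner p b v = 0"
    proof -
      have "T v = 0" unfolding v_def oproj_diff[OF T e oproj_closed[OF T e]] oproj_idem[OF T e] by simp
      then show ?thesis using oproj_adj[OF T bt v] unfolding Tb by (simp only: tinner_zero_right)
    qed
    moreover have "(fnorm p b)\<^sup>2 = tinner q (F b) (F v)"
    proof -
      have "(fnorm p b)\<^sup>2 = tinner p b (T (?S (F v)))" unfolding fnorm_square b_def ..
      also have "\<dots> = tinner p b (?S (F v))" using oproj_adj[OF T bt St[of "F v"]] unfolding Tb by simp
      finally show ?thesis using adj[OF bt, of q "F v"] by simp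
    qed
    ultimately have "(fnorm p b)\<^sup>2 \<le> (R3 * fnorm p v) * fnorm p b" by (simp add: mult_ac)
    then show ?thesis using R3 by (intro fnorm_le_of_square_le) simp_all
  qed
  have "fnorm p (Xh - Y) \<le> fnorm p a + fnorm p (v - tscale \<beta> b) + fnorm p (tscale \<beta> c)"
    unfolding split using fnorm_triangle[of p "a + (v - tscale \<beta> b)" "tscale \<beta> c"]
      fnorm_triangle[of p a "v - tscale \<beta> b"] by linarith
  moreover have "fnorm p (v - tscale \<beta> b) \<le> (1 + R3 - R2) / (1 - R2) * fnorm p v"
  proof -
    have "fnorm p (v - tscale \<beta> b) \<le> fnorm p v + \<beta> * fnorm p b"
      using fnorm_triangle_minus[of p v "tscale \<beta> b"] \<beta>0 by (simp add: fnorm_tscale)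
    also have "\<beta> * fnorm p b \<le> fnorm p b / (1 - R2)" by (rule \<beta>R) simp
    also have "\<dots> \<le> (R3 * fnorm p v) / (1 - R2)" using nb R by (intro divide_right_mono) simp_all
    also have "fnorm p v + R3 * fnorm p v / (1 - R2) = (1 + R3 - R2) / (1 - R2) * fnorm p v"
      using R by (simp add: field_simps)
    finally show ?thesis by simp
  qed
  moreover have "fnorm p (tscale \<beta> c) \<le> \<xi> / (1 - R2)"
  proof -
    have "fnorm p (tscale \<beta> c) \<le> fnorm p c / (1 - R2)"
      unfolding fnorm_tscale abs_of_nonneg[OF \<beta>0] by (rule \<beta>R) simp
    also have "\<dots> \<le> \<xi> / (1 - R2)" using noise R unfolding c_def by (intro divide_right_mono) simp_all
    finally show ?thesis .
  qed
  ultimately show "fnorm p (Xh - Y) \<le> 2 * R2 / (1 - R2) * fnorm p (X - Y)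
      + (1 + R3 - R2) / (1 - R2) * fnorm p (Y - T Y) + \<xi> / (1 - R2)"
    using na unfolding nv e_def by linarith
qed

lemma tlinear_meas: "tlinear (meas n d p A)"
  unfolding tlinear_def
  by (auto simp: meas_def tscale_def fun_eq_iff algebra_simps sum.distrib sum_distrib_left)

text \<open>\<open>LEAST\<close> on the reals yields a valid constant only if the set of such
  constants is nonempty, bounded below and contains its infimum. Boundedness of the map gives the
  first, the nonzero \<open>Z0\<close> the second since it forces \<open>0 \<le> R\<close>, and the
  third holds because both inequalities are affine in \<open>R\<close>.\<close>

lemma trip_const_rip:
  assumes Z0: "Z0 \<in> tensors p" "tucrank_le p Z0 s" "Z0 \<noteq> 0"
  shows "Z \<in> tensors p \<Longrightarrow> tucrank_le p Z s \<Longrightarrow> rip p (n # drop d p) (meas n d p A) (trip_const n d p A s) Z"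
    and "(\<And>Z. Z \<in> tensors p \<Longrightarrow> tucrank_le p Z s \<Longrightarrow> rip p (n # drop d p) (meas n d p A) R Z)
      \<Longrightarrow> trip_const n d p A s \<le> R"
proof -
  let ?q = "n # drop d p" and ?F = "meas n d p A"
  define D where "D = {Z \<in> tensors p. tucrank_le p Z s}"
  define S where "S = {R. \<forall>Z\<in>D. rip p ?q ?F R Z}"
  have tc: "trip_const n d p A s = (LEAST R. R \<in> S)"
    unfolding trip_const_def S_def rip_def D_def by (intro arg_cong[of _ _ Least]) auto
  have z0: "0 < (fnorm p Z0)\<^sup>2" using fnorm_eq_0[OF Z0(1)] Z0(3) by simp
  have Z0D: "Z0 \<in> D" using Z0 by (simp add: D_def)
  have "S \<noteq> {}"
  proof -
    obtain c where c: "0 \<le> c" "\<And>X. X \<in> tensors p \<Longrightarrow> fnorm ?q (?F X) \<le> c * fnorm p X"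
      using tlinear_bounded[OF tlinear_meas] by metis
    \<comment> \<open>With this constant the lower inequality has a nonpositive left side, and the
      upper one follows from boundedness.\<close>
    have "rip p ?q ?F (1 + c\<^sup>2) Z" if "Z \<in> D" for Z
    proof -
      have "(fnorm ?q (?F Z))\<^sup>2 \<le> (c * fnorm p Z)\<^sup>2"
        using c(2)[of Z] that by (intro power_mono) (simp_all add: D_def)
      also have "\<dots> \<le> (1 + (1 + c\<^sup>2)) * (fnorm p Z)\<^sup>2"
        unfolding power_mult_distrib by (intro mult_right_mono) simp_all
      finally show ?thesis
        unfolding rip_def using mult_nonpos_nonneg[of "1 - (1 + c\<^sup>2)" "(fnorm p Z)\<^sup>2"]
        by (smt (verit) zero_le_power2)
    qed
    then show ?thesis by (auto simp: S_def)
  qed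
  have low: "bdd_below S"
  proof
    fix R assume "R \<in> S"
    then have "(1 - R) * (fnorm p Z0)\<^sup>2 \<le> (1 + R) * (fnorm p Z0)\<^sup>2"
      using Z0D unfolding S_def rip_def by fastforce
    then show "0 \<le> R" using z0 by (simp add: mult_le_cancel_right)
  qed
  have lift: "x \<le> Inf S * y" if "\<And>R. R \<in> S \<Longrightarrow> x \<le> R * y" "0 \<le> y" for x y :: real
  proof (cases "y = 0")
    case True
    then show ?thesis using that(1) \<open>S \<noteq> {}\<close> by auto
  next
    case False
    then have "x / y \<le> Inf S" using that \<open>S \<noteq> {}\<close> by (intro cInf_greatest) (auto simp: field_simps)
    then show ?thesis using False that(2) by (simp add: field_simps)
  qed
  have S_iff: "R \<in> S \<longleftrightarrow> (\<forall>Z\<in>D. rip p ?q ?F R Z)" for R by (simp add: S_def)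
  have InfS: "Inf S \<in> S"
    unfolding S_iff
  proof (intro ballI)
    fix Z assume Z: "Z \<in> D"
    have "(fnorm p Z)\<^sup>2 - (fnorm ?q (?F Z))\<^sup>2 \<le> Inf S * (fnorm p Z)\<^sup>2"
      by (rule lift) (use Z in \<open>auto simp: S_iff rip_def algebra_simps\<close>)
    moreover have "(fnorm ?q (?F Z))\<^sup>2 - (fnorm p Z)\<^sup>2 \<le> Inf S * (fnorm p Z)\<^sup>2"
      by (rule lift) (use Z in \<open>auto simp: S_iff rip_def algebra_simps\<close>)
    ultimately show "rip p ?q ?F (Inf S) Z" unfolding rip_def by (simp add: algebra_simps)
  qed
  have eq: "trip_const n d p A s = Inf S"
    unfolding tc by (rule Least_equality[of "\<lambda>R. R \<in> S", OF InfS]) (rule cInf_lower[OF _ low])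
  show "Z \<in> tensors p \<Longrightarrow> tucrank_le p Z s \<Longrightarrow> rip p ?q ?F (trip_const n d p A s) Z"
    using InfS unfolding eq S_iff by (simp add: D_def)
  show "trip_const n d p A s \<le> R" if "\<And>Z. Z \<in> tensors p \<Longrightarrow> tucrank_le p Z s \<Longrightarrow> rip p ?q ?F R Z"
    unfolding eq using that by (intro cInf_lower[OF _ low]) (simp add: S_iff D_def)
qed

section \<open>Tucker rank and best approximation\<close>

lemma tucrank_le_iff:
  "tucrank_le p X s \<longleftrightarrow> length s = length p \<and>
     (\<forall>k<length p. vec_space.rank (p ! k) (matricize p k X) \<le> s ! k)"
  by (auto simp: tucrank_le_def tucrank_def list_all2_conv_all_nth)

context tensor_format
begin

lemma rank_matricize_tscale:
  "vec_space.rank (p ! k) (matricize p k (tscale c X)) \<le> vec_space.rank (p ! k) (matricize p k X)"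
proof -
  have "matricize p k (tscale c X) = matricize p k X * (c \<cdot>\<^sub>m 1\<^sub>m (other_dim p k))"
    unfolding matricize_tscale mult_smult_distrib[OF matricize_carrier one_carrier_mat]
      right_mult_one_mat[OF matricize_carrier] ..
  then show ?thesis using rank_mult_le[OF matricize_carrier[of k X], of "c \<cdot>\<^sub>m 1\<^sub>m (other_dim p k)" "other_dim p k"] by simp
qed

lemma rank_matricize_add:
  "vec_space.rank (p ! k) (matricize p k (X + Y))
    \<le> vec_space.rank (p ! k) (matricize p k X) + vec_space.rank (p ! k) (matricize p k Y)"
  unfolding matricize_add by (rule vec_space.rank_subadditive[OF matricize_carrier matricize_carrier])

lemma rank_matricize_zero: "vec_space.rank (p ! k) (matricize p k 0) = 0"
proof -
  have "matricize p k 0 = 0\<^sub>m (p ! k) (other_dim p k)" by (rule eq_matI) (auto simp: matricize_index)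
  then show ?thesis by (simp add: vec_space.rank_0I)
qed

lemma tucrank_le_tscale: "tucrank_le p X s \<Longrightarrow> tucrank_le p (tscale c X) s"
  unfolding tucrank_le_iff using rank_matricize_tscale le_trans by blast

end

text \<open>Bounded Tucker rank is invariant under scaling, so \<open>W\<close> must be its own best
  multiple. Comparison with \<open>f / w\<close> times \<open>W\<close>, the projection of
  \<open>Z\<close> onto the line through \<open>W\<close>, gives
  \<open>(w - f)\<^sup>2 \<le> 0\<close>.\<close>

lemma best_approx_inner:
  assumes "tensor_format p" and best: "best_approx p s Z W"
  shows "tinner p Z W = (fnorm p W)\<^sup>2"
proof (cases "fnorm p W = 0")
  case True
  then show ?thesis using tinner_abs_le[of p Z W] by simp
next
  case False
  define w f where "w = (fnorm p W)\<^sup>2" and "f = tinner p Z W"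
  have w: "0 < w" using False by (simp add: w_def)
  have sq: "(fnorm p (Z - tscale c W))\<^sup>2 = (fnorm p Z)\<^sup>2 - 2 * c * f + c\<^sup>2 * w" for c
    unfolding w_def f_def fnorm_square tinner_diff_left tinner_diff_right tinner_tscale_left tinner_tscale_right
      tinner_commute[of p W Z] by (simp add: power2_eq_square algebra_simps)
  have "fnorm p (Z - W) \<le> fnorm p (Z - tscale (f / w) W)"
    using best tensor_format.tucrank_le_tscale[OF assms(1)] tensors_tscale unfolding best_approx_def by blast
  then have "(fnorm p (Z - tscale 1 W))\<^sup>2 \<le> (fnorm p (Z - tscale (f / w) W))\<^sup>2"
    unfolding tscale_one by (intro power_mono) simp_all
  then have "w * (w - 2 * f) \<le> w * ((f / w)\<^sup>2 * w - 2 * (f / w) * f)"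
    unfolding sq using w by (intro mult_left_mono) simp_all
  also have "\<dots> = - f\<^sup>2" using w by (simp add: power2_eq_square field_simps)
  finally have "(w - f)\<^sup>2 \<le> 0" by (simp add: power2_eq_square algebra_simps)
  then show ?thesis by (simp add: w_def f_def)
qed

text \<open>\<open>T Z\<close> is itself a competitor, and for both approximations the squared
  residual is the squared norm of \<open>Z\<close> minus that of the approximation. Applied to the
  adjoint image of the noise, this bounds its tangent part by \<open>Emax\<close>.\<close>

lemma best_approx_oproj_le:
  assumes "tensor_format p" and best: "best_approx p s Z W" and Z: "Z \<in> tensors p"
    and T: "oproj p T" "tucrank_le p (T Z) s"
  shows "fnorm p (T Z) \<le> fnorm p W"
proof -
  have "fnorm p (Z - W) \<le> fnorm p (Z - T Z)"
    using best T(2) oproj_closed[OF T(1) Z] unfolding best_approx_def by blast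
  then have "(fnorm p (Z - W))\<^sup>2 \<le> (fnorm p (Z - T Z))\<^sup>2" by (intro power_mono) simp_all
  moreover have "(fnorm p (Z - W))\<^sup>2 = (fnorm p Z)\<^sup>2 - (fnorm p W)\<^sup>2"
    using best_approx_inner[OF assms(1) best] tinner_commute[of p W Z]
    unfolding fnorm_square tinner_diff_left tinner_diff_right by simp
  ultimately have "(fnorm p (T Z))\<^sup>2 \<le> (fnorm p W)\<^sup>2"
    using oproj_pythagoras[OF T(1) Z] by linarith
  then show ?thesis by (rule power2_le_imp_le) simp
qed

section \<open>Convergence of Riemannian gradient descent\<close>

text \<open>\<open>e\<close> is the normal component of the target; it is hidden behind
  \<open>obtains\<close> because it depends on the frame chosen in the step. The case
  \<open>X = Y\<close> is kept apart for use when \<open>lam\<close> is not positive.\<close>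

lemma rgd_step_error:
  assumes fmt: "tensor_format p" and len: "length r = length p"
    and r: "\<And>k. k < length p \<Longrightarrow> 1 \<le> r ! k"
    and X: "X \<in> tensors p" and Y: "Y \<in> tensors p" and rank: "list_all2 (\<le>) (tucrank p Y) r"
    and H: "H = t_hosvd p r \<or> H = st_hosvd p r"
    and step: "rgd_step n d p A (meas n d p A Y + E) r H X X'"
    and R: "0 < R2" "R2 < 1" "0 \<le> R3"
    and rip2: "\<And>Z. Z \<in> tensors p \<Longrightarrow> tucrank_le p Z (map (\<lambda>a. 2 * a) r)
        \<Longrightarrow> rip p (n # drop d p) (meas n d p A) R2 Z"
    and rip3: "\<And>Z. Z \<in> tensors p \<Longrightarrow> tucrank_le p Z (map2 (\<lambda>a b. 2 * a + b) r (tucrank p Y))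
        \<Longrightarrow> rip p (n # drop d p) (meas n d p A) R3 Z"
    and best: "best_approx p (map (\<lambda>a. 2 * a) r) (meas_adj n d p A E) Emax"
    and lam: "\<And>k. k < length p \<Longrightarrow> lam \<le> singular_value (tucrank p Y ! k) (matricize p k Y)"
  obtains e where "X' \<in> tensors p" "X = Y \<Longrightarrow> e = 0" "0 < lam \<Longrightarrow> e \<le> real (length p) * (fnorm p (X - Y))\<^sup>2 / lam"
    and "fnorm p (X' - Y) \<le> (sqrt (real (length p)) + 1) * (2 * R2 / (1 - R2) * fnorm p (X - Y)
        + (1 + R3 - R2) / (1 - R2) * e + fnorm p Emax / (1 - R2))"
proof -
  let ?F = "meas n d p A" and ?q = "n # drop d p"
  interpret tensor_format p by (rule fmt)
  obtain U V G Xh where frame: "tangent_frame p r X U V"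
    and G: "G = tangent_proj p U V (meas_adj n d p A (?F X - (?F Y + E)))"
    and Xh: "Xh = (if G = 0 then X else X - (\<lambda>i. (fnorm p G)\<^sup>2 / (fnorm ?q (?F G))\<^sup>2 * G i))"
    and HX: "H Xh X'" using step unfolding rgd_step_def by blast
  have SVD: "is_SVD (r ! k) (matricize p k X) (U k)" if "k < length p" for k
    using frame that unfolding tangent_frame_def by blast
  obtain S where S: "S \<in> tensors r" "X = mode_prods r U (length p) S"
    and V: "\<And>k. k < length p \<Longrightarrow> V k \<in> orthonormal_mats (other_dim r k) (r ! k)"
    and sub: "\<And>k. k < length p \<Longrightarrow> vec_space.row_space (other_dim r k) (matricize r k S)
        \<subseteq> vec_space.col_space (other_dim r k) (V k)"
    using frame unfolding tangent_frame_def by blast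
  interpret T: tangent_projections p r U V
  proof
    show "U k \<in> orthonormal_mats (p ! k) (r ! k)" if "k < length p" for k
      using is_SVD_orthonormal[OF SVD[OF that]] by simp
    show "0 < r ! k" if "k < length p" for k using r[OF that] by simp
  qed (use len V in simp_all)
  have fixed: "T.Pm k X = X" "T.Wm k X = X" if "k < length p" for k
    using T.tucker_fixed[OF S X that sub[OF that]] by simp_all
  have TX: "T.Tm X = X" using fixed(1) by (intro T.Tm_fixed[OF X])
  have rkT: "tucrank_le p (T.Tm W) (map (\<lambda>a. 2 * a) r)" if "W \<in> tensors p" for W
    unfolding tucrank_le_iff using T.rank_matricize_Tm[OF _ that] len by simp
  have rkTY: "tucrank_le p (T.Tm W + tscale b Y) (map2 (\<lambda>a b. 2 * a + b) r (tucrank p Y))"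
    if W: "W \<in> tensors p" for W b
    unfolding tucrank_le_iff
  proof (intro conjI allI impI)
    show "length (map2 (\<lambda>a b. 2 * a + b) r (tucrank p Y)) = length p" using len by (simp add: tucrank_def)
    fix k assume k: "k < length p"
    have "vec_space.rank (p ! k) (matricize p k (T.Tm W + tscale b Y))
        \<le> 2 * r ! k + vec_space.rank (p ! k) (matricize p k Y)"
      using rank_matricize_add[of k "T.Tm W" "tscale b Y"] T.rank_matricize_Tm[OF k W]
        rank_matricize_tscale[of k b Y] by linarith
    then show "vec_space.rank (p ! k) (matricize p k (T.Tm W + tscale b Y))
        \<le> map2 (\<lambda>a b. 2 * a + b) r (tucrank p Y) ! k"
      using k len by (simp add: tucrank_def)
  qed
  note lin = tlinear_meas[of n d p A]
  have adjE: "tadjoint p ?q ?F E \<in> tensors p" by (rule tadjoint(1)[OF lin])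
  have noise: "fnorm p (T.Tm (tadjoint p ?q ?F E)) \<le> fnorm p Emax"
    using best_approx_oproj_le[OF fmt _ adjE T.oproj_Tm rkT[OF adjE]] best by (simp add: meas_adj_def)
  have G': "G = T.Tm (tadjoint p ?q ?F (?F X - (?F Y + E)))"
    unfolding G T.Tm_def meas_adj_def ..
  have Xh': "Xh = (if G = 0 then X else X - tscale ((fnorm p G)\<^sup>2 / (fnorm ?q (?F G))\<^sup>2) G)"
    unfolding Xh tscale_def ..
  note pgs = projected_gradient_step[OF T.oproj_Tm lin X TX Y R(1,2)
      rip2[OF T.Tm_in_tensors rkT] rip3[OF tensors_add[OF T.Tm_in_tensors tensors_tscale[OF Y]] rkTY]
      R(3) noise G' Xh']
  have "t_hosvd p r Xh X' \<or> st_hosvd p r Xh X'" using H HX by auto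
  note qo = hosvd_quasi_optimal[OF pgs(1) Y len r rank this]
  show ?thesis
  proof (rule that[of "fnorm p (Y - T.Tm Y)"])
    show "X' \<in> tensors p" by (rule qo(1))
    show "fnorm p (Y - T.Tm Y) = 0" if "X = Y" using TX that by simp
    show "fnorm p (Y - T.Tm Y) \<le> real (length p) * (fnorm p (X - Y))\<^sup>2 / lam" if "0 < lam"
      using lam by (intro T.Tm_residual_le[OF X fixed Y that]) (simp_all add: tucrank_def)
    have "(sqrt (real (length p)) + 1) * fnorm p (Xh - Y)
        \<le> (sqrt (real (length p)) + 1) * (2 * R2 / (1 - R2) * fnorm p (X - Y)
        + (1 + R3 - R2) / (1 - R2) * fnorm p (Y - T.Tm Y) + fnorm p Emax / (1 - R2))"
      by (rule mult_left_mono[OF pgs(2)]) (simp_all add: add_nonneg_nonneg)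
    then show "fnorm p (X' - Y) \<le> (sqrt (real (length p)) + 1) * (2 * R2 / (1 - R2) * fnorm p (X - Y)
        + (1 + R3 - R2) / (1 - R2) * fnorm p (Y - T.Tm Y) + fnorm p Emax / (1 - R2))"
      using qo(2) by linarith
  qed
qed

text \<open>The radius \<open>B\<close> is the admissible distance of the initial guess; the induction keeps every iterate
  within \<open>2 * B\<close>, where the quadratic term costs at most a quarter of the error.\<close>

lemma contraction_arith:
  fixes N :: nat
  assumes R: "0 < R2" "R2 \<le> 1 / (8 * (sqrt (real N) + 1) + 1)" "R2 \<le> R3"
    and B: "B = R2 / (real N * (1 + R3 - R2)) * lam" and N: "1 \<le> N" and lam: "0 \<le> lam"
    and e: "0 \<le> e" "e \<le> 2 * B" and res: "e = 0 \<Longrightarrow> res = 0" "0 < lam \<Longrightarrow> res \<le> real N * e\<^sup>2 / lam"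
    and e': "e' \<le> (sqrt (real N) + 1) * (2 * R2 / (1 - R2) * e + (1 + R3 - R2) / (1 - R2) * res + \<xi> / (1 - R2))"
  shows "e' \<le> e / 2 + (sqrt (real N) + 1) / (1 - R2) * \<xi>"
proof -
  define s where "s = sqrt (real N) + 1"
  have s: "1 \<le> s" by (simp add: s_def)
  \<comment> \<open>Rearranged, this says \<open>s * (2 * R2 / (1 - R2)) \<le> 1 / 4\<close>. Both
    the tangent part and the quadratic part are bounded by this multiple of \<open>e\<close>, which
    makes one half in total.\<close>
  have "R2 * (8 * s + 1) \<le> 1" using R(2) s unfolding s_def[symmetric] by (simp add: pos_le_divide_eq)
  then have R8: "8 * (s * R2) \<le> 1 - R2" by (simp add: algebra_simps)
  have R1: "R2 < 1" using R8 R s mult_pos_pos[of s R2] by linarith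
  have lin: "s * (2 * R2 / (1 - R2)) \<le> 1 / 4" using R8 R1 by (simp add: field_simps)
  have K: "0 < 1 + R3 - R2" using R(3) by simp
  have quad: "(1 + R3 - R2) * res \<le> 2 * R2 * e"
  proof (cases "0 < lam")
    case True
    have "(1 + R3 - R2) * res \<le> (1 + R3 - R2) * (real N * e\<^sup>2 / lam)"
      using res(2)[OF True] K by (intro mult_left_mono) simp_all
    also have "\<dots> = ((1 + R3 - R2) * real N / lam * e) * e" by (simp add: power2_eq_square)
    also have "\<dots> \<le> (2 * R2) * e"
    proof (rule mult_right_mono[OF _ e(1)])
      have "(1 + R3 - R2) * real N / lam * e \<le> (1 + R3 - R2) * real N / lam * (2 * B)"
        using e(2) K True by (intro mult_left_mono) simp_all
      \<comment> \<open>The radius \<open>B\<close> is chosen for this cancellation.\<close>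
      also have "\<dots> = 2 * R2"
      proof -
        have gen: "k * z / l * (2 * (b / (z * k) * l)) = 2 * b"
          if "k \<noteq> 0" "l \<noteq> 0" "z \<noteq> 0" for b k l z :: real using that by simp
        show ?thesis unfolding B by (rule gen) (use K N True in simp_all)
      qed
      finally show "(1 + R3 - R2) * real N / lam * e \<le> 2 * R2" .
    qed
    finally show ?thesis .
  next
    \<comment> \<open>Now \<open>lam = 0\<close>, so \<open>B\<close> and with it \<open>e\<close>
      vanish: the iterate already equals the target.\<close>
    case False
    then have "e = 0" using e lam unfolding B by simp
    then show ?thesis using res(1) by simp
  qed
  have "s * ((1 + R3 - R2) / (1 - R2) * res) \<le> s * (2 * R2 / (1 - R2)) * e"
  proof -
    have "s / (1 - R2) * ((1 + R3 - R2) * res) \<le> s / (1 - R2) * (2 * R2 * e)"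
      using quad s R1 by (intro mult_left_mono) simp_all
    then show ?thesis by (simp add: mult_ac)
  qed
  moreover have "s * (2 * R2 / (1 - R2)) * e \<le> 1 / 4 * e" using lin e(1) by (rule mult_right_mono)
  moreover have "e' \<le> s * (2 * R2 / (1 - R2)) * e + s * ((1 + R3 - R2) / (1 - R2) * res) + s / (1 - R2) * \<xi>"
    using e' unfolding s_def[symmetric] by (simp add: algebra_simps)
  moreover have "e' \<le> e / 2 + z" if "b \<le> a" "a \<le> 1 / 4 * e" "e' \<le> a + b + z" for a b z
    using that by linarith
  ultimately show ?thesis unfolding s_def by blast
qed

theorem theorem1:
  fixes d m n N :: nat
    and p r rs :: "nat list"
    and A :: "nat \<Rightarrow> tensor"
    and Xs Y E Emax :: tensor
    and H :: "tensor \<Rightarrow> tensor \<Rightarrow> bool"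
    and X :: "nat \<Rightarrow> tensor"
    and R2 R3 lam :: real
  defines "N \<equiv> d + m"
    and "R2 \<equiv> trip_const n d p A (map (\<lambda>a. 2 * a) r)"
    and "R3 \<equiv> trip_const n d p A (map2 (\<lambda>a b. 2 * a + b) r rs)"
    and "lam \<equiv> Min ((\<lambda>k. singular_value (rs ! k) (matricize p k Xs)) ` {..<N})"
  assumes "1 \<le> d"
    and "length p = N"
    and "\<forall>i<n. A i \<in> tensors (take d p)"
    and "Xs \<in> tensors p"
    and "tucrank p Xs = rs"
    and "E \<in> tensors (n # drop d p)"
    and "Y = meas n d p A Xs + E"
    and "length r = N"
    and "\<forall>k<N. 1 \<le> r ! k \<and> r ! k \<le> p ! k \<and> r ! k \<le> other_dim r k"
    and "list_all2 (\<le>) rs r"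
    and "best_approx p (map (\<lambda>a. 2 * a) r) (meas_adj n d p A E) Emax"
    and "H = t_hosvd p r \<or> H = st_hosvd p r"
    and "rgd_iterates n d p A Y r H X"
    and "trip n d p A (map (\<lambda>a. 2 * a) r)"
    and "0 < R2"
    and "fnorm p (X 0 - Xs) \<le> R2 / (real N * (1 + R3 - R2)) * lam"
    and "R2 \<le> 1 / (8 * (sqrt (real N) + 1) + 1)"
    and "lam \<ge> 2 * (1 + R3 - R2) * (sqrt (real N) + 1) * real N / (R2 * (1 - R2)) * fnorm p Emax"
  shows "(\<forall>t. fnorm p (X t - Xs)
              \<le> (1/2) ^ t * fnorm p (X 0 - Xs)
                + 2 * (sqrt (real N) + 1) / (1 - R2) * fnorm p Emax) \<and>
         (E = 0 \<longrightarrow> (\<forall>t. fnorm p (X t - Xs) \<le> (1/2) ^ t * fnorm p (X 0 - Xs)))"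
proof -
  note rank_Xs = \<open>tucrank p Xs = rs\<close>
  note Y_eq = \<open>Y = meas n d p A Xs + E\<close>
  note r_bounds = \<open>\<forall>k<N. 1 \<le> r ! k \<and> r ! k \<le> p ! k \<and> r ! k \<le> other_dim r k\<close>
  note rs_le = \<open>list_all2 (\<le>) rs r\<close>
  note best = \<open>best_approx p (map (\<lambda>a. 2 * a) r) (meas_adj n d p A E) Emax\<close>
  note H_cases = \<open>H = t_hosvd p r \<or> H = st_hosvd p r\<close>
  note iterates = \<open>rgd_iterates n d p A Y r H X\<close>
  note trip = \<open>trip n d p A (map (\<lambda>a. 2 * a) r)\<close>
  note init_le = \<open>fnorm p (X 0 - Xs) \<le> R2 / (real N * (1 + R3 - R2)) * lam\<close>
  note lam_ge = \<open>lam \<ge> 2 * (1 + R3 - R2) * (sqrt (real N) + 1) * real N / (R2 * (1 - R2)) * fnorm p Emax\<close>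
  have N: "1 \<le> N" and lenp: "length p = N" and lenr: "length r = length p" using assms by simp_all
  have rk: "1 \<le> r ! k" "r ! k \<le> p ! k" if "k < length p" for k
    using r_bounds that unfolding lenp by simp_all
  have fmt: "tensor_format p" using rk by unfold_locales fastforce
  interpret tensor_format p by (rule fmt)
  have iter: "X 0 \<in> tensors p" "tucrank p (X 0) = r" "\<And>t. rgd_step n d p A Y r H (X t) (X (Suc t))"
    using iterates unfolding rgd_iterates_def by blast+
  have rank0: "vec_space.rank (p ! k) (matricize p k (X 0)) = r ! k" if "k < length p" for k
    using arg_cong[OF iter(2), of "\<lambda>l. l ! k"] that by (simp add: tucrank_def)
  \<comment> \<open>The initial tensor is the nonzero witness that makes both restricted isometry
    constants well-behaved.\<close>
  have nz: "X 0 \<noteq> 0"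
  proof
    assume "X 0 = 0"
    then have "r ! 0 = 0" using rank0[of 0] rank_matricize_zero[of 0] N lenp by simp
    then show False using rk(1)[of 0] N lenp by simp
  qed
  have lens: "length rs = length p" using rank_Xs by (auto simp: tucrank_def)
  have le2: "tucrank_le p (X 0) (map (\<lambda>a. 2 * a) r)"
    unfolding tucrank_le_iff using rank0 lenr by simp
  have mono: "tucrank_le p Z (map2 (\<lambda>a b. 2 * a + b) r rs)" if "tucrank_le p Z (map (\<lambda>a. 2 * a) r)" for Z
    using that lenr lens unfolding tucrank_le_iff by (simp add: trans_le_add1)
  note rip2 = trip_const_rip(1)[OF iter(1) le2 nz, of _ n d A, folded R2_def]
    and rip3 = trip_const_rip(1)[OF iter(1) mono[OF le2] nz, of _ n d A, folded R3_def]
  \<comment> \<open>Tensors of rank at most \<open>2 * r\<close> belong to the larger class, so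
    \<open>R3\<close> is valid for them and \<open>R2\<close> is the least such constant.\<close>
  have R23: "R2 \<le> R3"
    unfolding R2_def by (rule trip_const_rip(2)[OF iter(1) le2 nz]) (rule rip3[OF _ mono])
  have R1: "R2 < 1" using trip unfolding trip_def R2_def .
  have K: "0 < 1 + R3 - R2" using R23 by simp
  have R0: "0 < R2" using assms by blast
  define B where "B = R2 / (real N * (1 + R3 - R2)) * lam"
  define \<xi> where "\<xi> = fnorm p Emax"
  define c where "c = (sqrt (real N) + 1) / (1 - R2)"
  have c: "0 < c" using R1 unfolding c_def by (intro divide_pos_pos add_nonneg_pos) simp_all
  have init: "fnorm p (X 0 - Xs) \<le> B" using init_le unfolding B_def .
  have pos: "0 < R2 / (real N * (1 + R3 - R2))" using R0 K N by simp
  \<comment> \<open>The sign is read off the initial bound: a norm is at most a positive multiple of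
    \<open>lam\<close>.\<close>
  have lam0: "0 \<le> lam"
    using init fnorm_nonneg[of p "X 0 - Xs"] pos unfolding B_def by (smt (verit) mult_pos_neg)
  \<comment> \<open>This is the hypothesis on \<open>lam\<close>, multiplied by the factor that
    turns \<open>lam\<close> into \<open>B\<close>.\<close>
  have noise: "2 * c * \<xi> \<le> B"
  proof -
    have "2 * c * \<xi> = R2 / (real N * (1 + R3 - R2))
        * (2 * (1 + R3 - R2) * (sqrt (real N) + 1) * real N / (R2 * (1 - R2)) * fnorm p Emax)"
    proof -
      have gen: "2 * (a / l) * x = b / (z * k) * (2 * k * a * z / (b * l) * x)"
        if "k \<noteq> 0" "l \<noteq> 0" "b \<noteq> 0" "z \<noteq> 0" for a b k l x z :: real
        using that by simp
      show ?thesis unfolding c_def \<xi>_def by (rule gen) (use R0 R1 K N in simp_all)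
    qed
    also have "\<dots> \<le> B" unfolding B_def using pos lam_ge by (intro mult_left_mono) simp_all
    finally show ?thesis .
  qed
  have lam_le: "lam \<le> singular_value (tucrank p Xs ! k) (matricize p k Xs)" if "k < length p" for k
    unfolding lam_def rank_Xs using that lenp by (intro Min_le) auto
  \<comment> \<open>\<open>2 * c * \<xi>\<close> is the fixed point of the recursion
    \<open>e \<mapsto> e / 2 + c * \<xi>\<close>, so the induction keeps this summand unchanged
    while the initial error is halved.\<close>
  have main: "X t \<in> tensors p \<and> fnorm p (X t - Xs) \<le> (1/2) ^ t * fnorm p (X 0 - Xs) + 2 * c * \<xi>" for t
  proof (induction t)
    case 0
    then show ?case using iter(1) c by (simp add: \<xi>_def)
  next
    case (Suc t)
    define e where "e = fnorm p (X t - Xs)"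
    have "(1/2) ^ t * fnorm p (X 0 - Xs) \<le> 1 * fnorm p (X 0 - Xs)"
      by (intro mult_right_mono power_le_one) simp_all
    \<comment> \<open>One \<open>B\<close> comes from the initial error, the other from the
      accumulated noise.\<close>
    then have e2: "e \<le> 2 * B" using Suc init noise unfolding e_def by linarith
    obtain res where res: "X (Suc t) \<in> tensors p" "X t = Xs \<Longrightarrow> res = 0"
      "0 < lam \<Longrightarrow> res \<le> real (length p) * (fnorm p (X t - Xs))\<^sup>2 / lam"
      "fnorm p (X (Suc t) - Xs) \<le> (sqrt (real (length p)) + 1) * (2 * R2 / (1 - R2) * fnorm p (X t - Xs)
        + (1 + R3 - R2) / (1 - R2) * res + fnorm p Emax / (1 - R2))"
    proof (rule rgd_step_error[OF fmt lenr rk(1) conjunct1[OF Suc] \<open>Xs \<in> tensors p\<close> _ H_cases _ R0 R1])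
      show "list_all2 (\<le>) (tucrank p Xs) r" using rank_Xs rs_le by simp
      show "rgd_step n d p A (meas n d p A Xs + E) r H (X t) (X (Suc t))"
        using iter(3)[of t] unfolding Y_eq .
      show "0 \<le> R3" using R0 R23 by simp
      show "rip p (n # drop d p) (meas n d p A) R2 Z"
        if "Z \<in> tensors p" "tucrank_le p Z (map (\<lambda>a. 2 * a) r)" for Z using rip2 that by blast
      show "rip p (n # drop d p) (meas n d p A) R3 Z"
        if "Z \<in> tensors p" "tucrank_le p Z (map2 (\<lambda>a b. 2 * a + b) r (tucrank p Xs))" for Z
        using rip3 that unfolding rank_Xs by blast
    qed (use best lam_le in blast)+
    have "fnorm p (X (Suc t) - Xs) \<le> e / 2 + (sqrt (real N) + 1) / (1 - R2) * \<xi>"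
    proof (rule contraction_arith[OF R0 _ R23 B_def N lam0 _ e2])
      show "R2 \<le> 1 / (8 * (sqrt (real N) + 1) + 1)" using assms by blast
      show "0 \<le> e" by (simp add: e_def)
      show "res = 0" if "e = 0"
        using res(2) fnorm_eq_0[of "X t - Xs" p] that Suc \<open>Xs \<in> tensors p\<close> unfolding e_def by simp
      show "res \<le> real N * e\<^sup>2 / lam" if "0 < lam" using res(3)[OF that] unfolding lenp e_def .
      show "fnorm p (X (Suc t) - Xs) \<le> (sqrt (real N) + 1) * (2 * R2 / (1 - R2) * e
          + (1 + R3 - R2) / (1 - R2) * res + \<xi> / (1 - R2))"
        using res(4) unfolding lenp e_def \<xi>_def .
    qed
    then have "fnorm p (X (Suc t) - Xs) \<le> e / 2 + c * \<xi>" unfolding c_def .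
    also have "e \<le> (1/2) ^ t * fnorm p (X 0 - Xs) + 2 * c * \<xi>" using Suc unfolding e_def by blast
    finally have calc: "fnorm p (X (Suc t) - Xs) \<le> ((1/2) ^ t * fnorm p (X 0 - Xs) + 2 * c * \<xi>) / 2 + c * \<xi>"
      by simp
    have half: "(1/2) ^ Suc t * f = (1/2) ^ t * f / 2" for f :: real by simp
    have "x \<le> (a + 2 * c * z) / 2 + c * z \<Longrightarrow> x \<le> a / 2 + 2 * c * z" for x a z :: real
      by (simp add: field_simps)
    from this[OF calc] show ?case unfolding half by (intro conjI res(1))
  qed
  have conv: "fnorm p (X t - Xs) \<le> (1/2) ^ t * fnorm p (X 0 - Xs) + 2 * (sqrt (real N) + 1) / (1 - R2) * fnorm p Emax" for t
    using main[of t] unfolding c_def \<xi>_def by simp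
  \<comment> \<open>A best approximation of the zero tensor has squared norm equal to its inner
    product with zero.\<close>
  moreover have "fnorm p Emax = 0" if "E = 0"
  proof -
    have "meas_adj n d p A E = 0"
      unfolding meas_adj_def that using tadjoint_diff[OF tlinear_meas, of p "n # drop d p" n d p A 0 0] by simp
    then have "best_approx p (map (\<lambda>a. 2 * a) r) 0 Emax" using best by simp
    from best_approx_inner[OF fmt this] show ?thesis by (simp add: tinner_zero_left)
  qed
  ultimately show ?thesis by fastforce
qed

end
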